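(* Let $f$ be a $C^2$ self map (not assumed invertible) of an $n$-dimensional smooth Riemannian manifold $M$, and let $\Lambda\subset M$ be a locally maximal repeller of $f$ such that $f|\Lambda$ is topologically mixing. Define $\phi:\Lambda\to\mathbb{R}$ by $\phi(x)=-\log|\det Df(x)|$, and $$s=\lim_{k\to\infty}\frac1k\log\left(\max\{\|Df^k(x)\|:x\in\Lambda\}\right).$$ Then $$\overline{\dim}_B\Lambda\le n+\frac{P(\phi)}{s}.$$
   Context: A (locally maximal) repeller of $f$ is a compact invariant set $\Lambda$ ($f(\Lambda)=\Lambda$) such that: $f$ is expanding on $\Lambda$, i.e. there exist $c>0$ and $\lambda\in(1,\infty)$ with $\|Df^k(x)v\|\ge c\lambda^k\|v\|$ for all $x\in\Lambda$, $v\in T_xM$, $k\in\mathbb{N}$; and $\Lambda$ is locally maximal, i.e. there is an open neighborhood $U\subset M$ of $\Lambda$ with $\Lambda=\bigcap_{k\in\mathbb{N}}f^{-k}(U)$, where $\mathbb{N}=\{0,1,2,\dots\}$. $P(\varphi)$ is the topological pressure of a continuous function $\varphi:\Lambda\to\mathbb{R}$ with respect to $f|\Lambda$, and $\overline{\dim}_B$ is upper box (Minkowski) dimension. *)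

theory Defs
  imports "HOL-Analysis.Analysis"
begin

section \<open>Maps of class C^k between open subsets of Euclidean spaces\<close>

text \<open>Only meant for open \<open>S\<close>: derivatives are taken in the full neighbourhood filter.\<close>

primrec Ck_on ::
  "nat \<Rightarrow> ('a::euclidean_space \<Rightarrow> 'b::euclidean_space) \<Rightarrow> 'a set \<Rightarrow> bool" where
  "Ck_on 0 h S \<longleftrightarrow> continuous_on S h"
| "Ck_on (Suc k) h S \<longleftrightarrow>
     (\<forall>x\<in>S. h differentiable (at x)) \<and>
     (\<forall>v. Ck_on k (\<lambda>x. frechet_derivative h (at x) v) S)"

definition smooth_on :: "('a::euclidean_space \<Rightarrow> 'b::euclidean_space) \<Rightarrow> 'a set \<Rightarrow> bool" where
  "smooth_on h S \<longleftrightarrow> (\<forall>k. Ck_on k h S)"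


section \<open>Smooth manifolds\<close>

text \<open>The manifold \<open>M\<close> is a whole type \<open>'m\<close> with its topology (Hausdorff and second
  countable by the sort of \<open>'m\<close>), modelled on \<open>real ^ 'n\<close>.  A chart is a pair of
  its domain and its coordinate map.\<close>

type_synonym ('m, 'n) chart = "'m set \<times> ('m \<Rightarrow> real ^ 'n)"

definition chart_inv :: "('m, 'n) chart \<Rightarrow> real ^ 'n \<Rightarrow> 'm" where
  "chart_inv c = inv_into (fst c) (snd c)"

definition smooth_atlas ::
  "('m::{t2_space,second_countable_topology}, 'n::finite) chart set \<Rightarrow> bool" where
  "smooth_atlas A \<longleftrightarrow>
     (\<forall>c\<in>A. open (fst c) \<and> open (snd c ` fst c) \<and>
        homeomorphism (fst c) (snd c ` fst c) (snd c) (chart_inv c)) \<and>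
     (\<Union>c\<in>A. fst c) = UNIV \<and>
     (\<forall>c\<in>A. \<forall>d\<in>A. smooth_on (snd d \<circ> chart_inv c) (snd c ` (fst c \<inter> fst d)))"

definition Ck_map ::
  "('m::{t2_space,second_countable_topology}, 'n::finite) chart set \<Rightarrow> nat \<Rightarrow> ('m \<Rightarrow> 'm) \<Rightarrow> bool"
where
  "Ck_map A k f \<longleftrightarrow> continuous_on UNIV f \<and>
     (\<forall>c\<in>A. \<forall>d\<in>A. Ck_on k (snd d \<circ> f \<circ> chart_inv c) (snd c ` (fst c \<inter> f -` fst d)))"

text \<open>For every point \<open>x\<close> one chart around \<open>x\<close> is selected, and the tangent space at \<open>x\<close> is
  identified with \<open>real ^ 'n\<close> by means of the coordinate basis of this selected chart.\<close>

definition chart_at :: "('m, 'n) chart set \<Rightarrow> 'm \<Rightarrow> ('m, 'n) chart" where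
  "chart_at A x = (SOME c. c \<in> A \<and> x \<in> fst c)"

text \<open>The differential \<open>Df(x)\<close>, from the tangent space at \<open>x\<close> to the one at \<open>f x\<close>.\<close>

definition mderiv ::
  "('m, 'n::finite) chart set \<Rightarrow> ('m \<Rightarrow> 'm) \<Rightarrow> 'm \<Rightarrow> real ^ 'n \<Rightarrow> real ^ 'n" where
  "mderiv A f x =
     frechet_derivative (snd (chart_at A (f x)) \<circ> f \<circ> chart_inv (chart_at A x))
       (at (snd (chart_at A x) x))"

text \<open>The tangent vector at \<open>x\<close> whose coordinates in an arbitrary chart \<open>c\<close> around \<open>x\<close>
  are given.\<close>

definition tangent_of_coord ::
  "('m, 'n::finite) chart set \<Rightarrow> ('m, 'n) chart \<Rightarrow> 'm \<Rightarrow> real ^ 'n \<Rightarrow> real ^ 'n" where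
  "tangent_of_coord A c x =
     frechet_derivative (snd (chart_at A x) \<circ> chart_inv c) (at (snd c x))"


section \<open>Riemannian metrics\<close>

type_synonym ('m, 'n) metric_tensor = "'m \<Rightarrow> real ^ 'n \<Rightarrow> real ^ 'n \<Rightarrow> real"

text \<open>The selected chart may jump from point to point, so smoothness is required of the
  coefficients of the metric in the charts of the atlas.\<close>

definition riemannian_metric ::
  "('m::{t2_space,second_countable_topology}, 'n::finite) chart set \<Rightarrow>
    ('m, 'n) metric_tensor \<Rightarrow> bool" where
  "riemannian_metric A g \<longleftrightarrow>
     (\<forall>x. bilinear (g x) \<and> (\<forall>v w. g x v w = g x w v) \<and> (\<forall>v. v \<noteq> 0 \<longrightarrow> g x v v > 0)) \<and>
     (\<forall>c\<in>A. \<forall>v w. smooth_on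
        (\<lambda>y. g (chart_inv c y) (tangent_of_coord A c (chart_inv c y) v)
                               (tangent_of_coord A c (chart_inv c y) w))
        (snd c ` fst c))"

definition rnorm :: "('m, 'n) metric_tensor \<Rightarrow> 'm \<Rightarrow> real ^ 'n \<Rightarrow> real" where
  "rnorm g x v = sqrt (g x v v)"

text \<open>Operator norm and absolute value of the determinant of a linear map from the tangent
  space at \<open>x\<close> to the tangent space at \<open>y\<close>.  The latter is computed with respect to
  orthonormal bases, on whose choice it does not depend.\<close>

definition rop_norm ::
  "('m, 'n::finite) metric_tensor \<Rightarrow> 'm \<Rightarrow> 'm \<Rightarrow> (real ^ 'n \<Rightarrow> real ^ 'n) \<Rightarrow> real" where
  "rop_norm g x y L = (SUP v\<in>{v. rnorm g x v = 1}. rnorm g y (L v))"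

definition orthonormal_frame ::
  "('m, 'n::finite) metric_tensor \<Rightarrow> 'm \<Rightarrow> ('n \<Rightarrow> real ^ 'n) \<Rightarrow> bool" where
  "orthonormal_frame g x e \<longleftrightarrow> (\<forall>i j. g x (e i) (e j) = (if i = j then 1 else 0))"

definition rabs_det ::
  "('m, 'n::finite) metric_tensor \<Rightarrow> 'm \<Rightarrow> 'm \<Rightarrow> (real ^ 'n \<Rightarrow> real ^ 'n) \<Rightarrow> real" where
  "rabs_det g x y L = (THE d. \<forall>e e'. orthonormal_frame g x e \<and> orthonormal_frame g y e' \<longrightarrow>
     d = \<bar>det (\<chi> i j. g y (e' i) (L (e j)))\<bar>)"

definition C1_curve_on ::
  "('m::{t2_space,second_countable_topology}, 'n::finite) chart set \<Rightarrow>
    real \<Rightarrow> real \<Rightarrow> (real \<Rightarrow> 'm) \<Rightarrow> bool" where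
  "C1_curve_on A a b \<gamma> \<longleftrightarrow> continuous_on {a..b} \<gamma> \<and>
     (\<forall>c\<in>A.
        (\<forall>t\<in>{a..b} \<inter> \<gamma> -` fst c. (snd c \<circ> \<gamma>) differentiable (at t within {a..b})) \<and>
        continuous_on ({a..b} \<inter> \<gamma> -` fst c)
          (\<lambda>t. vector_derivative (snd c \<circ> \<gamma>) (at t within {a..b})))"

definition piecewise_C1_curve ::
  "('m::{t2_space,second_countable_topology}, 'n::finite) chart set \<Rightarrow> (real \<Rightarrow> 'm) \<Rightarrow> bool" where
  "piecewise_C1_curve A \<gamma> \<longleftrightarrow> path \<gamma> \<and>
     (\<exists>T. finite T \<and> {0, 1} \<subseteq> T \<and> T \<subseteq> {0..1} \<and>
        (\<forall>a\<in>T. \<forall>b\<in>T. a < b \<and> T \<inter> {a<..<b} = {} \<longrightarrow> C1_curve_on A a b \<gamma>))"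

text \<open>The speed is meaningless at the finitely many break points, which are Lebesgue null.\<close>

definition curve_length ::
  "('m, 'n::finite) chart set \<Rightarrow> ('m, 'n) metric_tensor \<Rightarrow> (real \<Rightarrow> 'm) \<Rightarrow> ennreal" where
  "curve_length A g \<gamma> =
     (\<integral>\<^sup>+ t\<in>{0..1}. ennreal (rnorm g (\<gamma> t)
        (vector_derivative (snd (chart_at A (\<gamma> t)) \<circ> \<gamma>) (at t))) \<partial>lborel)"

text \<open>\<open>M\<close> need not be connected; the distance between different components is \<open>\<infinity>\<close>.\<close>

definition rdist ::
  "('m::{t2_space,second_countable_topology}, 'n::finite) chart set \<Rightarrow>
    ('m, 'n) metric_tensor \<Rightarrow> 'm \<Rightarrow> 'm \<Rightarrow> ennreal" where
  "rdist A g x y =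
     (INF \<gamma>\<in>{\<gamma>. piecewise_C1_curve A \<gamma> \<and> pathstart \<gamma> = x \<and> pathfinish \<gamma> = y}.
        curve_length A g \<gamma>)"


section \<open>Upper box dimension\<close>

text \<open>For \<open>\<epsilon> < 1\<close> the infimum is \<open>ln N / ln (1 / \<epsilon>)\<close>, where \<open>N\<close> is the least number of
  \<open>\<epsilon>\<close>-balls that cover \<open>X\<close> (and it is \<open>\<infinity>\<close> if there is no finite cover).\<close>

definition upper_box_dim ::
  "('m::{t2_space,second_countable_topology}, 'n::finite) chart set \<Rightarrow>
    ('m, 'n) metric_tensor \<Rightarrow> 'm set \<Rightarrow> ereal" where
  "upper_box_dim A g X =
     Limsup (at_right 0) (\<lambda>\<epsilon>::real.
       INF F\<in>{F. finite F \<and> X \<subseteq> (\<Union>x\<in>F. {y. rdist A g x y < ennreal \<epsilon>})}.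
         ereal (ln (real (card F)) / ln (1 / \<epsilon>)))"


section \<open>Topological pressure\<close>

definition separated ::
  "('m::{t2_space,second_countable_topology}, 'n::finite) chart set \<Rightarrow>
    ('m, 'n) metric_tensor \<Rightarrow> ('m \<Rightarrow> 'm) \<Rightarrow> nat \<Rightarrow> real \<Rightarrow> 'm set \<Rightarrow> bool" where
  "separated A g f k \<epsilon> E \<longleftrightarrow>
     (\<forall>x\<in>E. \<forall>y\<in>E. x \<noteq> y \<longrightarrow> (\<exists>i<k. rdist A g ((f ^^ i) x) ((f ^^ i) y) > ennreal \<epsilon>))"

text \<open>Bowen's definition for \<open>f\<close> restricted to the invariant compact set \<open>X\<close>.  The monotone
  map \<open>t \<mapsto> ln t / k\<close> is applied inside the supremum, which therefore only ranges over
  nonempty \<open>E\<close> (note \<open>ln 0 = 0\<close>).\<close>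

definition pressure ::
  "('m::{t2_space,second_countable_topology}, 'n::finite) chart set \<Rightarrow>
    ('m, 'n) metric_tensor \<Rightarrow> ('m \<Rightarrow> 'm) \<Rightarrow> 'm set \<Rightarrow> ('m \<Rightarrow> real) \<Rightarrow> ereal" where
  "pressure A g f X \<phi> =
     Lim (at_right 0) (\<lambda>\<epsilon>::real.
       limsup (\<lambda>k.
         SUP E\<in>{E. E \<subseteq> X \<and> finite E \<and> E \<noteq> {} \<and> separated A g f k \<epsilon> E}.
           ereal (ln (\<Sum>x\<in>E. exp (\<Sum>i<k. \<phi> ((f ^^ i) x))) / real k)))"


section \<open>Repellers\<close>

definition expanding_on ::
  "('m, 'n::finite) chart set \<Rightarrow> ('m, 'n) metric_tensor \<Rightarrow> ('m \<Rightarrow> 'm) \<Rightarrow> 'm set \<Rightarrow> bool" where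
  "expanding_on A g f X \<longleftrightarrow>
     (\<exists>c>0. \<exists>\<mu>>1. \<forall>x\<in>X. \<forall>v. \<forall>k.
        rnorm g ((f ^^ k) x) (mderiv A (f ^^ k) x v) \<ge> c * \<mu> ^ k * rnorm g x v)"

definition locally_maximal :: "('m::topological_space \<Rightarrow> 'm) \<Rightarrow> 'm set \<Rightarrow> bool" where
  "locally_maximal f X \<longleftrightarrow> (\<exists>U. open U \<and> X \<subseteq> U \<and> X = (\<Inter>k. (f ^^ k) -` U))"

definition repeller ::
  "('m::{t2_space,second_countable_topology}, 'n::finite) chart set \<Rightarrow>
    ('m, 'n) metric_tensor \<Rightarrow> ('m \<Rightarrow> 'm) \<Rightarrow> 'm set \<Rightarrow> bool" where
  "repeller A g f X \<longleftrightarrow> compact X \<and> X \<noteq> {} \<and> f ` X = X \<and>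
     expanding_on A g f X \<and> locally_maximal f X"

definition topologically_mixing_on :: "('m::topological_space \<Rightarrow> 'm) \<Rightarrow> 'm set \<Rightarrow> bool" where
  "topologically_mixing_on f X \<longleftrightarrow>
     (\<forall>V W. openin (top_of_set X) V \<and> openin (top_of_set X) W \<and> V \<noteq> {} \<and> W \<noteq> {} \<longrightarrow>
        (\<exists>N. \<forall>k\<ge>N. (f ^^ k) ` V \<inter> W \<noteq> {}))"

end

theory Submission
  imports Defs
begin


text \<open>The bound comes from comparing volumes.  Fix a rate \<open>\<sigma> > s\<close> and let \<open>r\<close> be of the order of
  \<open>exp (- k \<sigma>)\<close>.  By the definition of \<open>s\<close> the iterates of \<open>f\<close> of order up to \<open>k\<close> stretch small
  distances at points of \<open>\<Lambda>\<close> by less than \<open>exp (k \<sigma>)\<close>, up to a constant.  Hence a ball of radius \<open>r\<close>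
  around a point of \<open>\<Lambda>\<close> stays close to the orbit of its centre for \<open>k\<close> steps, and the
  \<open>r\<close>-neighbourhood of \<open>\<Lambda>\<close> is contained in the union of the Bowen balls of order \<open>k\<close> around the
  points of a maximal \<open>(k, \<epsilon>)\<close>-separated set \<open>E\<close>.  The map \<open>f\<close> is injective on small balls and its
  Jacobian hardly varies there, so that one application of \<open>f\<close> shows that the volume of the Bowen
  ball around \<open>z\<close> is at most \<open>exp (\<delta> + \<phi> z)\<close> times that of the Bowen ball of order \<open>k - 1\<close> around
  \<open>f z\<close>.  By induction its volume is bounded by a constant times
  \<open>exp (k \<delta> + \<phi> z + \<dots> + \<phi> (f\<^sup>k\<^sup>-\<^sup>1 z))\<close>.  On the other hand disjoint balls with radius of order \<open>r\<close> around
  the points of a maximal \<open>r\<close>-separated subset of \<open>\<Lambda>\<close> have volumes of order \<open>r\<^sup>n\<close> and fit into the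
  same union, so that the number of \<open>r\<close>-balls needed to cover \<open>\<Lambda>\<close> is at most a constant times
  \<open>exp (k \<delta>) / r\<^sup>n\<close> times the sum over \<open>E\<close> which defines the pressure (\<open>covering_number_bound\<close>).
  Taking logarithms and dividing by \<open>ln (1 / r)\<close>, which is about \<open>k \<sigma>\<close>, gives the dimension bound
  \<open>n + (P(\<phi>) + \<delta>) / \<sigma>\<close>; then \<open>\<delta>\<close> tends to \<open>0\<close> and \<open>\<sigma>\<close> to \<open>s\<close>.

  All estimates are made in finitely many charts that cover \<open>\<Lambda>\<close>.  There the Riemannian distance is
  comparable with the Euclidean one (\<open>rdist_lower_bound\<close>, \<open>rdist_upper_bound\<close>), and Lebesgue
  measure serves as volume: the Jacobian of \<open>f\<close> in charts differs from the Riemannian one by a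
  quotient of volume densities at consecutive points (\<open>rabs_det_cderiv\<close>), and these quotients
  telescope along an orbit.  The constants lost in comparing norms of the derivative of \<open>f\<^sup>m\<close> do not
  depend on \<open>m\<close>, so they are absorbed by a large \<open>m\<close> (\<open>near_iterates\<close>).  That \<open>s\<close> is a limit, and
  that it is positive, follows from Fekete's lemma and from expansion (\<open>growth_rate\<close>).\<close>

section \<open>Change of variables for arbitrary finite index types\<close>

text \<open>A well-ordered copy of a finite type.  The change of variables formula concerns
  \<open>real ^ 'k\<close> for a well-ordered \<open>'k\<close>; a permutation of the coordinates carries it over to every
  finite index type.\<close>

typedef (overloaded) 'n ord_index = "{..<CARD('n::finite)}"
  by (rule exI[of _ 0]) simp

instance ord_index :: (finite) finite
proof
  have "(UNIV :: 'a ord_index set) = Abs_ord_index ` {..<CARD('a)}"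
    by (rule type_definition.univ[OF type_definition_ord_index])
  then show "finite (UNIV :: 'a ord_index set)"
    by (rule ssubst) (rule finite_imageI, rule finite_lessThan)
qed

instantiation ord_index :: (finite) linorder
begin

definition less_eq_ord_index :: "'a ord_index \<Rightarrow> 'a ord_index \<Rightarrow> bool" where
  "less_eq_ord_index a b \<longleftrightarrow> Rep_ord_index a \<le> Rep_ord_index b"

definition less_ord_index :: "'a ord_index \<Rightarrow> 'a ord_index \<Rightarrow> bool" where
  "less_ord_index a b \<longleftrightarrow> Rep_ord_index a < Rep_ord_index b"

instance
  by (intro_classes; unfold less_eq_ord_index_def less_ord_index_def Rep_ord_index_inject[symmetric])
    linarith+

end

instance ord_index :: (finite) wellorder
proof
  fix P :: "'a ord_index \<Rightarrow> bool" and a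
  assume step: "\<And>x. (\<And>y. y < x \<Longrightarrow> P y) \<Longrightarrow> P x"
  show "P a"
  proof (induction a rule: measure_induct_rule[of Rep_ord_index])
    case (less x)
    show ?case
      by (rule step, rule less) (simp only: less_ord_index_def)
  qed
qed

lemma card_ord_index: "CARD('n::finite ord_index) = CARD('n)"
  using type_definition.card[OF type_definition_ord_index[where 'n='n]] card_lessThan by (rule trans)

definition to_ord :: "'n::finite \<Rightarrow> 'n ord_index" where
  "to_ord = (SOME h. bij h)"

lemma bij_to_ord: "bij (to_ord :: 'n::finite \<Rightarrow> 'n ord_index)"
proof -
  have "\<exists>h :: 'n \<Rightarrow> 'n ord_index. bij h"
    by (rule finite_same_card_bij) (simp_all add: card_ord_index)
  then show ?thesis unfolding to_ord_def by (rule someI_ex)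
qed

definition reindex :: "real^'n::finite \<Rightarrow> real^'n ord_index" where
  "reindex v = (\<chi> k. v $ inv to_ord k)"

definition unreindex :: "real^'n ord_index \<Rightarrow> real^'n::finite" where
  "unreindex v = (\<chi> k. v $ to_ord k)"

lemma reindex_nth [simp]: "reindex v $ k = v $ inv to_ord k"
  by (simp add: reindex_def)
lemma unreindex_nth [simp]: "unreindex v $ k = v $ to_ord k"
  by (simp add: unreindex_def)
lemma to_ord_inv [simp]: "inv to_ord (to_ord k) = k" "to_ord (inv to_ord j) = j"
  by (simp_all add: inv_f_f[OF bij_is_inj[OF bij_to_ord]] surj_f_inv_f[OF bij_is_surj[OF bij_to_ord]])
lemma unreindex_reindex [simp]: "unreindex (reindex v) = v" "reindex (unreindex w) = w"
  by (simp_all add: vec_eq_iff)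
lemma linear_reindex: "linear reindex" "linear unreindex"
  by (auto intro!: linearI simp: vec_eq_iff)

text \<open>Boxes determine Lebesgue measure, and in this form their volume is visibly invariant under a
  permutation of the coordinates.\<close>

lemma emeasure_lborel_cart_box:
  fixes l u :: "real^'n::finite"
  assumes "\<And>i. l $ i \<le> u $ i"
  shows "emeasure lborel (box l u) = ennreal (\<Prod>i\<in>UNIV. u $ i - l $ i)"
proof -
  have *: "(\<Prod>b\<in>Basis. (u - l) \<bullet> b) = (\<Prod>i\<in>UNIV. u $ i - l $ i)"
    by (simp add: Basis_vec_def prod.UNION_disjoint image_def[symmetric] UNION_singleton_eq_range
        prod.reindex inj_on_def axis_eq_axis inner_axis)
  have "\<And>b. b \<in> Basis \<Longrightarrow> l \<bullet> b \<le> u \<bullet> b"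
    using assms by (auto simp: Basis_vec_def inner_axis)
  then show ?thesis
    using emeasure_lborel_box[of l u] * by simp
qed

lemma distr_unreindex: "distr lborel borel (unreindex :: _ \<Rightarrow> real^'n::finite) = lborel"
proof (rule lborel_eqI[symmetric])
  fix l u :: "real^'n" assume lu: "\<And>b. b \<in> Basis \<Longrightarrow> l \<bullet> b \<le> u \<bullet> b"
  have lu': "l $ i \<le> u $ i" for i
    using lu[of "axis i 1"] by (simp add: inner_axis axis_in_Basis_iff)
  have vi: "unreindex -` box l u = box (reindex l) (reindex u)"
    unfolding box_def Basis_vec_def
    apply (auto simp: inner_axis)
      apply (metis to_ord_inv(2)) apply (metis to_ord_inv(2)) apply (metis to_ord_inv(1))
    by (metis to_ord_inv(1))
  have [measurable]: "(unreindex :: _ \<Rightarrow> real^'n) \<in> borel_measurable borel"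
    by (intro borel_measurable_continuous_onI linear_continuous_on linear_conv_bounded_linear[THEN iffD1] linear_reindex)
  have "emeasure (distr lborel borel unreindex) (box l u) = emeasure lborel (box (reindex l) (reindex u))"
    by (subst emeasure_distr) (auto simp: vi)
  also have "\<dots> = ennreal (\<Prod>i\<in>UNIV. reindex u $ i - reindex l $ i)"
    by (rule emeasure_lborel_cart_box) (simp add: lu')
  also have "(\<Prod>i\<in>UNIV. reindex u $ i - reindex l $ i) = (\<Prod>i\<in>UNIV. u $ i - l $ i)"
    using prod.reindex_bij_betw[OF bij_imp_bij_inv[OF bij_to_ord], of "\<lambda>i. u $ i - l $ i"] by simp
  also have "ennreal \<dots> = emeasure lborel (box l u)"
    by (rule emeasure_lborel_cart_box[symmetric]) (rule lu')
  finally show "emeasure (distr lborel borel unreindex) (box l u) = (\<Prod>b\<in>Basis. (u - l) \<bullet> b)"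
    using emeasure_lborel_box[OF lu] by (simp add: lu)
qed simp

lemma measure_reindex:
  fixes S :: "(real^'n::finite) set"
  assumes "compact S"
  shows "measure lebesgue (reindex ` S) = measure lebesgue S"
proof -
  have [measurable]: "(unreindex :: _ \<Rightarrow> real^'n) \<in> borel_measurable borel"
    by (intro borel_measurable_continuous_onI linear_continuous_on linear_conv_bounded_linear[THEN iffD1] linear_reindex)
  have vi: "reindex ` S = unreindex -` S"
    by (force simp: image_iff)
  have cr: "compact (reindex ` S)"
    by (intro compact_continuous_image assms linear_continuous_on linear_conv_bounded_linear[THEN iffD1] linear_reindex)
  have "measure lebesgue (reindex ` S) = measure lborel (reindex ` S)"
    using cr by (simp add: borel_compact)
  also have "\<dots> = measure (distr lborel borel unreindex) S"
    using assms by (subst measure_distr) (auto simp: vi borel_compact)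
  also have "\<dots> = measure lebesgue S"
    using assms by (simp add: distr_unreindex borel_compact)
  finally show ?thesis .
qed

text \<open>Conjugating a permutation by a bijection preserves its sign, so the Leibniz sums agree.\<close>

lemma det_reindex:
  fixes M :: "real^'n^'n::finite"
  shows "det (\<chi> i j. M $ inv to_ord i $ inv to_ord j) = det M"
proof -
  let ?t = "to_ord :: 'n \<Rightarrow> 'n ord_index"
  let ?c = "\<lambda>p. ?t \<circ> p \<circ> inv ?t"
  have c: "?c p = map_permutation UNIV ?t p" for p
    by (simp add: map_permutation_def restrict_id_def fun_eq_iff bij_is_surj[OF bij_to_ord])
  have sgn: "sign (?c p) = sign p" if "p permutes UNIV" for p
    unfolding c by (rule sign_map_permutation) (use that bij_to_ord in \<open>auto simp: bij_def\<close>)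
  have bij: "bij_betw ?c {p. p permutes UNIV} {p. p permutes UNIV}"
  proof (rule bij_betw_byWitness[where f'="\<lambda>q. inv ?t \<circ> q \<circ> ?t"])
    show "?c ` {p. p permutes UNIV} \<subseteq> {p. p permutes UNIV}"
      using bij_to_ord by (auto simp: bij_imp_bij_inv intro!: bij_imp_permutes bij_comp dest: permutes_bij)
    show "(\<lambda>q. inv ?t \<circ> q \<circ> ?t) ` {p. p permutes UNIV} \<subseteq> {p. p permutes UNIV}"
      using bij_to_ord by (auto simp: bij_imp_bij_inv intro!: bij_imp_permutes bij_comp dest: permutes_bij)
  qed (auto simp: fun_eq_iff)
  have "det (\<chi> i j. M $ inv ?t i $ inv ?t j) =
      (\<Sum>p | p permutes UNIV. of_int (sign (?c p)) * (\<Prod>i\<in>UNIV. M $ inv ?t i $ inv ?t (?c p i)))"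
    unfolding det_def by (subst sum.reindex_bij_betw[OF bij, symmetric]) simp
  also have "\<dots> = (\<Sum>p | p permutes UNIV. of_int (sign p) * (\<Prod>i\<in>UNIV. M $ i $ p i))"
  proof (rule sum.cong[OF refl])
    fix p :: "'n \<Rightarrow> 'n" assume "p \<in> {p. p permutes UNIV}"
    moreover have "(\<Prod>i\<in>UNIV. M $ inv ?t i $ p (inv ?t i)) = (\<Prod>i\<in>UNIV. M $ i $ p i)"
      using prod.reindex_bij_betw[OF bij_imp_bij_inv[OF bij_to_ord], of "\<lambda>i. M $ i $ p i"] by simp
    ultimately show "of_int (sign (?c p)) * (\<Prod>i\<in>UNIV. M $ inv ?t i $ inv ?t (?c p i)) =
        of_int (sign p) * (\<Prod>i\<in>UNIV. M $ i $ p i)"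
      by (simp add: sgn)
  qed
  finally show ?thesis by (simp add: det_def)
qed

text \<open>The measure of the image is the integral of the Jacobian over \<open>S\<close>, because \<open>F\<close> is injective
  there.\<close>

lemma measure_image_ge:
  fixes F :: "real^'n::finite \<Rightarrow> real^'n"
  assumes "compact S"
    and der: "\<And>x. x \<in> S \<Longrightarrow> (F has_derivative F' x) (at x)"
    and inj: "inj_on F S"
    and ge: "\<And>x. x \<in> S \<Longrightarrow> m \<le> \<bar>det (matrix (F' x))\<bar>"
  shows "m * measure lebesgue S \<le> measure lebesgue (F ` S)"
proof -
  let ?F = "reindex \<circ> F \<circ> unreindex" and ?S = "reindex ` S"
  let ?D = "\<lambda>y. reindex \<circ> F' (unreindex y) \<circ> unreindex"
  have bl: "bounded_linear (reindex :: real^'n \<Rightarrow> _)" "bounded_linear (unreindex :: _ \<Rightarrow> real^'n)"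
    using linear_reindex by (auto simp: linear_conv_bounded_linear)
  have cS: "compact ?S"
    by (intro compact_continuous_image assms linear_continuous_on bl)
  have der': "(?F has_derivative ?D y) (at y within ?S)" if "y \<in> ?S" for y
  proof (rule has_derivative_at_withinI)
    have "unreindex y \<in> S" using that by auto
    then have "(F has_derivative F' (unreindex y)) (at (unreindex y))" by (rule der)
    then show "(?F has_derivative ?D y) (at y)"
      using bl by (intro diff_chain_at bounded_linear_imp_has_derivative) 
  qed
  have detD: "det (matrix (?D y)) = det (matrix (F' (unreindex y)))" if "y \<in> ?S" for y
  proof -
    have "unreindex (axis j 1) = (axis (inv to_ord j) 1 :: real^'n)" for j
      by (auto simp: vec_eq_iff axis_def)
    then have "matrix (?D y) = (\<chi> i j. matrix (F' (unreindex y)) $ inv to_ord i $ inv to_ord j)"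
      by (simp add: matrix_def)
    then show ?thesis by (simp add: det_reindex)
  qed
  have inj': "inj_on ?F ?S"
    using inj unfolding inj_on_def by (metis comp_apply imageE unreindex_reindex(1))
  have contF: "continuous_on S F"
    using der by (meson continuous_at_imp_continuous_on has_derivative_continuous)
  have im: "?F ` ?S = reindex ` F ` S"
    by (auto simp: image_comp o_def)
  have cF: "compact (F ` S)" by (intro compact_continuous_image contF assms)
  have cFS: "compact (?F ` ?S)"
    unfolding im by (intro compact_continuous_image linear_continuous_on bl cF)
  have "((\<lambda>y. \<bar>det (matrix (?D y))\<bar>) has_integral measure lebesgue (?F ` ?S)) ?S"
    using has_measure_differentiable_image[OF _ der' inj', of "measure lebesgue (?F ` ?S)"] cS cFS
    by (auto simp: lmeasurable_compact fmeasurableD)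
  note J = this
  have I: "((\<lambda>y. m) has_integral m * measure lebesgue ?S) ?S"
    using has_integral_mult_right[of "\<lambda>x. 1" "measure lebesgue ?S" ?S m] lmeasurable_compact[OF cS]
    by (simp add: lmeasurable_iff_integrable_on lmeasure_integral has_integral_integral)
  have "m * measure lebesgue ?S \<le> measure lebesgue (?F ` ?S)"
    by (rule has_integral_le[OF I J]) (use ge detD in auto)
  then show ?thesis
    by (simp only: im measure_reindex[OF assms(1)] measure_reindex[OF cF])
qed


section \<open>Uniformity on compact sets\<close>

lemma eventually_at_right_0_iff:
  "eventually P (at_right (0::real)) \<longleftrightarrow> (\<exists>b>0. \<forall>y. 0 < y \<and> y < b \<longrightarrow> P y)"
  by (subst eventually_at_right[of 0 1]) auto

lemma eventually_at_right_0_mono: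
  assumes "0 < e" "P e" and mono: "\<And>x y. 0 < x \<Longrightarrow> x \<le> y \<Longrightarrow> P y \<Longrightarrow> P x"
  shows "eventually P (at_right (0::real))"
  unfolding eventually_at_right_0_iff using assms by (meson less_imp_le)

text \<open>If a property of sets that passes to subsets holds for a small ball around every point of a
  compact set, then it holds for all balls of one radius: take a Lebesgue number of the cover.  This
  is the source of the uniform radii below.\<close>

lemma uniform_on_compact:
  fixes Q :: "'a::metric_space set"
  assumes "compact Q"
    and local: "\<And>z. z \<in> Q \<Longrightarrow> \<exists>r>0. P (ball z r)"
    and mono: "\<And>S T. P T \<Longrightarrow> S \<subseteq> T \<Longrightarrow> P S"
  shows "eventually (\<lambda>r. \<forall>z\<in>Q. P (cball z r)) (at_right 0)"
proof -
  obtain \<rho> where \<rho>: "\<And>z. z \<in> Q \<Longrightarrow> \<rho> z > 0 \<and> P (ball z (\<rho> z))"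
    using local by metis
  obtain e where e: "0 < e" "\<And>z. z \<in> Q \<Longrightarrow> \<exists>G\<in>(\<lambda>z. ball z (\<rho> z)) ` Q. ball z e \<subseteq> G"
    by (rule Heine_Borel_lemma[OF \<open>compact Q\<close>, of "(\<lambda>z. ball z (\<rho> z)) ` Q"]) (use \<rho> in auto)
  have "P (cball z r)" if "z \<in> Q" "r < e" for z r
  proof -
    obtain w where w: "w \<in> Q" "ball z e \<subseteq> ball w (\<rho> w)"
      using e(2)[OF \<open>z \<in> Q\<close>] by auto
    have "cball z r \<subseteq> ball z e"
      using \<open>r < e\<close> by auto
    then show ?thesis
      using mono \<rho>[OF w(1)] w(2) by (meson order_trans)
  qed
  then show ?thesis
    unfolding eventually_at_right_0_iff using e(1) by blast
qed

section \<open>Continuously differentiable maps between Euclidean spaces\<close>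

definition C1_on :: "('a::euclidean_space \<Rightarrow> 'b::euclidean_space) \<Rightarrow> 'a set \<Rightarrow> bool" where
  "C1_on h S \<longleftrightarrow> (\<forall>x\<in>S. h differentiable (at x)) \<and>
     (\<forall>v. continuous_on S (\<lambda>x. frechet_derivative h (at x) v))"

lemma Ck_on_1_iff: "Ck_on 1 h S \<longleftrightarrow> C1_on h S"
  unfolding One_nat_def C1_on_def by simp

lemma Ck_on_SucD: "Ck_on (Suc k) h S \<Longrightarrow> Ck_on k h S"
proof (induction k arbitrary: h)
  case 0
  then show ?case
    by (simp add: continuous_at_imp_continuous_on differentiable_imp_continuous_within)
next
  case (Suc k)
  then show ?case by simp
qed

lemma smooth_on_continuous_on: "smooth_on h S \<Longrightarrow> continuous_on S h"
  unfolding smooth_on_def by (metis Ck_on.simps(1))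

lemma C1_on_has_derivative:
  "C1_on h S \<Longrightarrow> x \<in> S \<Longrightarrow> (h has_derivative frechet_derivative h (at x)) (at x)"
  unfolding C1_on_def using frechet_derivative_works by blast

lemma C1_on_continuous_on: "C1_on h S \<Longrightarrow> continuous_on S h"
  unfolding C1_on_def
  by (simp add: continuous_at_imp_continuous_on differentiable_imp_continuous_within)

lemma linear_sum_Basis:
  fixes L :: "'a::euclidean_space \<Rightarrow> 'b::real_vector"
  assumes "linear L" shows "L w = (\<Sum>b\<in>Basis. (w \<bullet> b) *\<^sub>R L b)"
proof -
  have "L w = L (\<Sum>b\<in>Basis. (w \<bullet> b) *\<^sub>R b)" by (simp add: euclidean_representation)
  also have "\<dots> = (\<Sum>b\<in>Basis. (w \<bullet> b) *\<^sub>R L b)"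
    using assms by (simp add: linear_sum linear_scale)
  finally show ?thesis .
qed

lemma onorm_le_sum_Basis:
  fixes L :: "'a::euclidean_space \<Rightarrow> 'b::euclidean_space"
  assumes "linear L" shows "onorm L \<le> (\<Sum>b\<in>Basis. norm (L b))"
proof (rule onorm_le)
  fix w
  have "norm (L w) \<le> (\<Sum>b\<in>Basis. norm ((w \<bullet> b) *\<^sub>R L b))"
    unfolding linear_sum_Basis[OF assms, of w] by (rule norm_sum)
  also have "\<dots> \<le> (\<Sum>b\<in>Basis. norm (L b) * norm w)"
    by (rule sum_mono) (auto simp: mult.commute[of _ "norm (L _)"] intro!: mult_left_mono Basis_le_norm)
  finally show "norm (L w) \<le> (\<Sum>b\<in>Basis. norm (L b)) * norm w"
    by (simp add: sum_distrib_right)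
qed

text \<open>In finite dimension, continuity of \<open>x \<mapsto> Df(x) v\<close> for every \<open>v\<close> gives continuity of \<open>Df\<close> in the
  operator norm, which is dominated by the sum over a basis.\<close>

lemma C1_on_tendsto_onorm:
  fixes h :: "'a::euclidean_space \<Rightarrow> 'b::euclidean_space"
  assumes "C1_on h S" "open S" "z \<in> S" "0 < e"
  shows "\<exists>r>0. ball z r \<subseteq> S \<and>
    (\<forall>y\<in>ball z r. onorm (\<lambda>v. frechet_derivative h (at y) v - frechet_derivative h (at z) v) < e)"
proof -
  let ?D = "\<lambda>y. frechet_derivative h (at y)"
  have lin: "linear (?D y)" if "y \<in> S" for y
    using that assms(1) by (simp add: C1_on_def linear_frechet_derivative)
  have "((\<lambda>y. ?D y b) \<longlongrightarrow> ?D z b) (at z)" for b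
    using assms by (metis C1_on_def continuous_on_eq_continuous_at isCont_def)
  then have "((\<lambda>y. \<Sum>b\<in>Basis. norm (?D y b - ?D z b)) \<longlongrightarrow> (\<Sum>b\<in>(Basis::'a set). norm (?D z b - ?D z b))) (at z)"
    by (intro tendsto_intros)
  then have "eventually (\<lambda>y. (\<Sum>b\<in>Basis. norm (?D y b - ?D z b)) < e) (at z)"
    using \<open>0 < e\<close> by (auto dest: order_tendstoD)
  then obtain r1 where r1: "0 < r1"
      "\<And>y. y \<noteq> z \<Longrightarrow> dist y z < r1 \<Longrightarrow> (\<Sum>b\<in>Basis. norm (?D y b - ?D z b)) < e"
    unfolding eventually_at by auto
  obtain r2 where r2: "0 < r2" "ball z r2 \<subseteq> S"
    using assms open_contains_ball by metis
  have "onorm (\<lambda>v. ?D y v - ?D z v) < e" if "y \<in> ball z (min r1 r2)" for y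
  proof -
    have "y \<in> S" using that r2 by auto
    have "linear (\<lambda>v. ?D y v - ?D z v)"
      by (intro linear_compose_sub lin \<open>y \<in> S\<close> assms)
    then have "onorm (\<lambda>v. ?D y v - ?D z v) \<le> (\<Sum>b\<in>Basis. norm (?D y b - ?D z b))"
      by (rule onorm_le_sum_Basis)
    also have "\<dots> < e"
      using r1(2)[of y] that \<open>0 < e\<close> by (cases "y = z") (auto simp: dist_commute)
    finally show ?thesis .
  qed
  then show ?thesis using r1(1) r2
    by (intro exI[of _ "min r1 r2"]) auto
qed

lemma C1_on_compose:
  fixes h1 :: "'a::euclidean_space \<Rightarrow> 'b::euclidean_space" and h2 :: "'b \<Rightarrow> 'c::euclidean_space"
  assumes 1: "C1_on h1 S" and 2: "C1_on h2 T" and "h1 ` S \<subseteq> T"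
  shows "C1_on (h2 \<circ> h1) S"
proof -
  let ?D1 = "\<lambda>y. frechet_derivative h1 (at y)" and ?D2 = "\<lambda>y. frechet_derivative h2 (at y)"
  have d: "frechet_derivative (h2 \<circ> h1) (at y) v = (\<Sum>b\<in>Basis. (?D1 y v \<bullet> b) *\<^sub>R ?D2 (h1 y) b)"
    if "y \<in> S" for y v
  proof -
    have "h1 y \<in> T" using that assms(3) by auto
    then have lin: "linear (?D2 (h1 y))" using 2 by (simp add: C1_on_def linear_frechet_derivative)
    have "frechet_derivative (h2 \<circ> h1) (at y) = ?D2 (h1 y) \<circ> ?D1 y"
      using \<open>h1 y \<in> T\<close> that 1 2 by (simp add: C1_on_def frechet_derivative_compose)
    then show ?thesis using linear_sum_Basis[OF lin, of "?D1 y v"] by simp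
  qed
  have "continuous_on S (\<lambda>y. \<Sum>b\<in>Basis. (?D1 y v \<bullet> b) *\<^sub>R ?D2 (h1 y) b)" for v
  proof -
    have "continuous_on S (\<lambda>y. ?D2 (h1 y) b)" for b
      by (rule continuous_on_compose2[OF _ C1_on_continuous_on[OF 1] assms(3)])
        (use 2 in \<open>simp add: C1_on_def\<close>)
    moreover have "continuous_on S (\<lambda>y. ?D1 y v)" using 1 by (simp add: C1_on_def)
    ultimately show ?thesis by (intro continuous_intros)
  qed
  then have "continuous_on S (\<lambda>y. frechet_derivative (h2 \<circ> h1) (at y) v)" for v
    by (subst continuous_on_cong[OF refl d]) auto
  moreover have "(h2 \<circ> h1) differentiable (at y)" if "y \<in> S" for y
    using that 1 2 assms(3) unfolding C1_on_def by (intro differentiable_chain_at) auto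
  ultimately show ?thesis unfolding C1_on_def by blast
qed

lemma C1_on_open_cong:
  assumes "C1_on h S" "open S" "\<And>x. x \<in> S \<Longrightarrow> h' x = h x"
  shows "C1_on h' S"
proof -
  have d: "(h' has_derivative frechet_derivative h (at x)) (at x)" if "x \<in> S" for x
    using has_derivative_transform_within_open[OF C1_on_has_derivative[OF assms(1) that] assms(2) that] assms(3)
    by simp
  then have "frechet_derivative h' (at x) = frechet_derivative h (at x)" if "x \<in> S" for x
    using frechet_derivative_at that by metis
  then show ?thesis
    using assms(1) d unfolding C1_on_def differentiable_def
    by (auto cong: continuous_on_cong)
qed

lemma C1_on_local:
  assumes "\<And>x. x \<in> S \<Longrightarrow> \<exists>T. open T \<and> x \<in> T \<and> T \<subseteq> S \<and> C1_on h T"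
  shows "C1_on h S"
  unfolding C1_on_def
proof (intro conjI ballI allI)
  fix x assume "x \<in> S"
  then show "h differentiable (at x)" using assms unfolding C1_on_def by blast
next
  fix v
  show "continuous_on S (\<lambda>x. frechet_derivative h (at x) v)"
  proof (rule continuous_at_imp_continuous_on, rule ballI)
    fix x assume "x \<in> S"
    then show "isCont (\<lambda>x. frechet_derivative h (at x) v) x"
      using assms unfolding C1_on_def by (meson continuous_on_eq_continuous_at)
  qed
qed

text \<open>The mean value inequality on balls so small that the derivative varies by less than \<open>e\<close>.\<close>

lemma C1_on_Lipschitz_uniform:
  fixes h :: "'a::euclidean_space \<Rightarrow> 'b::euclidean_space"
  assumes C1: "C1_on h S" and "open S" "compact Q" "Q \<subseteq> S" "0 < e"
  shows "eventually (\<lambda>r. \<forall>z\<in>Q. cball z r \<subseteq> S \<and> (\<forall>y\<in>cball z r.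
      norm (h y - h z) \<le> (onorm (frechet_derivative h (at z)) + e) * norm (y - z))) (at_right 0)"
proof -
  let ?D = "\<lambda>y. frechet_derivative h (at y)"
  define P where "P B \<longleftrightarrow> B \<subseteq> S \<and> (\<forall>z\<in>B. \<forall>y\<in>B.
      norm (h y - h z) \<le> (onorm (?D z) + e) * norm (y - z))" for B
  have "eventually (\<lambda>r. \<forall>z\<in>Q. P (cball z r)) (at_right 0)"
  proof (rule uniform_on_compact[OF \<open>compact Q\<close>])
    fix z0 assume "z0 \<in> Q"
    then have "z0 \<in> S" using assms by auto
    obtain r where r: "0 < r" "ball z0 r \<subseteq> S"
        "\<And>y. y \<in> ball z0 r \<Longrightarrow> onorm (\<lambda>v. ?D y v - ?D z0 v) < e/2"
      using C1_on_tendsto_onorm[OF C1 \<open>open S\<close> \<open>z0 \<in> S\<close>, of "e/2"] \<open>0 < e\<close> by auto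
    have bl: "bounded_linear (?D y)" if "y \<in> S" for y
      using C1_on_has_derivative[OF C1 that] by (rule has_derivative_bounded_linear)
    have tri: "onorm (?D y) \<le> onorm (?D z) + e" if "y \<in> ball z0 r" "z \<in> ball z0 r" for y z
    proof -
      have b: "bounded_linear (?D y)" "bounded_linear (?D z)" "bounded_linear (?D z0)"
        using bl that r(2) \<open>z0 \<in> S\<close> by auto
      have "onorm (\<lambda>v. ?D z0 v - ?D z v) = onorm (\<lambda>v. ?D z v - ?D z0 v)"
        using onorm_neg[of "\<lambda>v. ?D z v - ?D z0 v"] by simp
      then have s: "onorm (\<lambda>v. ?D y v - ?D z0 v) < e/2" "onorm (\<lambda>v. ?D z0 v - ?D z v) < e/2"
        using r(3) that by auto
      have "?D y = (\<lambda>v. (?D y v - ?D z0 v) + ((?D z0 v - ?D z v) + ?D z v))" by auto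
      then have "onorm (?D y) = onorm (\<lambda>v. (?D y v - ?D z0 v) + ((?D z0 v - ?D z v) + ?D z v))"
        by simp
      also have "\<dots> \<le> onorm (\<lambda>v. ?D y v - ?D z0 v) + onorm (\<lambda>v. (?D z0 v - ?D z v) + ?D z v)"
        by (intro onorm_triangle bounded_linear_sub bounded_linear_add b)
      also have "onorm (\<lambda>v. (?D z0 v - ?D z v) + ?D z v) \<le> onorm (\<lambda>v. ?D z0 v - ?D z v) + onorm (?D z)"
        by (intro onorm_triangle bounded_linear_sub b)
      finally show ?thesis using s by linarith
    qed
    have "norm (h y - h z) \<le> (onorm (?D z) + e) * norm (y - z)"
      if "y \<in> ball z0 r" "z \<in> ball z0 r" for y z
    proof (rule differentiable_bound[OF convex_ball _ _ that, where f'="?D"])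
      show "(h has_derivative ?D x) (at x within ball z0 r)" if "x \<in> ball z0 r" for x
        by (rule has_derivative_at_withinI, rule C1_on_has_derivative[OF C1]) (use that r(2) in blast)
      show "onorm (?D x) \<le> onorm (?D z) + e" if "x \<in> ball z0 r" for x
        using tri that \<open>z \<in> ball z0 r\<close> by auto
    qed
    then show "\<exists>r>0. P (ball z0 r)"
      unfolding P_def using r by blast
  qed (auto simp: P_def)
  moreover have "eventually (\<lambda>r::real. 0 < r) (at_right 0)"
    by (simp add: eventually_at_right_less)
  ultimately show ?thesis
    by eventually_elim (auto simp: P_def)
qed

text \<open>The injectivity part of the inverse function theorem, with a uniform radius.\<close>

lemma C1_on_inj_uniform:
  fixes h :: "real^'n::finite \<Rightarrow> real^'n"
  assumes C1: "C1_on h S" and "open S" "compact Q" "Q \<subseteq> S"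
    and inj: "\<And>z. z \<in> Q \<Longrightarrow> inj (frechet_derivative h (at z))"
  shows "eventually (\<lambda>r. \<forall>z\<in>Q. inj_on h (cball z r)) (at_right 0)"
proof (rule uniform_on_compact[OF \<open>compact Q\<close>])
  fix z assume "z \<in> Q"
  then have "z \<in> S" using assms by auto
  let ?D = "\<lambda>y. frechet_derivative h (at y)"
  have "linear (?D z)" using \<open>z \<in> S\<close> C1 by (simp add: C1_on_def linear_frechet_derivative)
  then obtain g' where g': "linear g'" "g' \<circ> ?D z = id"
    using linear_injective_left_inverse inj[OF \<open>z \<in> Q\<close>] by blast
  have bl: "bounded_linear g'" using g' by (simp add: linear_conv_bounded_linear)
  have close: "\<exists>d>0. \<forall>x. dist z x < d \<longrightarrow> onorm (\<lambda>v. ?D x v - ?D z v) < e" if "0 < e" for e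
    using C1_on_tendsto_onorm[OF C1 \<open>open S\<close> \<open>z \<in> S\<close> that] by (metis mem_ball)
  obtain r where "0 < r" "inj_on h (ball z r)"
    using has_derivative_locally_injective[where f=h and f'="?D" and g'=g',
        OF \<open>z \<in> S\<close> \<open>open S\<close> bl g'(2) C1_on_has_derivative[OF C1] close] by blast
  then show "\<exists>r>0. inj_on h (ball z r)" by blast
qed (auto simp: inj_on_def)

lemma C1_on_continuous_det:
  fixes h :: "real^'n::finite \<Rightarrow> real^'n"
  assumes "C1_on h S"
  shows "continuous_on S (\<lambda>x. det (matrix (frechet_derivative h (at x))))"
  unfolding matrix_def det_def vec_lambda_beta
  by (intro continuous_intros) (use assms in \<open>auto simp: C1_on_def\<close>)

lemma positive_distortion_uniform:
  fixes F :: "'a::metric_space \<Rightarrow> real"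
  assumes "continuous_on S F" "open S" "compact Q" "Q \<subseteq> S" "0 < e" "\<And>z. z \<in> Q \<Longrightarrow> 0 < F z"
  shows "eventually (\<lambda>r. \<forall>z\<in>Q. \<forall>y\<in>cball z r. exp (- e) * F z \<le> F y) (at_right 0)"
proof -
  have "eventually (\<lambda>r. \<forall>z\<in>Q. \<forall>x\<in>cball z r. \<forall>y\<in>cball z r. exp (- e) * F x \<le> F y) (at_right 0)"
  proof (rule uniform_on_compact[OF \<open>compact Q\<close>])
    fix z assume "z \<in> Q"
    then have z: "z \<in> S" "0 < F z" using assms by auto
    then have "isCont F z" using assms by (simp add: continuous_on_eq_continuous_at)
    then have t: "(F \<longlongrightarrow> F z) (nhds z)"
      by (simp add: isCont_def tendsto_at_iff_tendsto_nhds)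
    have lo: "exp (- (e/2)) * F z < F z" and hi: "F z < exp (e/2) * F z"
      using z \<open>0 < e\<close> by (simp_all add: mult_less_cancel_right2 mult_less_cancel_right1)
    have "eventually (\<lambda>x. exp (- (e/2)) * F z < F x \<and> F x < exp (e/2) * F z) (nhds z)"
      using order_tendstoD[OF t] lo hi by (simp add: eventually_conj_iff)
    then obtain r where r: "0 < r"
        "\<And>x. dist x z < r \<Longrightarrow> exp (- (e/2)) * F z < F x \<and> F x < exp (e/2) * F z"
      unfolding eventually_nhds_metric by auto
    have "exp (- e) * F x \<le> F y" if "x \<in> ball z r" "y \<in> ball z r" for x y
    proof -
      have "exp (- e) * F x \<le> exp (- e) * (exp (e/2) * F z)"
        using r(2)[of x] that by (intro mult_left_mono) (auto simp: dist_commute)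
      also have "\<dots> = exp (- (e/2)) * F z"
        by (simp add: mult.assoc[symmetric] exp_add[symmetric])
      also have "\<dots> \<le> F y" using r(2)[of y] that by (auto simp: dist_commute)
      finally show ?thesis .
    qed
    then show "\<exists>r>0. \<forall>x\<in>ball z r. \<forall>y\<in>ball z r. exp (- e) * F x \<le> F y"
      using r(1) by blast
  qed blast
  moreover have "eventually (\<lambda>r::real. 0 < r) (at_right 0)"
    by (simp add: eventually_at_right_less)
  ultimately show ?thesis
    by eventually_elim auto
qed

section \<open>Fekete's lemma\<close>

lemma subadditive_bound:
  fixes a :: "nat \<Rightarrow> real"
  assumes sub: "\<And>j k. a (j + k) \<le> a j + a k"
  shows "a (q * m + l) \<le> real q * a m + a l"
proof (induction q)
  case (Suc q)
  have "a (Suc q * m + l) \<le> a m + a (q * m + l)"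
    using sub[of m "q * m + l"] by (simp add: add.assoc)
  with Suc show ?case by (simp add: algebra_simps)
qed simp

text \<open>Write \<open>k = q m + l\<close> with \<open>l < m\<close>: subadditivity bounds \<open>a k / k\<close> by \<open>a m / m\<close> up to an error of
  order \<open>1 / k\<close>, so that the limit is the infimum of the quotients.  The lower bound keeps this
  infimum finite; it is stated with \<open>Suc k\<close> to cover \<open>k = 0\<close> as well.\<close>

lemma Fekete_limit:
  fixes a :: "nat \<Rightarrow> real"
  assumes sub: "\<And>j k. a (j + k) \<le> a j + a k"
    and lower: "\<And>k. c \<le> a k / real (Suc k)" 
  shows "convergent (\<lambda>k. a k / real k)"
proof -
  define L where "L = (INF k\<in>{1..}. a k / real k)"
  have below: "min c (2*c) \<le> a k / real k" if "k \<ge> 1" for k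
  proof -
    have "c * real (Suc k) \<le> a k" using lower[of k] by (simp add: field_simps)
    moreover have "min c (2*c) * real k \<le> c * real (Suc k)"
    proof (cases "c \<ge> 0")
      case True then show ?thesis by (simp add: algebra_simps)
    next
      case False
      then have "c * 1 \<ge> c * real k" using that by (intro mult_left_mono_neg) auto
      with False show ?thesis by (simp add: algebra_simps min_def)
    qed
    ultimately show ?thesis using that by (simp add: field_simps)
  qed
  have bdd: "bdd_below ((\<lambda>k. a k / real k) ` {1..})"
    by (rule bdd_belowI2[where m="min c (2*c)"]) (use below in auto)
  have "(\<lambda>k. a k / real k) \<longlonglongrightarrow> L"
  proof (rule order_tendstoI)
    fix x assume "x < L"
    moreover have "L \<le> a k / real k" if "k \<ge> 1" for k
      unfolding L_def by (rule cINF_lower[OF bdd]) (use that in auto)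
    ultimately show "eventually (\<lambda>k. x < a k / real k) sequentially"
      by (intro eventually_sequentiallyI[of 1]) (meson less_le_trans)
  next
    fix x assume "L < x"
    then obtain m where m: "m \<ge> 1" "a m / real m < x"
      unfolding L_def using cINF_less_iff[OF _ bdd] by auto
    define B where "B = Max ((\<lambda>l. \<bar>a l\<bar> + \<bar>a m\<bar>) ` {..<m})"
    have B: "\<bar>a l\<bar> + \<bar>a m\<bar> \<le> B" if "l < m" for l
      unfolding B_def using that by (intro Max_ge) auto
    have ub: "a k / real k \<le> a m / real m + B / real k" if "k \<ge> 1" for k
    proof -
      have "a k = a (k div m * m + k mod m)" by simp
      also have "\<dots> \<le> real (k div m) * a m + a (k mod m)"
        by (rule subadditive_bound[OF sub])
      finally have 1: "a k \<le> real (k div m) * a m + a (k mod m)" .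
      have "real k = real (k div m) * real m + real (k mod m)"
        by (metis div_mult_mod_eq of_nat_add of_nat_mult)
      then have "real (k div m) = real k / real m - real (k mod m) / real m"
        using m(1) by (simp add: field_simps)
      then have 2: "real (k div m) * a m = real k * (a m / real m) - (real (k mod m) / real m) * a m"
        by (simp only: left_diff_distrib times_divide_eq_left times_divide_eq_right)
      have Bk: "\<bar>a (k mod m)\<bar> + \<bar>a m\<bar> \<le> B"
        by (rule B) (use m(1) in simp)
      have "\<bar>(real (k mod m) / real m) * a m\<bar> \<le> 1 * \<bar>a m\<bar>"
        unfolding abs_mult using m(1) by (intro mult_right_mono) auto
      then have "a k \<le> real k * (a m / real m) + B"
        using 1 2 Bk abs_ge_minus_self[of "(real (k mod m) / real m) * a m"] abs_ge_self[of "a (k mod m)"]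
        by linarith
      then show ?thesis using that by (simp add: field_simps)
    qed
    have "(\<lambda>k. a m / real m + B / real k) \<longlonglongrightarrow> a m / real m + 0"
      by (intro tendsto_add tendsto_const lim_const_over_n)
    then have "eventually (\<lambda>k. a m / real m + B / real k < x) sequentially"
      using m(2) by (auto dest: order_tendstoD)
    with eventually_ge_at_top[of 1] show "eventually (\<lambda>k. a k / real k < x) sequentially"
      by eventually_elim (use ub in fastforce)
  qed
  then show ?thesis by (rule convergentI)
qed

section \<open>Norm of a gauge integral\<close>

text \<open>The integrand may fail to be Borel measurable, but a gauge integrable function is Lebesgue
  measurable, and passing to the completion does not change the nonnegative integral.  If the
  right-hand side is finite, then the function is Lebesgue integrable with integral \<open>I\<close>.\<close>

lemma has_integral_norm_le_nn_integral:
  fixes f :: "real \<Rightarrow> 'b::euclidean_space"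
  assumes "(f has_integral I) {a..b}"
  shows "ennreal (norm I) \<le> (\<integral>\<^sup>+ t\<in>{a..b}. ennreal (norm (f t)) \<partial>lborel)"
proof -
  let ?F = "\<lambda>t. indicator {a..b} t *\<^sub>R f t"
  have eq: "(\<integral>\<^sup>+ t\<in>{a..b}. ennreal (norm (f t)) \<partial>lborel) = (\<integral>\<^sup>+ t. ennreal (norm (?F t)) \<partial>lebesgue)"
    unfolding nn_integral_completion
    by (intro nn_integral_cong) (auto split: split_indicator)
  have "f integrable_on {a..b}" using assms by blast
  then have meas: "?F \<in> borel_measurable lebesgue"
    using integrable_imp_measurable[of f "{a..b}"]
    by (subst (asm) borel_measurable_restrict_space_iff) auto
  show ?thesis
  proof (cases "(\<integral>\<^sup>+ t. ennreal (norm (?F t)) \<partial>lebesgue) = \<infinity>")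
    case False
    then have int: "integrable lebesgue ?F"
      using meas by (auto simp: integrable_iff_bounded less_top)
    then have "(?F has_integral integral\<^sup>L lebesgue ?F) UNIV"
      by (rule has_integral_integral_lebesgue)
    then have "(f has_integral integral\<^sup>L lebesgue ?F) {a..b}"
      by (subst has_integral_restrict_UNIV[symmetric])
         (simp add: indicator_scaleR_eq_if)
    then have "I = integral\<^sup>L lebesgue ?F" using assms has_integral_unique by blast
    then show ?thesis
      unfolding eq using integral_norm_bound_ennreal[OF int] by simp
  qed (simp add: eq)
qed


section \<open>Linear algebra of inner products\<close>

lemma bilinear_matrix:
  fixes B :: "real^'n::finite \<Rightarrow> real^'n \<Rightarrow> real"
  assumes "bilinear B"
  shows "B v w = v \<bullet> ((\<chi> i j. B (axis i 1) (axis j 1)) *v w)"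
proof -
  have "B v w = B (\<Sum>i\<in>UNIV. v $ i *\<^sub>R axis i 1) (\<Sum>j\<in>UNIV. w $ j *\<^sub>R axis j 1)"
    by (simp add: basis_expansion scalar_mult_eq_scaleR[symmetric])
  also have "\<dots> = (\<Sum>i\<in>UNIV. \<Sum>j\<in>UNIV. v $ i * (w $ j * B (axis i 1) (axis j 1)))"
    by (simp add: bilinear_sum[OF assms] bilinear_lmul[OF assms] bilinear_rmul[OF assms]
      sum.cartesian_product mult.left_commute)
  also have "\<dots> = v \<bullet> ((\<chi> i j. B (axis i 1) (axis j 1)) *v w)"
    by (simp add: inner_vec_def matrix_vector_mult_def sum_distrib_left mult_ac)
  finally show ?thesis .
qed

lemma bilinear_frame_matrix:
  fixes B :: "real^'n::finite \<Rightarrow> real^'n \<Rightarrow> real"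
  assumes "bilinear B"
  shows "(\<chi> i j. B (P *v axis i 1) (Q *v axis j 1)) =
    transpose P ** (\<chi> i j. B (axis i 1) (axis j 1)) ** Q"
proof -
  let ?M = "\<chi> i j. B (axis i 1) (axis j 1)"
  have "B (P *v axis i 1) (Q *v axis j 1) = (transpose P ** ?M ** Q) $ i $ j" for i j
  proof -
    have "B (P *v axis i 1) (Q *v axis j 1) = (P *v axis i 1) \<bullet> (?M *v (Q *v axis j 1))"
      by (rule bilinear_matrix[OF assms])
    also have "\<dots> = axis i 1 \<bullet> (transpose P *v (?M *v (Q *v axis j 1)))"
      by (simp only: dot_lmul_matrix[symmetric] vector_transpose_matrix)
    also have "\<dots> = ((transpose P ** ?M ** Q) *v axis j 1) $ i"
      by (simp add: matrix_vector_mul_assoc matrix_mul_assoc inner_axis')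
    also have "\<dots> = (transpose P ** ?M ** Q) $ i $ j"
      by (simp add: matrix_vector_mul_component inner_axis)
    finally show ?thesis .
  qed
  then show ?thesis by (simp add: vec_eq_iff)
qed

text \<open>An orthonormal set of maximal size spans: otherwise a vector outside its span, made
  orthogonal to it and normalised, could be added.\<close>

lemma orthonormal_basis_exists:
  fixes B :: "real^'n::finite \<Rightarrow> real^'n \<Rightarrow> real"
  assumes bil: "bilinear B" and sym: "\<And>v w. B v w = B w v" and pos: "\<And>v. v \<noteq> 0 \<Longrightarrow> 0 < B v v"
  shows "\<exists>e :: 'n \<Rightarrow> real^'n. \<forall>i j. B (e i) (e j) = (if i = j then 1 else 0)"
proof -
  define ON where "ON S \<longleftrightarrow> finite S \<and> (\<forall>u\<in>S. \<forall>v\<in>S. B u v = (if u = v then 1 else 0))"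
    for S :: "(real^'n) set"
  have lin: "linear (\<lambda>v. B u v)" for u using bil by (simp add: bilinear_def)
  have Bsum: "B u (\<Sum>v\<in>S. c v *\<^sub>R v) = c u" if "ON S" "u \<in> S" for S u c
  proof -
    have "B u (\<Sum>v\<in>S. c v *\<^sub>R v) = (\<Sum>v\<in>S. c v * B u v)"
      by (simp add: linear_sum[OF lin] linear_scale[OF lin])
    also have "\<dots> = (\<Sum>v\<in>S. if u = v then c v else 0)"
      using that by (intro sum.cong) (auto simp: ON_def)
    also have "\<dots> = c u" using that by (simp add: ON_def)
    finally show ?thesis .
  qed
  have ind: "independent S" if "ON S" for S
    unfolding independent_explicit
  proof (intro conjI allI impI ballI)
    show "finite S" using that by (simp add: ON_def)
    fix c v assume "(\<Sum>v\<in>S. c v *\<^sub>R v) = 0" "v \<in> S"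
    then show "c v = 0" using Bsum[OF that \<open>v \<in> S\<close>, of c] linear_0[OF lin] by simp
  qed
  have le: "card S \<le> CARD('n)" if "ON S" for S
    using independent_bound[OF ind[OF that]] by simp
  have "ON {}" by (simp add: ON_def)
  then obtain S where S: "ON S" "\<And>T. ON T \<Longrightarrow> card T \<le> card S"
    using ex_has_greatest_nat[of ON "{}" card "Suc CARD('n)"] le by (metis le_imp_less_Suc)
  have "card S = CARD('n)"
  proof (rule ccontr)
    assume "card S \<noteq> CARD('n)"
    then have "dim S < DIM(real^'n)"
      using le[OF S(1)] ind[OF S(1)] by (simp add: dim_eq_card_independent)
    then have "span S \<noteq> UNIV" by (metis dim_span dim_UNIV less_irrefl)
    then obtain v where v: "v \<notin> span S" by blast
    define w where "w = v - (\<Sum>u\<in>S. B u v *\<^sub>R u)"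
    have "w \<noteq> 0"
    proof
      assume "w = 0"
      then have "v = (\<Sum>u\<in>S. B u v *\<^sub>R u)" by (simp add: w_def)
      moreover have "(\<Sum>u\<in>S. B u v *\<^sub>R u) \<in> span S"
        by (intro span_sum span_scale span_base)
      ultimately show False using v by simp
    qed
    then have wpos: "0 < B w w" by (rule pos)
    have orth: "B u w = 0" if "u \<in> S" for u
      unfolding w_def by (simp add: linear_diff[OF lin] Bsum[OF S(1) that])
    define w' where "w' = (1 / sqrt (B w w)) *\<^sub>R w"
    have 1: "B w' w' = 1"
      using wpos by (simp add: w'_def bilinear_lmul[OF bil] bilinear_rmul[OF bil] real_div_sqrt divide_simps)
    have 0: "B u w' = 0" "B w' u = 0" if "u \<in> S" for u
      using orth[OF that] sym[of u w'] by (simp_all add: w'_def bilinear_rmul[OF bil])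
    have "w' \<notin> S" using 0 1 by force
    moreover have "ON (insert w' S)"
      using S(1) 0 1 \<open>w' \<notin> S\<close> by (auto simp: ON_def)
    ultimately show False
      using S(2)[of "insert w' S"] S(1) by (simp add: ON_def)
  qed
  then obtain e where "bij_betw e (UNIV :: 'n set) S"
    using S(1) finite_same_card_bij[of "UNIV :: 'n set" S] by (auto simp: ON_def)
  then have "B (e i) (e j) = (if i = j then 1 else 0)" for i j
    using S(1) unfolding ON_def bij_betw_def inj_on_def by (metis UNIV_I image_eqI)
  then show ?thesis by (intro exI[of _ e]) simp
qed

definition metric_matrix :: "(real^'n::finite \<Rightarrow> real^'n \<Rightarrow> real) \<Rightarrow> real^'n^'n" where
  "metric_matrix B = (\<chi> i j. B (axis i 1) (axis j 1))"

definition frame_matrix :: "('n::finite \<Rightarrow> real^'n) \<Rightarrow> real^'n^'n" where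
  "frame_matrix e = (\<chi> i j. e j $ i)"

lemma frame_matrix_axis [simp]: "frame_matrix e *v axis j 1 = e j"
  by (simp add: frame_matrix_def matrix_vector_mul_component vec_eq_iff inner_axis)

text \<open>With the frame as columns of a matrix \<open>P\<close> and the metric as a matrix \<open>G\<close>, orthonormality says
  that \<open>P\<^sup>T G P\<close> is the identity.\<close>

lemma orthonormal_frame_det:
  assumes "bilinear (g x)" "orthonormal_frame g x e"
  shows "(det (frame_matrix e))\<^sup>2 * det (metric_matrix (g x)) = 1"
proof -
  have "(\<chi> i j. g x (e i) (e j)) = mat 1"
    using assms(2) by (simp add: orthonormal_frame_def mat_def vec_eq_iff)
  then have "transpose (frame_matrix e) ** metric_matrix (g x) ** frame_matrix e = mat 1"
    using bilinear_frame_matrix[OF assms(1), of "frame_matrix e" "frame_matrix e"]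
    by (simp add: metric_matrix_def)
  then have "det (transpose (frame_matrix e) ** metric_matrix (g x) ** frame_matrix e) = 1"
    by simp
  then show ?thesis by (simp add: det_mul power2_eq_square mult_ac)
qed

lemma orthonormal_frame_exists:
  assumes "bilinear (g x)" "\<And>v w. g x v w = g x w v" "\<And>v. v \<noteq> 0 \<Longrightarrow> g x v v > 0"
  obtains e where "orthonormal_frame g x e"
  using orthonormal_basis_exists[of "g x"] assms unfolding orthonormal_frame_def by blast

lemma det_metric_pos:
  assumes "bilinear (g x)" "\<And>v w. g x v w = g x w v" "\<And>v. v \<noteq> 0 \<Longrightarrow> g x v v > 0"
  shows "0 < det (metric_matrix (g x))"
proof -
  obtain e where e: "orthonormal_frame g x e" using orthonormal_frame_exists assms by metis
  then have 1: "(det (frame_matrix e))\<^sup>2 * det (metric_matrix (g x)) = 1"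
    using orthonormal_frame_det[of g x e] assms(1) by blast
  show ?thesis
  proof (rule ccontr)
    assume "\<not> ?thesis"
    then have "(det (frame_matrix e))\<^sup>2 * det (metric_matrix (g x)) \<le> 0"
      by (intro mult_nonneg_nonpos) auto
    with 1 show False by simp
  qed
qed

text \<open>Orthonormal frames exist and the determinants of their matrices are \<open>\<plusminus>1 / sqrt (det G)\<close>.  So the
  determinant which defines \<open>rabs_det\<close> does not depend on the frames, and the definite description has
  a value.\<close>

lemma rabs_det_eq:
  assumes "bilinear (g x)" "\<And>v w. g x v w = g x w v" "\<And>v. v \<noteq> 0 \<Longrightarrow> g x v v > 0"
    and "bilinear (g y)" "\<And>v w. g y v w = g y w v" "\<And>v. v \<noteq> 0 \<Longrightarrow> g y v v > 0"
    and "linear L"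
  shows "rabs_det g x y L = \<bar>det (matrix L)\<bar> * sqrt (det (metric_matrix (g y))) / sqrt (det (metric_matrix (g x)))"
    (is "_ = ?d")
proof -
  have E: "\<bar>det (frame_matrix e)\<bar> = 1 / sqrt (det (metric_matrix (g z)))"
    if "orthonormal_frame g z e" "bilinear (g z)" "\<And>v w. g z v w = g z w v" "\<And>v. v \<noteq> 0 \<Longrightarrow> g z v v > 0" for z e
  proof -
    have p: "0 < det (metric_matrix (g z))" by (rule det_metric_pos) (use that in auto)
    have "(det (frame_matrix e))\<^sup>2 = 1 / det (metric_matrix (g z))"
      using orthonormal_frame_det[OF that(2,1)] p by (simp add: field_simps)
    then have "sqrt ((det (frame_matrix e))\<^sup>2) = sqrt (1 / det (metric_matrix (g z)))" by simp
    then show ?thesis by (simp add: real_sqrt_divide)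
  qed
  have val: "\<bar>det (\<chi> i j. g y (e' i) (L (e j)))\<bar> = ?d"
    if e: "orthonormal_frame g x e" and e': "orthonormal_frame g y e'" for e e'
  proof -
    have p: "0 < det (metric_matrix (g y))" by (rule det_metric_pos) (use assms in auto)
    have "L (e j) = (matrix L ** frame_matrix e) *v axis j 1" for j
      by (simp add: matrix_vector_mul_assoc[symmetric] fun_cong[OF matrix_vector_mul(2)[OF \<open>linear L\<close>]])
    then have "(\<chi> i j. g y (e' i) (L (e j))) =
        transpose (frame_matrix e') ** metric_matrix (g y) ** (matrix L ** frame_matrix e)"
      using bilinear_frame_matrix[OF assms(4), of "frame_matrix e'" "matrix L ** frame_matrix e"]
      by (simp add: metric_matrix_def)
    then have "\<bar>det (\<chi> i j. g y (e' i) (L (e j)))\<bar> =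
        \<bar>det (frame_matrix e')\<bar> * \<bar>det (metric_matrix (g y))\<bar> * \<bar>det (matrix L)\<bar> * \<bar>det (frame_matrix e)\<bar>"
      by (simp add: det_mul abs_mult)
    also have "\<dots> = ?d"
    proof -
      have "\<bar>det (frame_matrix e)\<bar> = 1 / sqrt (det (metric_matrix (g x)))"
        by (rule E[OF e]) (use assms in auto)
      moreover have "\<bar>det (frame_matrix e')\<bar> = 1 / sqrt (det (metric_matrix (g y)))"
        by (rule E[OF e']) (use assms in auto)
      moreover have "\<bar>det (metric_matrix (g y))\<bar> = sqrt (det (metric_matrix (g y))) * sqrt (det (metric_matrix (g y)))"
        using p by simp
      moreover have "sqrt (det (metric_matrix (g y))) \<noteq> 0" using p by simp
      moreover have "a' * m * d * a = d * q / p" if "a = 1 / p" "a' = 1 / q" "m = q * q" "q \<noteq> 0"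
        for a a' m d p q :: real using that by simp
      ultimately show ?thesis by blast
    qed
    finally show ?thesis .
  qed
  obtain e e' where "orthonormal_frame g x e" "orthonormal_frame g y e'"
    using orthonormal_frame_exists[of g x] orthonormal_frame_exists[of g y] assms by metis
  then show ?thesis
    unfolding rabs_det_def using val by (intro the_equality) auto
qed

section \<open>Riemannian manifolds in charts\<close>

text \<open>The differential of \<open>h\<close> in two given charts.  Both \<open>mderiv\<close> and \<open>tangent_of_coord\<close> are special
  cases, so that a single chain rule provides all relations between them.\<close>

definition cderiv ::
  "('m, 'n::finite) chart \<Rightarrow> ('m, 'n) chart \<Rightarrow> ('m \<Rightarrow> 'm) \<Rightarrow> 'm \<Rightarrow> real ^ 'n \<Rightarrow> real ^ 'n" where
  "cderiv c d h x = frechet_derivative (snd d \<circ> h \<circ> chart_inv c) (at (snd c x))"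

locale riemannian_manifold =
  fixes A :: "('m::{t2_space,second_countable_topology}, 'n::finite) chart set"
    and g :: "('m, 'n) metric_tensor"
  assumes atlas: "smooth_atlas A" and metric: "riemannian_metric A g"
begin

lemma open_chart_domain: "c \<in> A \<Longrightarrow> open (fst c)"
  using atlas by (auto simp: smooth_atlas_def)

lemma chart_homeomorphism: "c \<in> A \<Longrightarrow> homeomorphism (fst c) (snd c ` fst c) (snd c) (chart_inv c)"
  using atlas by (auto simp: smooth_atlas_def)

lemma chart_inv_chart [simp]: "c \<in> A \<Longrightarrow> x \<in> fst c \<Longrightarrow> chart_inv c (snd c x) = x"
  using chart_homeomorphism by (auto simp: homeomorphism_def)

lemma chart_chart_inv [simp]: "c \<in> A \<Longrightarrow> y \<in> snd c ` fst c \<Longrightarrow> snd c (chart_inv c y) = y"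
  by auto

lemma chart_inv_in [simp]: "c \<in> A \<Longrightarrow> y \<in> snd c ` fst c \<Longrightarrow> chart_inv c y \<in> fst c"
  by auto

lemma continuous_on_chart: "c \<in> A \<Longrightarrow> S \<subseteq> fst c \<Longrightarrow> continuous_on S (snd c)"
  using chart_homeomorphism by (meson continuous_on_subset homeomorphism_def)

lemma continuous_on_chart_inv: "c \<in> A \<Longrightarrow> S \<subseteq> snd c ` fst c \<Longrightarrow> continuous_on S (chart_inv c)"
  using chart_homeomorphism by (meson continuous_on_subset homeomorphism_def)

lemma open_chart_image:
  assumes "c \<in> A" "open V"
  shows "open (snd c ` (fst c \<inter> V))"
proof -
  have "snd c ` (fst c \<inter> V) = snd c ` fst c \<inter> chart_inv c -` V"
    using assms(1) by force
  moreover have "open (snd c ` fst c \<inter> chart_inv c -` V)"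
    using atlas assms continuous_on_chart_inv[OF assms(1) order_refl]
    by (auto simp: smooth_atlas_def continuous_on_open_vimage Int_commute)
  ultimately show ?thesis by simp
qed

lemma chart_at: "chart_at A x \<in> A \<and> x \<in> fst (chart_at A x)"
proof -
  have "x \<in> (\<Union>c\<in>A. fst c)" using atlas by (simp add: smooth_atlas_def)
  then have "\<exists>c. c \<in> A \<and> x \<in> fst c" by blast
  then show ?thesis unfolding chart_at_def by (rule someI_ex)
qed

lemma Ck_map_C1_on:
  assumes "Ck_map A 1 h" "c \<in> A" "d \<in> A"
  shows "C1_on (snd d \<circ> h \<circ> chart_inv c) (snd c ` (fst c \<inter> h -` fst d))"
  using assms unfolding Ck_map_def Ck_on_1_iff by blast

lemma open_rep_domain:
  assumes "Ck_map A 1 h" "c \<in> A" "d \<in> A"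
  shows "open (snd c ` (fst c \<inter> h -` fst d))"
  using assms by (intro open_chart_image open_vimage open_chart_domain) (auto simp: Ck_map_def)

lemma Ck_map_id: "Ck_map A 1 id"
  unfolding Ck_map_def
proof (intro conjI ballI)
  fix c d assume "c \<in> A" "d \<in> A"
  then have "smooth_on (snd d \<circ> chart_inv c) (snd c ` (fst c \<inter> fst d))"
    using atlas by (auto simp: smooth_atlas_def)
  then show "Ck_on 1 (snd d \<circ> id \<circ> chart_inv c) (snd c ` (fst c \<inter> id -` fst d))"
    by (simp add: smooth_on_def)
qed (simp add: id_def)

lemma cderiv_has_derivative:
  assumes "Ck_map A 1 h" "c \<in> A" "d \<in> A" "x \<in> fst c" "h x \<in> fst d"
  shows "((snd d \<circ> h \<circ> chart_inv c) has_derivative cderiv c d h x) (at (snd c x))"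
  unfolding cderiv_def using assms by (intro C1_on_has_derivative[OF Ck_map_C1_on]) auto

lemma linear_cderiv:
  assumes "Ck_map A 1 h" "c \<in> A" "d \<in> A" "x \<in> fst c" "h x \<in> fst d"
  shows "linear (cderiv c d h x)"
  using cderiv_has_derivative[OF assms] by (rule has_derivative_linear)

lemma rep_compose_eq:
  assumes "e \<in> A" "y \<in> snd c ` (fst c \<inter> h1 -` fst e)" "c \<in> A"
  shows "(snd d \<circ> h2 \<circ> chart_inv e \<circ> (snd e \<circ> h1 \<circ> chart_inv c)) y = (snd d \<circ> (h2 \<circ> h1) \<circ> chart_inv c) y"
  using assms by auto

lemma cderiv_compose:
  assumes "Ck_map A 1 h1" "Ck_map A 1 h2" "c \<in> A" "d \<in> A" "e \<in> A"
    and "x \<in> fst c" "h1 x \<in> fst e" "h2 (h1 x) \<in> fst d"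
  shows "cderiv c d (h2 \<circ> h1) x = cderiv e d h2 (h1 x) \<circ> cderiv c e h1 x"
proof -
  let ?S = "snd c ` (fst c \<inter> h1 -` fst e)"
  have 1: "((snd e \<circ> h1 \<circ> chart_inv c) has_derivative cderiv c e h1 x) (at (snd c x))"
    by (rule cderiv_has_derivative) (use assms in auto)
  have 2: "((snd d \<circ> h2 \<circ> chart_inv e) has_derivative cderiv e d h2 (h1 x)) (at (snd e (h1 x)))"
    by (rule cderiv_has_derivative) (use assms in auto)
  have eq: "(snd e \<circ> h1 \<circ> chart_inv c) (snd c x) = snd e (h1 x)" using assms by simp
  have "((snd d \<circ> h2 \<circ> chart_inv e \<circ> (snd e \<circ> h1 \<circ> chart_inv c)) has_derivative
      (cderiv e d h2 (h1 x) \<circ> cderiv c e h1 x)) (at (snd c x))"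
    by (rule diff_chain_at[OF 1]) (use 2 eq in simp)
  then have "((snd d \<circ> (h2 \<circ> h1) \<circ> chart_inv c) has_derivative
      (cderiv e d h2 (h1 x) \<circ> cderiv c e h1 x)) (at (snd c x))"
    by (rule has_derivative_transform_within_open[OF _ open_rep_domain[OF assms(1,3,5)]])
      (use assms rep_compose_eq in auto)
  then show ?thesis
    unfolding cderiv_def[of c d "h2 \<circ> h1"] by (rule frechet_derivative_at[symmetric])
qed

lemma Ck_map_compose:
  assumes h1: "Ck_map A 1 h1" and h2: "Ck_map A 1 h2"
  shows "Ck_map A 1 (h2 \<circ> h1)"
  unfolding Ck_map_def Ck_on_1_iff
proof (intro conjI ballI)
  show "continuous_on UNIV (h2 \<circ> h1)"
    using assms unfolding Ck_map_def by (metis continuous_on_compose continuous_on_subset top_greatest)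
  fix c d assume c: "c \<in> A" and d: "d \<in> A"
  show "C1_on (snd d \<circ> (h2 \<circ> h1) \<circ> chart_inv c) (snd c ` (fst c \<inter> (h2 \<circ> h1) -` fst d))"
  proof (rule C1_on_local)
    fix y assume "y \<in> snd c ` (fst c \<inter> (h2 \<circ> h1) -` fst d)"
    then obtain x where x: "x \<in> fst c" "h2 (h1 x) \<in> fst d" "y = snd c x" by auto
    define e where "e = chart_at A (h1 x)"
    have e: "e \<in> A" "h1 x \<in> fst e" using chart_at[of "h1 x"] by (auto simp: e_def)
    have ch1: "continuous_on UNIV h1" and ch2: "continuous_on UNIV h2"
      using assms by (auto simp: Ck_map_def)
    let ?V = "h1 -` fst e \<inter> h1 -` (h2 -` fst d)"
    let ?T = "snd c ` (fst c \<inter> ?V)"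
    have oT: "open ?T"
      by (intro open_chart_image c open_Int open_vimage open_chart_domain e d ch1 ch2)
    have "C1_on (snd d \<circ> h2 \<circ> chart_inv e \<circ> (snd e \<circ> h1 \<circ> chart_inv c)) ?T"
    proof (rule C1_on_compose[where T="snd e ` (fst e \<inter> h2 -` fst d)"])
      show "C1_on (snd e \<circ> h1 \<circ> chart_inv c) ?T"
        using Ck_map_C1_on[OF h1 c e(1)] unfolding C1_on_def
        by (auto intro: continuous_on_subset)
      show "C1_on (snd d \<circ> h2 \<circ> chart_inv e) (snd e ` (fst e \<inter> h2 -` fst d))"
        by (rule Ck_map_C1_on[OF h2 e(1) d])
      show "(snd e \<circ> h1 \<circ> chart_inv c) ` ?T \<subseteq> snd e ` (fst e \<inter> h2 -` fst d)"
        using c by auto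
    qed
    then have "C1_on (snd d \<circ> (h2 \<circ> h1) \<circ> chart_inv c) ?T"
      by (rule C1_on_open_cong[OF _ oT]) (use c e in auto)
    then show "\<exists>T. open T \<and> y \<in> T \<and> T \<subseteq> snd c ` (fst c \<inter> (h2 \<circ> h1) -` fst d) \<and>
        C1_on (snd d \<circ> (h2 \<circ> h1) \<circ> chart_inv c) T"
      using oT x e by (intro exI[of _ ?T]) auto
  qed
qed

lemma Ck_map_funpow:
  assumes "Ck_map A 1 h" shows "Ck_map A 1 (h ^^ k)"
proof (induction k)
  case 0
  show ?case unfolding funpow.simps by (rule Ck_map_id)
next
  case (Suc k)
  show ?case unfolding funpow.simps by (rule Ck_map_compose[OF Suc assms])
qed

lemma Ck_map_2_imp_1: "Ck_map A 2 h \<Longrightarrow> Ck_map A 1 h"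
  unfolding Ck_map_def numeral_2_eq_2 One_nat_def by (meson Ck_on_SucD)

lemma cderiv_self: "c \<in> A \<Longrightarrow> x \<in> fst c \<Longrightarrow> cderiv c c id x = id"
proof -
  assume c: "c \<in> A" and x: "x \<in> fst c"
  have "(id has_derivative id) (at (snd c x))" by (simp add: id_def)
  then have "((snd c \<circ> id \<circ> chart_inv c) has_derivative id) (at (snd c x))"
    by (rule has_derivative_transform_within_open[OF _ open_chart_image[OF c open_UNIV]])
      (use c x in auto)
  then show ?thesis unfolding cderiv_def by (rule frechet_derivative_at[symmetric])
qed

lemma tangent_of_coord_cderiv: "tangent_of_coord A c x = cderiv c (chart_at A x) id x"
  by (simp add: tangent_of_coord_def cderiv_def)

lemma mderiv_cderiv: "mderiv A h x = cderiv (chart_at A x) (chart_at A (h x)) h x"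
  by (simp add: mderiv_def cderiv_def)

lemma linear_tangent: "c \<in> A \<Longrightarrow> x \<in> fst c \<Longrightarrow> linear (tangent_of_coord A c x)"
  unfolding tangent_of_coord_cderiv by (intro linear_cderiv Ck_map_id) (auto simp: chart_at)

text \<open>The coordinate change in the opposite direction is a left inverse.\<close>

lemma inj_tangent:
  assumes "c \<in> A" "x \<in> fst c" shows "inj (tangent_of_coord A c x)"
proof -
  have "cderiv c c (id \<circ> id) x = cderiv (chart_at A x) c id (id x) \<circ> cderiv c (chart_at A x) id x"
    by (rule cderiv_compose[OF Ck_map_id Ck_map_id]) (use assms chart_at in auto)
  then have "cderiv (chart_at A x) c id x \<circ> tangent_of_coord A c x = id"
    using cderiv_self[OF assms] by (simp add: tangent_of_coord_cderiv)
  then show ?thesis by (metis inj_on_id inj_on_imageI2)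
qed

lemma mderiv_tangent:
  assumes "Ck_map A 1 h" "c \<in> A" "x \<in> fst c" "d \<in> A" "h x \<in> fst d"
  shows "mderiv A h x \<circ> tangent_of_coord A c x = tangent_of_coord A d (h x) \<circ> cderiv c d h x"
proof -
  let ?e = "chart_at A x" and ?e' = "chart_at A (h x)"
  have "cderiv c ?e' (h \<circ> id) x = cderiv ?e ?e' h (id x) \<circ> cderiv c ?e id x"
    by (rule cderiv_compose[OF Ck_map_id assms(1)]) (use assms chart_at in auto)
  moreover have "cderiv c ?e' (id \<circ> h) x = cderiv d ?e' id (h x) \<circ> cderiv c d h x"
    by (rule cderiv_compose[OF assms(1) Ck_map_id]) (use assms chart_at in auto)
  ultimately show ?thesis by (simp add: mderiv_cderiv tangent_of_coord_cderiv)
qed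

lemma linear_mderiv: "Ck_map A 1 h \<Longrightarrow> linear (mderiv A h x)"
  unfolding mderiv_cderiv by (intro linear_cderiv) (auto simp: chart_at)

lemma mderiv_compose:
  assumes "Ck_map A 1 h1" "Ck_map A 1 h2"
  shows "mderiv A (h2 \<circ> h1) x = mderiv A h2 (h1 x) \<circ> mderiv A h1 x"
  unfolding mderiv_cderiv using cderiv_compose[OF assms] chart_at by simp

lemma metric_bilinear: "bilinear (g x)"
  and metric_sym: "g x v w = g x w v"
  and metric_pos: "v \<noteq> 0 \<Longrightarrow> 0 < g x v v"
  using metric by (auto simp: riemannian_metric_def)

lemma metric_zero [simp]: "g x 0 0 = 0"
  using metric_bilinear bilinear_lzero by blast

lemma metric_nonneg: "0 \<le> g x v v"
  by (cases "v = 0") (auto intro: less_imp_le metric_pos)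

lemma rnorm_nonneg [simp]: "0 \<le> rnorm g x v"
  by (simp add: rnorm_def metric_nonneg)

lemma rnorm_pos: "v \<noteq> 0 \<Longrightarrow> 0 < rnorm g x v"
  by (simp add: rnorm_def metric_pos)

lemma rnorm_zero [simp]: "rnorm g x 0 = 0"
  by (simp add: rnorm_def)

lemma rnorm_scale: "rnorm g x (r *\<^sub>R v) = \<bar>r\<bar> * rnorm g x v"
  by (simp add: rnorm_def bilinear_lmul[OF metric_bilinear] bilinear_rmul[OF metric_bilinear]
      real_sqrt_mult power2_eq_square[symmetric] mult.assoc[symmetric])

text \<open>The density of the Riemannian volume with respect to Lebesgue measure in the chart \<open>c\<close>.\<close>

definition chart_volume :: "('m, 'n) chart \<Rightarrow> 'm \<Rightarrow> real" where
  "chart_volume c x = sqrt (det (\<chi> i j. g x (tangent_of_coord A c x (axis i 1)) (tangent_of_coord A c x (axis j 1))))"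

lemma chart_volume_eq:
  assumes "c \<in> A" "x \<in> fst c"
  shows "chart_volume c x = \<bar>det (matrix (tangent_of_coord A c x))\<bar> * sqrt (det (metric_matrix (g x)))"
proof -
  let ?T = "matrix (tangent_of_coord A c x)"
  have "tangent_of_coord A c x v = ?T *v v" for v
    by (simp add: fun_cong[OF matrix_vector_mul(2)[OF linear_tangent[OF assms]]])
  then have "det (\<chi> i j. g x (tangent_of_coord A c x (axis i 1)) (tangent_of_coord A c x (axis j 1))) =
      (det ?T)\<^sup>2 * det (metric_matrix (g x))"
    using bilinear_frame_matrix[OF metric_bilinear, of x ?T ?T]
    by (simp add: metric_matrix_def det_mul power2_eq_square mult_ac)
  then show ?thesis by (simp add: chart_volume_def real_sqrt_mult)
qed

lemma chart_volume_pos: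
  assumes "c \<in> A" "x \<in> fst c" shows "0 < chart_volume c x"
proof -
  have "0 < det (metric_matrix (g x))"
    by (rule det_metric_pos) (auto simp: metric_bilinear metric_pos intro: metric_sym)
  moreover have "det (matrix (tangent_of_coord A c x)) \<noteq> 0"
    using det_nz_iff_inj[OF linear_tangent[OF assms]] inj_tangent[OF assms] by simp
  ultimately show ?thesis by (simp add: chart_volume_eq[OF assms])
qed

text \<open>Take determinants in \<open>mderiv_tangent\<close>.  Along an orbit the density at the end of one step is the
  density at the beginning of the next one, so in a product over the orbit only the first and the
  last density survive.\<close>

lemma rabs_det_cderiv:
  assumes h: "Ck_map A 1 h" and "c \<in> A" "x \<in> fst c" "d \<in> A" "h x \<in> fst d"
  shows "rabs_det g x (h x) (mderiv A h x) * chart_volume c x =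
    \<bar>det (matrix (cderiv c d h x))\<bar> * chart_volume d (h x)"
proof -
  have p: "0 < det (metric_matrix (g z))" for z
    by (rule det_metric_pos) (auto simp: metric_bilinear metric_pos intro: metric_sym)
  have "det (matrix (mderiv A h x \<circ> tangent_of_coord A c x)) =
      det (matrix (tangent_of_coord A d (h x) \<circ> cderiv c d h x))"
    by (simp add: mderiv_tangent[OF assms])
  then have *: "det (matrix (mderiv A h x)) * det (matrix (tangent_of_coord A c x)) =
      det (matrix (tangent_of_coord A d (h x))) * det (matrix (cderiv c d h x))"
    using assms by (simp add: matrix_compose linear_mderiv linear_tangent linear_cderiv det_mul)
  have "rabs_det g x (h x) (mderiv A h x) = \<bar>det (matrix (mderiv A h x))\<bar> *
      sqrt (det (metric_matrix (g (h x)))) / sqrt (det (metric_matrix (g x)))"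
    by (rule rabs_det_eq) (auto simp: metric_bilinear metric_pos linear_mderiv[OF h] intro: metric_sym)
  then have "rabs_det g x (h x) (mderiv A h x) * chart_volume c x =
     \<bar>det (matrix (mderiv A h x)) * det (matrix (tangent_of_coord A c x))\<bar> * sqrt (det (metric_matrix (g (h x))))"
    using p[of x] by (simp add: chart_volume_eq assms abs_mult)
  also have "\<dots> = \<bar>det (matrix (cderiv c d h x))\<bar> * chart_volume d (h x)"
    unfolding * by (simp add: chart_volume_eq assms abs_mult)
  finally show ?thesis .
qed

lemma continuous_on_metric_coeff:
  assumes "c \<in> A"
  shows "continuous_on (snd c ` fst c) (\<lambda>y. g (chart_inv c y) (tangent_of_coord A c (chart_inv c y) v)
                               (tangent_of_coord A c (chart_inv c y) w))"
  using metric assms by (intro smooth_on_continuous_on) (auto simp: riemannian_metric_def)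

lemma continuous_on_chart_volume:
  assumes "c \<in> A"
  shows "continuous_on (snd c ` fst c) (\<lambda>y. chart_volume c (chart_inv c y))"
  unfolding chart_volume_def det_def vec_lambda_beta
  by (intro continuous_intros continuous_on_metric_coeff assms)

lemma chart_volume_bounds:
  assumes "c \<in> A" "compact K" "K \<subseteq> fst c"
  shows "\<exists>a>0. \<exists>b. \<forall>x\<in>K. a \<le> chart_volume c x \<and> chart_volume c x \<le> b"
proof (cases "K = {}")
  case False
  have "continuous_on K (\<lambda>x. chart_volume c (chart_inv c (snd c x)))"
    by (rule continuous_on_compose2[OF continuous_on_chart_volume[OF assms(1)] continuous_on_chart[OF assms(1,3)]])
      (use assms in auto)
  then have cont: "continuous_on K (chart_volume c)"
    by (rule continuous_on_eq) (use assms in auto)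
  obtain x0 where x0: "x0 \<in> K" "\<And>x. x \<in> K \<Longrightarrow> chart_volume c x0 \<le> chart_volume c x"
    using continuous_attains_inf[OF assms(2) False cont] by auto
  obtain x1 where x1: "x1 \<in> K" "\<And>x. x \<in> K \<Longrightarrow> chart_volume c x \<le> chart_volume c x1"
    using continuous_attains_sup[OF assms(2) False cont] by auto
  have "0 < chart_volume c x0" using chart_volume_pos[OF assms(1)] assms(3) x0(1) by blast
  then show ?thesis using x0 x1 by blast
qed (auto intro: exI[of _ 1])

text \<open>The metric is a continuous and positive function on the product of \<open>K\<close> with the unit sphere,
  which is compact.\<close>

lemma metric_bounds:
  assumes "c \<in> A" "compact K" "K \<subseteq> fst c"
  shows "\<exists>\<kappa>>0. \<exists>C. \<forall>x\<in>K. \<forall>v. \<kappa> * norm v \<le> rnorm g x (tangent_of_coord A c x v) \<and>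
    rnorm g x (tangent_of_coord A c x v) \<le> C * norm v"
proof (cases "K = {}")
  case False
  let ?T = "\<lambda>x. tangent_of_coord A c x"
  let ?q = "\<lambda>x v. g x (?T x v) (?T x v)"
  let ?co = "\<lambda>i j y. g (chart_inv c y) (?T (chart_inv c y) i) (?T (chart_inv c y) j)"
  define S where "S = K \<times> sphere (0::real^'n) 1"
  have "compact S" unfolding S_def by (intro compact_Times assms compact_sphere)
  have "S \<noteq> {}" using False by (simp add: S_def)
  have q: "?q x v = (\<Sum>(i,j)\<in>Basis\<times>Basis. (v \<bullet> i) * (v \<bullet> j) * ?co i j (snd c x))" if "x \<in> K" for x v
  proof -
    have "x \<in> fst c" using that assms by auto
    then have l: "linear (?T x)" using linear_tangent assms by blast
    have "?T x v = (\<Sum>i\<in>Basis. (v \<bullet> i) *\<^sub>R ?T x i)" by (rule linear_sum_Basis[OF l])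
    then have "?q x v = g x (\<Sum>i\<in>Basis. (v \<bullet> i) *\<^sub>R ?T x i) (\<Sum>i\<in>Basis. (v \<bullet> i) *\<^sub>R ?T x i)" by simp
    also have "\<dots> = (\<Sum>(i,j)\<in>Basis\<times>Basis. (v \<bullet> i) * (v \<bullet> j) * g x (?T x i) (?T x j))"
      by (simp add: bilinear_sum[OF metric_bilinear] bilinear_lmul[OF metric_bilinear]
          bilinear_rmul[OF metric_bilinear] mult_ac)
    finally show ?thesis using \<open>x \<in> fst c\<close> assms by simp
  qed
  have "continuous_on S (\<lambda>p. \<Sum>(i,j)\<in>Basis\<times>Basis. (snd p \<bullet> i) * (snd p \<bullet> j) * ?co i j (snd c (fst p)))"
  proof -
    have "continuous_on S (\<lambda>p. snd c (fst p))"
      by (rule continuous_on_compose2[OF continuous_on_chart[OF assms(1,3)] continuous_on_fst[OF continuous_on_id]])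
        (auto simp: S_def)
    then have "continuous_on S (\<lambda>p. ?co i j (snd c (fst p)))" for i j
      by (rule continuous_on_compose2[OF continuous_on_metric_coeff[OF assms(1)]])
        (use assms in \<open>auto simp: S_def\<close>)
    then show ?thesis
      unfolding case_prod_beta by (intro continuous_intros)
  qed
  then have cont: "continuous_on S (\<lambda>p. ?q (fst p) (snd p))"
    by (rule continuous_on_eq) (auto simp: S_def q)
  obtain p0 where p0: "p0 \<in> S" "\<And>p. p \<in> S \<Longrightarrow> ?q (fst p0) (snd p0) \<le> ?q (fst p) (snd p)"
    using continuous_attains_inf[OF \<open>compact S\<close> \<open>S \<noteq> {}\<close> cont] by auto
  obtain p1 where p1: "p1 \<in> S" "\<And>p. p \<in> S \<Longrightarrow> ?q (fst p) (snd p) \<le> ?q (fst p1) (snd p1)"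
    using continuous_attains_sup[OF \<open>compact S\<close> \<open>S \<noteq> {}\<close> cont] by auto
  define \<kappa> where "\<kappa> = sqrt (?q (fst p0) (snd p0))"
  define C where "C = sqrt (?q (fst p1) (snd p1))"
  have "?T (fst p0) (snd p0) \<noteq> 0"
  proof
    assume "?T (fst p0) (snd p0) = 0"
    moreover have f: "fst p0 \<in> fst c" using p0(1) assms by (auto simp: S_def)
    ultimately have "snd p0 = 0"
      using inj_tangent[OF assms(1) f] linear_0[OF linear_tangent[OF assms(1) f]]
      by (metis injD)
    then show False using p0(1) by (auto simp: S_def)
  qed
  then have "\<kappa> > 0" by (simp add: \<kappa>_def metric_pos)
  moreover have "\<kappa> * norm v \<le> rnorm g x (?T x v) \<and> rnorm g x (?T x v) \<le> C * norm v" if "x \<in> K" for x v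
  proof (cases "v = 0")
    case True
    have "x \<in> fst c" using that assms by auto
    then show ?thesis using True linear_0[OF linear_tangent[OF assms(1)]] by simp
  next
    case False
    have xc: "x \<in> fst c" using that assms by auto
    define u where "u = (1 / norm v) *\<^sub>R v"
    have "(x, u) \<in> S" using that False by (simp add: S_def u_def)
    then have "\<kappa> \<le> rnorm g x (?T x u)" "rnorm g x (?T x u) \<le> C"
      using p0(2) p1(2) by (force simp: \<kappa>_def C_def rnorm_def)+
    moreover have "rnorm g x (?T x u) = rnorm g x (?T x v) / norm v"
      by (simp add: u_def linear_scale[OF linear_tangent[OF assms(1) xc]] rnorm_scale)
    ultimately show ?thesis using False by (simp add: field_simps)
  qed
  ultimately show ?thesis by blast
qed (auto intro: exI[of _ 1])

end


context riemannian_manifold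
begin

section \<open>Riemannian distance in charts\<close>

lemma curve_speed:
  assumes c: "c \<in> A" and "open X" "t \<in> X" "\<gamma> ` X \<subseteq> fst c"
    and der: "((snd c \<circ> \<gamma>) has_vector_derivative v) (at t)" and d: "d \<in> A" "\<gamma> t \<in> fst d"
  shows "((snd d \<circ> \<gamma>) has_vector_derivative cderiv c d id (\<gamma> t) v) (at t)"
proof -
  have gt: "\<gamma> t \<in> fst c" using assms by auto
  have 1: "((snd c \<circ> \<gamma>) has_derivative (\<lambda>h. h *\<^sub>R v)) (at t)"
    using der by (simp add: has_vector_derivative_def)
  have 2: "((snd d \<circ> id \<circ> chart_inv c) has_derivative cderiv c d id (\<gamma> t)) (at ((snd c \<circ> \<gamma>) t))"
    using cderiv_has_derivative[OF Ck_map_id c d(1) gt] d(2) by simp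
  have "((snd d \<circ> id \<circ> chart_inv c \<circ> (snd c \<circ> \<gamma>)) has_derivative
      (cderiv c d id (\<gamma> t) \<circ> (\<lambda>h. h *\<^sub>R v))) (at t)"
    by (rule diff_chain_at[OF 1 2])
  then have "((snd d \<circ> \<gamma>) has_derivative (cderiv c d id (\<gamma> t) \<circ> (\<lambda>h. h *\<^sub>R v))) (at t)"
    by (rule has_derivative_transform_within_open[OF _ assms(2,3)]) (use assms in auto)
  moreover have "linear (cderiv c d id (\<gamma> t))"
    by (rule linear_cderiv[OF Ck_map_id c d(1) gt]) (use d in simp)
  ultimately show ?thesis
    by (simp add: has_vector_derivative_def o_def linear_scale)
qed

lemma curve_speed_tangent:
  assumes "c \<in> A" "open X" "t \<in> X" "\<gamma> ` X \<subseteq> fst c"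
    and "((snd c \<circ> \<gamma>) has_vector_derivative v) (at t)"
  shows "vector_derivative (snd (chart_at A (\<gamma> t)) \<circ> \<gamma>) (at t) = tangent_of_coord A c (\<gamma> t) v"
  unfolding tangent_of_coord_cderiv
  by (intro vector_derivative_at curve_speed[OF assms]) (auto simp: chart_at)

lemma consecutive_points:
  fixes T :: "real set"
  assumes "finite T" "{0,1} \<subseteq> T" "0 < t" "t < 1" "t \<notin> T"
  obtains a b where "a \<in> T" "b \<in> T" "a < t" "t < b" "T \<inter> {a<..<b} = {}"
proof
  let ?L = "{s\<in>T. s < t}" and ?R = "{s\<in>T. t < s}"
  have fin: "finite ?L" "?L \<noteq> {}" "finite ?R" "?R \<noteq> {}" using assms by auto
  show "Max ?L \<in> T" "Max ?L < t" using Max_in[OF fin(1,2)] by auto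
  show "Min ?R \<in> T" "t < Min ?R" using Min_in[OF fin(3,4)] by auto
  show "T \<inter> {Max ?L<..<Min ?R} = {}"
  proof (rule ccontr)
    assume "T \<inter> {Max ?L<..<Min ?R} \<noteq> {}"
    then obtain s where s: "s \<in> T" "Max ?L < s" "s < Min ?R" by auto
    then have "s < t \<or> t < s" using assms(5) by (cases s t rule: linorder_cases) auto
    then show False
      using s Max_ge[OF fin(1), of s] Min_le[OF fin(3), of s] by auto
  qed
qed

text \<open>Integrate the velocity of the curve in the chart.  The fundamental theorem of calculus only
  needs the derivative outside the finitely many break points, and it is enough to consider the
  part of the curve that stays in \<open>K\<close>, where the metric is controlled.\<close>

lemma curve_length_lower_bound:
  assumes c: "c \<in> A" and \<gamma>: "piecewise_C1_curve A \<gamma>" and \<tau>: "0 \<le> \<tau>" "\<tau> \<le> 1"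
    and K: "\<gamma> ` {0..\<tau>} \<subseteq> K" "K \<subseteq> fst c" and "0 \<le> \<kappa>"
    and low: "\<And>z v. z \<in> K \<Longrightarrow> \<kappa> * norm v \<le> rnorm g z (tangent_of_coord A c z v)"
  shows "ennreal (\<kappa> * norm (snd c (\<gamma> \<tau>) - snd c (\<gamma> 0))) \<le> curve_length A g \<gamma>"
proof -
  let ?\<beta> = "snd c \<circ> \<gamma>"
  let ?v = "\<lambda>t. vector_derivative ?\<beta> (at t)"
  obtain T where T: "finite T" "{0,1} \<subseteq> T"
      "\<forall>a\<in>T. \<forall>b\<in>T. a < b \<and> T \<inter> {a<..<b} = {} \<longrightarrow> C1_curve_on A a b \<gamma>"
    using \<gamma> unfolding piecewise_C1_curve_def by (elim conjE exE) (rule that)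
  have cont\<gamma>: "continuous_on {0..1} \<gamma>" using \<gamma> by (auto simp: piecewise_C1_curve_def path_def)
  have in_c: "\<gamma> t \<in> K" "\<gamma> t \<in> fst c" if "t \<in> {0..\<tau>}" for t
    using that K by blast+
  define S where "S = T \<union> {0, \<tau>}"
  have "finite S" using T by (simp add: S_def)
  have der: "(?\<beta> has_vector_derivative ?v t) (at t)" if "t \<in> {0..\<tau>} - S" for t
  proof -
    have t: "0 < t" "t < 1" "t \<notin> T" "t \<in> {0..\<tau>}" using that \<tau> by (auto simp: S_def)
    obtain a b where ab: "a \<in> T" "b \<in> T" "a < t" "t < b" "T \<inter> {a<..<b} = {}"
      using consecutive_points[OF T(1,2) t(1-3)] .
    then have "C1_curve_on A a b \<gamma>" using T(3) by (meson less_trans)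
    then have "?\<beta> differentiable (at t within {a..b})"
      using c ab in_c[OF t(4)] by (auto simp: C1_curve_on_def)
    then have "?\<beta> differentiable (at t)"
      using ab by (simp add: at_within_Icc_at)
    then show ?thesis by (simp add: vector_derivative_works)
  qed
  have "continuous_on {0..\<tau>} ?\<beta>"
  proof (rule continuous_on_compose)
    show "continuous_on {0..\<tau>} \<gamma>" using cont\<gamma> \<tau> by (rule_tac continuous_on_subset) auto
    show "continuous_on (\<gamma> ` {0..\<tau>}) (snd c)" using K by (intro continuous_on_chart c) auto
  qed
  then have "(?v has_integral (?\<beta> \<tau> - ?\<beta> 0)) {0..\<tau>}"
    by (intro fundamental_theorem_of_calculus_strong[OF \<open>finite S\<close> \<tau>(1)] der)
  then have "((\<lambda>t. \<kappa> *\<^sub>R ?v t) has_integral \<kappa> *\<^sub>R (?\<beta> \<tau> - ?\<beta> 0)) {0..\<tau>}"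
    by (rule has_integral_cmul)
  then have "ennreal (norm (\<kappa> *\<^sub>R (?\<beta> \<tau> - ?\<beta> 0))) \<le> (\<integral>\<^sup>+ t\<in>{0..\<tau>}. ennreal (norm (\<kappa> *\<^sub>R ?v t)) \<partial>lborel)"
    by (rule has_integral_norm_le_nn_integral)
  also have "\<dots> \<le> curve_length A g \<gamma>"
    unfolding curve_length_def
  proof (rule nn_integral_mono_AE)
    have "S \<in> null_sets lborel" using \<open>finite S\<close> by (rule finite_imp_null_set_lborel)
    then have "AE t in lborel. t \<notin> S" by (rule AE_not_in)
    then show "AE t in lborel. ennreal (norm (\<kappa> *\<^sub>R ?v t)) * indicator {0..\<tau>} t \<le>
        ennreal (rnorm g (\<gamma> t) (vector_derivative (snd (chart_at A (\<gamma> t)) \<circ> \<gamma>) (at t))) * indicator {0..1} t"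
    proof eventually_elim
      case (elim t)
      show ?case
      proof (cases "t \<in> {0..\<tau>}")
        case True
        then have t: "t \<in> {0<..<\<tau>}" using elim by (auto simp: S_def less_le)
        have "vector_derivative (snd (chart_at A (\<gamma> t)) \<circ> \<gamma>) (at t) = tangent_of_coord A c (\<gamma> t) (?v t)"
          by (rule curve_speed_tangent[OF c open_greaterThanLessThan t])
            (use in_c der True elim in auto)
        then show ?thesis
          using low[OF in_c(1)[OF True], of "?v t"] True \<tau> \<open>0 \<le> \<kappa>\<close>
          by (simp add: ennreal_leI)
      qed simp
    qed
  qed
  finally show ?thesis using \<open>0 \<le> \<kappa>\<close> by simp
qed

text \<open>A curve from \<open>x\<close> either stays in the coordinate ball of radius \<open>t\<close>, and then its length is at
  least \<open>\<kappa>\<close> times the Euclidean distance of its ends, or it leaves this ball, and then its length is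
  at least \<open>\<kappa> t\<close>.  A distance below \<open>\<kappa> t\<close> provides a curve of the first kind.\<close>

lemma rdist_lower_bound:
  assumes c: "c \<in> A" and x: "x \<in> fst c" and t: "0 < t" and cb: "cball (snd c x) t \<subseteq> snd c ` fst c"
    and "0 < \<kappa>"
    and low: "\<And>y v. y \<in> cball (snd c x) t \<Longrightarrow>
      \<kappa> * norm v \<le> rnorm g (chart_inv c y) (tangent_of_coord A c (chart_inv c y) v)"
    and less: "rdist A g x y < ennreal (\<kappa> * t)"
  shows "y \<in> fst c \<and> ennreal (\<kappa> * norm (snd c x - snd c y)) \<le> rdist A g x y"
proof -
  let ?u = "snd c"
  define K where "K = chart_inv c ` cball (?u x) t"
  define V where "V = fst c \<inter> ?u -` ball (?u x) t"
  have "compact K"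
    unfolding K_def by (intro compact_continuous_image compact_cball continuous_on_chart_inv c cb)
  then have "closed K" by (rule compact_imp_closed)
  have Kc: "K \<subseteq> fst c" using cb c by (auto simp: K_def)
  have VK: "V \<subseteq> K"
  proof
    fix z assume "z \<in> V"
    then have "z = chart_inv c (?u z)" "?u z \<in> cball (?u x) t" using c by (auto simp: V_def)
    then show "z \<in> K" unfolding K_def by blast
  qed
  have uK: "?u z \<in> cball (?u x) t" if "z \<in> K" for z
    using that cb c by (auto simp: K_def)
  have "open V"
    unfolding V_def using continuous_on_open_vimage[OF open_chart_domain[OF c], of ?u]
      continuous_on_chart[OF c order_refl] by (auto simp: Int_commute)
  have lowK: "\<kappa> * norm v \<le> rnorm g z (tangent_of_coord A c z v)" if "z \<in> K" for z v
    using that low by (auto simp: K_def)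
  have dich: "ennreal (\<kappa> * t) \<le> curve_length A g \<gamma> \<or>
      (y \<in> fst c \<and> ennreal (\<kappa> * norm (?u x - ?u y)) \<le> curve_length A g \<gamma>)"
    if \<gamma>: "piecewise_C1_curve A \<gamma>" "pathstart \<gamma> = x" "pathfinish \<gamma> = y" for \<gamma>
  proof -
    have ends: "\<gamma> 0 = x" "\<gamma> 1 = y" using \<gamma> by (auto simp: pathstart_def pathfinish_def)
    have cont: "continuous_on {0..1} \<gamma>" using \<gamma> by (auto simp: piecewise_C1_curve_def path_def)
    show ?thesis
    proof (cases "\<gamma> ` {0..1} \<subseteq> V")
      case True
      then have "\<gamma> ` {0..1} \<subseteq> K" using VK by auto
      then have "ennreal (\<kappa> * norm (?u (\<gamma> 1) - ?u (\<gamma> 0))) \<le> curve_length A g \<gamma>"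
        using \<open>0 < \<kappa>\<close> by (intro curve_length_lower_bound[OF c \<gamma>(1) _ _ _ Kc _ lowK]) auto
      moreover have "y \<in> V" using True ends by (metis atLeastAtMost_iff image_subset_iff order_refl zero_le_one)
      ultimately show ?thesis using ends by (auto simp: V_def norm_minus_commute)
    next
      case False
      \<comment> \<open>the first time at which the curve leaves the coordinate ball\<close>
      define Z where "Z = {0..1} \<inter> \<gamma> -` (- V)"
      have "closed Z"
        unfolding Z_def using \<open>open V\<close> by (intro continuous_closed_preimage cont) auto
      then have "compact Z"
        using compact_Int_closed[of "{0..1::real}" Z] by (simp add: Z_def Int_absorb1)
      moreover have "Z \<noteq> {}" using False by (auto simp: Z_def)
      ultimately obtain \<tau> where \<tau>: "\<tau> \<in> Z" "\<And>s. s \<in> Z \<Longrightarrow> \<tau> \<le> s"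
        using compact_attains_inf by metis
      have \<tau>01: "0 \<le> \<tau>" "\<tau> \<le> 1" "\<gamma> \<tau> \<notin> V" using \<tau>(1) by (auto simp: Z_def)
      have "x \<in> V" using x t by (simp add: V_def)
      then have "\<tau> \<noteq> 0" using \<tau>01 ends by auto
      have before: "\<gamma> s \<in> V" if "0 \<le> s" "s < \<tau>" for s
        using that \<tau>(2)[of s] \<tau>01 by (auto simp: Z_def)
      have clos: "closure {0..<\<tau>} = {0..\<tau>}" using \<open>\<tau> \<noteq> 0\<close> \<tau>01 by simp
      have "\<gamma> ` closure {0..<\<tau>} \<subseteq> K"
      proof (rule image_closure_subset[OF _ \<open>closed K\<close>])
        show "continuous_on (closure {0..<\<tau>}) \<gamma>"
          unfolding clos using cont \<tau>01 by (rule_tac continuous_on_subset) auto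
        show "\<gamma> ` {0..<\<tau>} \<subseteq> K" using before VK by auto
      qed
      then have sub: "\<gamma> ` {0..\<tau>} \<subseteq> K" by (simp only: clos)
      then have "\<gamma> \<tau> \<in> K" using \<tau>01 by auto
      then have "dist (?u x) (?u (\<gamma> \<tau>)) = t"
        using \<tau>01(3) uK[of "\<gamma> \<tau>"] Kc by (auto simp: V_def)
      moreover have "ennreal (\<kappa> * norm (?u (\<gamma> \<tau>) - ?u (\<gamma> 0))) \<le> curve_length A g \<gamma>"
        using \<open>0 < \<kappa>\<close> \<tau>01 by (intro curve_length_lower_bound[OF c \<gamma>(1) _ _ sub Kc _ lowK]) auto
      ultimately show ?thesis using ends by (auto simp: dist_norm norm_minus_commute)
    qed
  qed
  obtain \<gamma>0 where \<gamma>0: "piecewise_C1_curve A \<gamma>0" "pathstart \<gamma>0 = x" "pathfinish \<gamma>0 = y"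
      "curve_length A g \<gamma>0 < ennreal (\<kappa> * t)"
    using less unfolding rdist_def INF_less_iff by auto
  then have y: "y \<in> fst c" and le: "ennreal (\<kappa> * norm (?u x - ?u y)) \<le> curve_length A g \<gamma>0"
    using dich[OF \<gamma>0(1-3)] by auto
  have "ennreal (\<kappa> * norm (?u x - ?u y)) \<le> ennreal (\<kappa> * t)"
    using le \<gamma>0(4) by (meson le_less_trans less_imp_le)
  then have "ennreal (\<kappa> * norm (?u x - ?u y)) \<le> rdist A g x y"
    unfolding rdist_def using dich by (intro INF_greatest) (auto intro: order_trans)
  with y show ?thesis by blast
qed

text \<open>Follow the straight segment in the chart.\<close>

lemma rdist_upper_bound:
  assumes c: "c \<in> A" and S: "convex S" "S \<subseteq> snd c ` fst c"
    and up: "\<And>y v. y \<in> S \<Longrightarrow>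
      rnorm g (chart_inv c y) (tangent_of_coord A c (chart_inv c y) v) \<le> C * norm v"
    and x: "x \<in> fst c" "snd c x \<in> S" and y: "y \<in> fst c" "snd c y \<in> S"
  shows "rdist A g x y \<le> ennreal (C * norm (snd c x - snd c y))"
proof -
  let ?u = "snd c"
  define w where "w = ?u y - ?u x"
  define l where "l t = ?u x + t *\<^sub>R w" for t
  define \<gamma> where "\<gamma> = chart_inv c \<circ> l"
  define X where "X = l -` (?u ` fst c)"
  have lS: "l t \<in> S" if "t \<in> {0..1}" for t
  proof -
    have "l t = (1 - t) *\<^sub>R ?u x + t *\<^sub>R ?u y" by (simp add: l_def w_def algebra_simps)
    then show ?thesis using S(1) x y that by (auto simp: convex_alt)
  qed
  have contl: "continuous_on T l" for T unfolding l_def by (intro continuous_intros)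
  have "open (?u ` fst c)" using open_chart_image[OF c open_UNIV] by simp
  then have "open X" unfolding X_def using contl by (intro open_vimage)
  have X01: "{0..1} \<subseteq> X" unfolding X_def using lS S(2) by blast
  have ul: "?u (\<gamma> t) = l t" "\<gamma> t \<in> fst c" if "t \<in> X" for t
    using that c by (auto simp: \<gamma>_def X_def)
  have der: "((?u \<circ> \<gamma>) has_vector_derivative w) (at t)" if "t \<in> X" for t
  proof -
    have "(l has_vector_derivative w) (at t)"
      unfolding l_def by (auto intro!: derivative_eq_intros)
    then show ?thesis
      by (rule has_vector_derivative_transform_within_open[OF _ \<open>open X\<close> that]) (simp add: ul)
  qed
  have sub: "\<gamma> ` X \<subseteq> fst c" using ul by auto
  have contX: "continuous_on X \<gamma>"
    unfolding \<gamma>_def by (intro continuous_on_compose contl continuous_on_chart_inv c) (auto simp: X_def)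
  have cont: "continuous_on {0..1} \<gamma>" using contX X01 by (rule continuous_on_subset)
  have C1: "C1_curve_on A 0 1 \<gamma>"
    unfolding C1_curve_on_def
  proof (intro conjI ballI)
    fix d assume d: "d \<in> A"
    have derd: "((snd d \<circ> \<gamma>) has_vector_derivative cderiv c d id (\<gamma> t) w) (at t within {0..1})"
      if "t \<in> {0..1} \<inter> \<gamma> -` fst d" for t
    proof (rule has_vector_derivative_at_within)
      have "t \<in> X" using X01 that by auto
      show "((snd d \<circ> \<gamma>) has_vector_derivative cderiv c d id (\<gamma> t) w) (at t)"
        by (rule curve_speed[OF c \<open>open X\<close> \<open>t \<in> X\<close> sub der[OF \<open>t \<in> X\<close>] d]) (use that in auto)
    qed
    then show "(snd d \<circ> \<gamma>) differentiable (at t within {0..1})" if "t \<in> {0..1} \<inter> \<gamma> -` fst d" for t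
      using that differentiableI_vector by blast
    have "vector_derivative (snd d \<circ> \<gamma>) (at t within {0..1}) =
        frechet_derivative (snd d \<circ> id \<circ> chart_inv c) (at (l t)) w" if "t \<in> {0..1} \<inter> \<gamma> -` fst d" for t
    proof -
      have "t \<in> {0..1}" using that by auto
      then have "vector_derivative (snd d \<circ> \<gamma>) (at t within {0..1}) = cderiv c d id (\<gamma> t) w"
        using vector_derivative_within_closed_interval[OF _ _ derd[OF that]] by auto
      then show ?thesis using ul(1)[of t] X01 \<open>t \<in> {0..1}\<close> by (auto simp: cderiv_def)
    qed
    moreover have "continuous_on ({0..1} \<inter> \<gamma> -` fst d)
        (\<lambda>t. frechet_derivative (snd d \<circ> id \<circ> chart_inv c) (at (l t)) w)"
    proof (rule continuous_on_compose2[OF _ contl])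
      show "continuous_on (snd c ` (fst c \<inter> id -` fst d))
          (\<lambda>y. frechet_derivative (snd d \<circ> id \<circ> chart_inv c) (at y) w)"
        using Ck_map_C1_on[OF Ck_map_id c d] by (simp add: C1_on_def)
      show "l ` ({0..1} \<inter> \<gamma> -` fst d) \<subseteq> snd c ` (fst c \<inter> id -` fst d)"
      proof
        fix z assume "z \<in> l ` ({0..1} \<inter> \<gamma> -` fst d)"
        then obtain t where t: "t \<in> {0..1}" "\<gamma> t \<in> fst d" "z = l t" by auto
        then have "t \<in> X" using X01 by auto
        then have "z = snd c (\<gamma> t)" "\<gamma> t \<in> fst c" using ul t by auto
        then show "z \<in> snd c ` (fst c \<inter> id -` fst d)" using t by auto
      qed
    qed
    ultimately show "continuous_on ({0..1} \<inter> \<gamma> -` fst d)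
        (\<lambda>t. vector_derivative (snd d \<circ> \<gamma>) (at t within {0..1}))"
      by (subst continuous_on_cong[OF refl]) auto
  qed (rule cont)
  have pw: "piecewise_C1_curve A \<gamma>"
    unfolding piecewise_C1_curve_def path_def
    using cont C1 by (intro conjI exI[of _ "{0,1}"]) auto
  have ends: "pathstart \<gamma> = x" "pathfinish \<gamma> = y"
    using c x y by (simp_all add: pathstart_def pathfinish_def \<gamma>_def l_def w_def)
  have "rdist A g x y \<le> curve_length A g \<gamma>"
    unfolding rdist_def by (rule INF_lower) (use pw ends in simp)
  also have "\<dots> \<le> (\<integral>\<^sup>+ t. ennreal (C * norm w) * indicator {0..1::real} t \<partial>lborel)"
    unfolding curve_length_def
  proof (rule nn_integral_mono)
    fix t :: real
    show "ennreal (rnorm g (\<gamma> t) (vector_derivative (snd (chart_at A (\<gamma> t)) \<circ> \<gamma>) (at t))) * indicator {0..1} t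
        \<le> ennreal (C * norm w) * indicator {0..1} t"
    proof (cases "t \<in> {0..1}")
      case True
      then have "t \<in> X" using X01 by auto
      have "vector_derivative (snd (chart_at A (\<gamma> t)) \<circ> \<gamma>) (at t) = tangent_of_coord A c (\<gamma> t) w"
        by (rule curve_speed_tangent[OF c \<open>open X\<close> \<open>t \<in> X\<close> sub der[OF \<open>t \<in> X\<close>]])
      moreover have "\<gamma> t = chart_inv c (l t)" by (simp add: \<gamma>_def)
      ultimately show ?thesis
        using up[OF lS[OF True], of w] by (auto intro!: ennreal_leI mult_right_mono)
    qed simp
  qed
  also have "\<dots> = ennreal (C * norm w)"
    by (subst nn_integral_cmult_indicator) auto
  finally show ?thesis by (simp add: w_def norm_minus_commute)
qed

section \<open>Compact sets in charts\<close>

text \<open>Cover the set by small coordinate balls, choose finitely many of them, and collect those that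
  belong to the same chart.\<close>

lemma finite_chart_cover:
  assumes "compact L"
  obtains I K where "finite I" "I \<subseteq> A" "\<And>c. c \<in> I \<Longrightarrow> compact (K c)"
    "\<And>c. c \<in> I \<Longrightarrow> K c \<subseteq> fst c" "L = (\<Union>c\<in>I. K c)"
proof -
  let ?c = "chart_at A"
  have "\<exists>r>0. cball (snd (?c x) x) r \<subseteq> snd (?c x) ` fst (?c x)" for x
  proof -
    have "open (snd (?c x) ` fst (?c x))"
      using open_chart_image[OF conjunct1[OF chart_at] open_UNIV] by simp
    then show ?thesis using chart_at[of x] by (meson imageI open_contains_cball)
  qed
  then obtain r where r: "\<And>x. r x > 0" "\<And>x. cball (snd (?c x) x) (r x) \<subseteq> snd (?c x) ` fst (?c x)"
    by metis
  define Vx where "Vx x = fst (?c x) \<inter> snd (?c x) -` ball (snd (?c x) x) (r x)" for x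
  have oV: "open (Vx x)" for x
    unfolding Vx_def using continuous_on_open_vimage[OF open_chart_domain, of "?c x" "snd (?c x)"]
      continuous_on_chart[of "?c x"] chart_at[of x] by (auto simp: Int_commute)
  have xV: "x \<in> Vx x" for x using chart_at[of x] r by (simp add: Vx_def)
  obtain Y where Y: "Y \<subseteq> L" "finite Y" "L \<subseteq> (\<Union>x\<in>Y. Vx x)"
    by (rule compactE_image[OF assms, of L Vx]) (use oV xV in auto)
  define B where "B x = chart_inv (?c x) ` cball (snd (?c x) x) (r x)" for x
  have cB: "compact (B x)" for x
    unfolding B_def by (intro compact_continuous_image compact_cball continuous_on_chart_inv r(2))
      (simp add: chart_at)
  have VB: "Vx x \<subseteq> B x" for x
  proof
    fix z assume "z \<in> Vx x"
    then have "z = chart_inv (?c x) (snd (?c x) z)" "snd (?c x) z \<in> cball (snd (?c x) x) (r x)"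
      using chart_at[of x] by (auto simp: Vx_def)
    then show "z \<in> B x" unfolding B_def by blast
  qed
  have Bc: "B x \<subseteq> fst (?c x)" for x
  proof
    fix z assume "z \<in> B x"
    then obtain y where "y \<in> cball (snd (?c x) x) (r x)" "z = chart_inv (?c x) y" by (auto simp: B_def)
    then show "z \<in> fst (?c x)" using r(2)[of x] chart_at[of x] chart_inv_in[of "?c x" y] by blast
  qed
  define K where "K c = (\<Union>x\<in>{x\<in>Y. ?c x = c}. B x) \<inter> L" for c
  show thesis
  proof (rule that[of "?c ` Y" K])
    show "finite (?c ` Y)" using Y by simp
    show "?c ` Y \<subseteq> A" using chart_at by auto
    show "compact (K c)" for c
      unfolding K_def using Y assms by (intro compact_Int compact_UN cB) auto
    show "K c \<subseteq> fst c" for c using Bc by (auto simp: K_def)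
    show "L = (\<Union>c\<in>?c ` Y. K c)"
    proof
      show "L \<subseteq> (\<Union>c\<in>?c ` Y. K c)"
      proof
        fix z assume "z \<in> L"
        then obtain x where "x \<in> Y" "z \<in> B x" using Y(3) VB by blast
        then show "z \<in> (\<Union>c\<in>?c ` Y. K c)" using \<open>z \<in> L\<close> by (auto simp: K_def)
      qed
    qed (auto simp: K_def)
  qed
qed

lemma chart_constants:
  assumes c: "c \<in> A" and K: "compact K" "K \<subseteq> fst c"
  shows "\<exists>\<rho>>0. \<exists>\<kappa>>0. \<exists>C. \<forall>z\<in>K. cball (snd c z) \<rho> \<subseteq> snd c ` fst c \<and>
    (\<forall>y\<in>cball (snd c z) \<rho>. \<forall>v.
      \<kappa> * norm v \<le> rnorm g (chart_inv c y) (tangent_of_coord A c (chart_inv c y) v) \<and>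
      rnorm g (chart_inv c y) (tangent_of_coord A c (chart_inv c y) v) \<le> C * norm v)"
proof -
  have "compact (snd c ` K)" by (intro compact_continuous_image continuous_on_chart c K)
  moreover have "open (snd c ` fst c)" using open_chart_image[OF c open_UNIV] by simp
  ultimately obtain e where e: "0 < e" "(\<Union>x\<in>snd c ` K. ball x e) \<subseteq> snd c ` fst c"
    using compact_subset_open_imp_ball_epsilon_subset K(2) by (metis image_mono)
  define K' where "K' = {x + y |x y. x \<in> snd c ` K \<and> y \<in> cball 0 (e/2)}"
  have "compact K'" unfolding K'_def by (intro compact_sums \<open>compact (snd c ` K)\<close> compact_cball)
  have K'I: "y \<in> K'" if "z \<in> K" "y \<in> cball (snd c z) (e/2)" for y z
  proof -
    have "y = snd c z + (y - snd c z)" "y - snd c z \<in> cball 0 (e/2)" "snd c z \<in> snd c ` K"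
      using that by (auto simp: dist_norm norm_minus_commute)
    then show ?thesis unfolding K'_def by blast
  qed
  have "K' \<subseteq> snd c ` fst c"
  proof
    fix w assume "w \<in> K'"
    then obtain z y where "z \<in> K" "norm y \<le> e/2" "w = snd c z + y" by (auto simp: K'_def)
    then have "w \<in> ball (snd c z) e" using e(1) by (simp add: dist_norm)
    then show "w \<in> snd c ` fst c" using e(2) \<open>z \<in> K\<close> by blast
  qed
  then have "compact (chart_inv c ` K')" "chart_inv c ` K' \<subseteq> fst c"
    using c by (auto intro!: compact_continuous_image continuous_on_chart_inv \<open>compact K'\<close>)
  from metric_bounds[OF c this] obtain \<kappa> C where *: "\<kappa> > 0"
    "\<And>z v. z \<in> chart_inv c ` K' \<Longrightarrow> \<kappa> * norm v \<le> rnorm g z (tangent_of_coord A c z v) \<and>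
       rnorm g z (tangent_of_coord A c z v) \<le> C * norm v" by blast
  show ?thesis
  proof (intro exI conjI ballI allI)
    show "0 < e/2" "0 < \<kappa>" using e * by auto
    show "cball (snd c z) (e/2) \<subseteq> snd c ` fst c" if "z \<in> K" for z
      using K'I[OF that] \<open>K' \<subseteq> snd c ` fst c\<close> by blast
  qed (use * K'I in blast)+
qed

end


section \<open>Operator norms of differentials\<close>

context riemannian_manifold
begin

text \<open>In the selected chart at \<open>x\<close> the coordinate change is the identity, so this is \<open>metric_bounds\<close> at
  a single point.\<close>

lemma rnorm_equivalent:
  obtains a b where "0 < a" "\<And>v. a * norm v \<le> rnorm g x v" "\<And>v. rnorm g x v \<le> b * norm v"
proof -
  let ?c = "chart_at A x"
  have "tangent_of_coord A ?c x = id"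
    unfolding tangent_of_coord_cderiv by (rule cderiv_self) (simp_all add: chart_at)
  moreover obtain a b where "0 < a" "\<And>v. a * norm v \<le> rnorm g x (tangent_of_coord A ?c x v) \<and>
      rnorm g x (tangent_of_coord A ?c x v) \<le> b * norm v"
    using metric_bounds[of ?c "{x}"] chart_at[of x] by auto
  ultimately show thesis using that[of a b] by simp
qed

lemma unit_vector_exists: "\<exists>v. rnorm g x v = 1"
proof -
  obtain v :: "real^'n" where "v \<noteq> 0" by (metis axis_eq_0_iff zero_neq_one)
  then have "rnorm g x ((1 / rnorm g x v) *\<^sub>R v) = 1"
    using rnorm_pos[of v x] by (simp add: rnorm_scale)
  then show ?thesis by blast
qed

text \<open>Boundedness makes the supremum that defines \<open>rop_norm\<close> meaningful.\<close>

lemma bdd_above_rnorm: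
  assumes "linear L"
  shows "bdd_above ((\<lambda>v. rnorm g y (L v)) ` {v. rnorm g x v = 1})"
proof -
  obtain a b where x: "0 < a" "\<And>v. a * norm v \<le> rnorm g x v" using rnorm_equivalent[of x] by metis
  obtain a' b' where y: "\<And>v. rnorm g y v \<le> b' * norm v" using rnorm_equivalent[of y] by metis
  have bl: "bounded_linear L" using assms by (simp add: linear_conv_bounded_linear)
  have "rnorm g y (L v) \<le> \<bar>b'\<bar> * (onorm L * (1 / a))" if "rnorm g x v = 1" for v
  proof -
    have "norm v \<le> 1 / a" using x(2)[of v] x(1) that by (simp add: field_simps)
    then have "norm (L v) \<le> onorm L * (1 / a)"
      using onorm[OF bl, of v] onorm_pos_le[OF bl] by (meson mult_left_mono order_trans)
    moreover have "rnorm g y (L v) \<le> \<bar>b'\<bar> * norm (L v)"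
      using y[of "L v"] mult_right_mono[OF abs_ge_self[of b'] norm_ge_zero[of "L v"]] by linarith
    ultimately show ?thesis by (meson abs_ge_zero mult_left_mono order_trans)
  qed
  then show ?thesis by (intro bdd_aboveI2) auto
qed

lemma rop_norm_ge:
  assumes "linear L" and low: "\<And>v. b * rnorm g x v \<le> rnorm g y (L v)"
  shows "b \<le> rop_norm g x y L"
proof -
  obtain v where v: "rnorm g x v = 1" using unit_vector_exists by blast
  have "b \<le> rnorm g y (L v)" using low[of v] v by simp
  also have "\<dots> \<le> rop_norm g x y L"
    unfolding rop_norm_def by (rule cSUP_upper[OF _ bdd_above_rnorm[OF assms(1)]]) (use v in simp)
  finally show ?thesis .
qed

lemma rop_norm_nonneg: "linear L \<Longrightarrow> 0 \<le> rop_norm g x y L"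
  by (rule rop_norm_ge) auto

lemma rnorm_le_rop_norm:
  assumes "linear L"
  shows "rnorm g y (L v) \<le> rop_norm g x y L * rnorm g x v"
proof (cases "v = 0")
  case False
  then have p: "0 < rnorm g x v" by (rule rnorm_pos)
  define w where "w = (1 / rnorm g x v) *\<^sub>R v"
  have "rnorm g x w = 1" using p by (simp add: w_def rnorm_scale)
  then have "rnorm g y (L w) \<le> rop_norm g x y L"
    unfolding rop_norm_def by (intro cSUP_upper[OF _ bdd_above_rnorm[OF assms]]) simp
  moreover have "rnorm g y (L w) = rnorm g y (L v) / rnorm g x v"
    using p by (simp add: w_def linear_scale[OF assms] rnorm_scale)
  ultimately show ?thesis using p by (simp add: field_simps)
qed (simp add: linear_0[OF assms])

lemma rop_norm_le:
  assumes "\<And>v. rnorm g y (L v) \<le> B * rnorm g x v"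
  shows "rop_norm g x y L \<le> B"
  unfolding rop_norm_def
proof (rule cSUP_least)
  show "{v. rnorm g x v = 1} \<noteq> {}" using unit_vector_exists[of x] by blast
  show "rnorm g y (L v) \<le> B" if "v \<in> {v. rnorm g x v = 1}" for v
    using assms[of v] that by simp
qed

lemma rop_norm_compose:
  assumes "linear L1" "linear L2"
  shows "rop_norm g x z (L2 \<circ> L1) \<le> rop_norm g y z L2 * rop_norm g x y L1"
proof (rule rop_norm_le)
  fix v
  have "rnorm g z (L2 (L1 v)) \<le> rop_norm g y z L2 * rnorm g y (L1 v)"
    by (rule rnorm_le_rop_norm[OF assms(2)])
  also have "\<dots> \<le> rop_norm g y z L2 * (rop_norm g x y L1 * rnorm g x v)"
    by (intro mult_left_mono rnorm_le_rop_norm rop_norm_nonneg assms)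
  finally show "rnorm g z ((L2 \<circ> L1) v) \<le> rop_norm g y z L2 * rop_norm g x y L1 * rnorm g x v"
    by (simp add: mult.assoc)
qed

end

section \<open>A compact set with a finite family of charts\<close>

text \<open>Finitely many charts in \<open>I\<close> suffice for \<open>\<Lambda>\<close>; the compact pieces \<open>K c\<close> cover it, and \<open>p\<close> selects for
  every point of \<open>\<Lambda>\<close> a chart in whose piece it lies.  On coordinate balls of radius \<open>\<rho>\<close> the metric is
  comparable with the Euclidean one, with constants \<open>\<kappa>\<close> and \<open>C\<close>.\<close>

locale charted_set = riemannian_manifold A g
  for A :: "('m::{t2_space,second_countable_topology}, 'n::finite) chart set"
    and g :: "('m, 'n) metric_tensor" +
  fixes \<Lambda> :: "'m set" and I :: "('m, 'n) chart set" and K :: "('m, 'n) chart \<Rightarrow> 'm set"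
    and p :: "'m \<Rightarrow> ('m, 'n) chart" and \<rho> \<kappa> C :: real
  assumes finite_I: "finite I" and I_sub: "I \<subseteq> A"
    and compact_K: "c \<in> I \<Longrightarrow> compact (K c)" and K_chart: "c \<in> I \<Longrightarrow> K c \<subseteq> fst c"
    and K_sub: "c \<in> I \<Longrightarrow> K c \<subseteq> \<Lambda>"
    and p: "x \<in> \<Lambda> \<Longrightarrow> p x \<in> I \<and> x \<in> K (p x)"
    and constants: "0 < \<rho>" "0 < \<kappa>" "\<kappa> \<le> C"
    and cball_chart: "c \<in> I \<Longrightarrow> z \<in> K c \<Longrightarrow> cball (snd c z) \<rho> \<subseteq> snd c ` fst c"
    and metric_low: "c \<in> I \<Longrightarrow> z \<in> K c \<Longrightarrow> y \<in> cball (snd c z) \<rho> \<Longrightarrow>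
      \<kappa> * norm v \<le> rnorm g (chart_inv c y) (tangent_of_coord A c (chart_inv c y) v)"
    and metric_up: "c \<in> I \<Longrightarrow> z \<in> K c \<Longrightarrow> y \<in> cball (snd c z) \<rho> \<Longrightarrow>
      rnorm g (chart_inv c y) (tangent_of_coord A c (chart_inv c y) v) \<le> C * norm v"
begin

lemma C_pos: "0 < C" using constants by linarith

lemma p_chart: "x \<in> \<Lambda> \<Longrightarrow> p x \<in> I" "x \<in> \<Lambda> \<Longrightarrow> p x \<in> A" "x \<in> \<Lambda> \<Longrightarrow> x \<in> K (p x)" "x \<in> \<Lambda> \<Longrightarrow> x \<in> fst (p x)"
  using p I_sub K_chart by blast+

lemma chart_inv_K: "c \<in> I \<Longrightarrow> z \<in> K c \<Longrightarrow> chart_inv c (snd c z) = z"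
  by (rule chart_inv_chart) (use I_sub K_chart in blast)+

lemma metric_low_at:
  assumes "c \<in> I" "z \<in> K c" shows "\<kappa> * norm v \<le> rnorm g z (tangent_of_coord A c z v)"
  using metric_low[OF assms, of "snd c z" v] constants chart_inv_K[OF assms] by simp

lemma metric_up_at:
  assumes "c \<in> I" "z \<in> K c" shows "rnorm g z (tangent_of_coord A c z v) \<le> C * norm v"
  using metric_up[OF assms, of "snd c z" v] constants chart_inv_K[OF assms] by simp

lemma rdist_le_chart_dist:
  assumes "c \<in> I" "z \<in> K c" "x \<in> fst c" "y \<in> fst c"
    and "dist (snd c z) (snd c x) \<le> \<rho>" "dist (snd c z) (snd c y) \<le> \<rho>"
  shows "rdist A g x y \<le> ennreal (C * dist (snd c x) (snd c y))"
  unfolding dist_norm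
proof (rule rdist_upper_bound[where S="cball (snd c z) \<rho>"])
  show "c \<in> A" using assms(1) I_sub by blast
  show "snd c x \<in> cball (snd c z) \<rho>" "snd c y \<in> cball (snd c z) \<rho>" using assms(5,6) by auto
qed (use assms(3,4) metric_up[OF assms(1,2)] cball_chart[OF assms(1,2)] in simp_all)

lemma chart_dist_le_rdist:
  assumes c: "c \<in> I" "z \<in> K c" and x: "x \<in> fst c" "dist (snd c z) (snd c x) \<le> \<rho> / 2"
    and less: "rdist A g x y < ennreal (\<kappa> * (\<rho> / 2))"
  shows "y \<in> fst c \<and> ennreal (\<kappa> * dist (snd c x) (snd c y)) \<le> rdist A g x y"
proof -
  have sub: "cball (snd c x) (\<rho> / 2) \<subseteq> cball (snd c z) \<rho>"
  proof
    fix w assume "w \<in> cball (snd c x) (\<rho> / 2)"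
    then show "w \<in> cball (snd c z) \<rho>"
      using x(2) dist_triangle[of "snd c z" w "snd c x"] by simp
  qed
  show ?thesis
    unfolding dist_norm
  proof (rule rdist_lower_bound[OF _ x(1) _ _ constants(2) _ less])
    show "c \<in> A" using c I_sub by auto
    show "cball (snd c x) (\<rho> / 2) \<subseteq> snd c ` fst c" using sub cball_chart[OF c] by blast
    show "\<kappa> * norm v \<le> rnorm g (chart_inv c y) (tangent_of_coord A c (chart_inv c y) v)"
      if "y \<in> cball (snd c x) (\<rho> / 2)" for y v
      using metric_low[OF c] sub that by blast
  qed (use constants in auto)
qed

text \<open>Closeness of \<open>y\<close> to the point \<open>x\<close> of \<open>\<Lambda>\<close>, measured in the chart of \<open>x\<close>.  This is not a metric, but
  it is equivalent to one at small scale: the next lemmas compare it with the Riemannian distance,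
  and through that provide substitutes for symmetry and the triangle inequality.\<close>

definition near :: "real \<Rightarrow> 'm \<Rightarrow> 'm \<Rightarrow> bool" where
  "near t x y \<longleftrightarrow> y \<in> fst (p x) \<and> dist (snd (p x) x) (snd (p x) y) \<le> t"

lemma near_mono: "near s x y \<Longrightarrow> s \<le> t \<Longrightarrow> near t x y"
  by (auto simp: near_def)

lemma near_imp_rdist:
  assumes "x \<in> \<Lambda>" "near t x y" "t \<le> \<rho>"
  shows "rdist A g x y \<le> ennreal (C * t)" "rdist A g y x \<le> ennreal (C * t)"
proof -
  let ?u = "snd (p x)"
  have d: "dist (?u x) (?u y) \<le> t" "y \<in> fst (p x)" using assms by (auto simp: near_def)
  have C: "ennreal (C * dist (?u x) (?u y)) \<le> ennreal (C * t)"
    using d C_pos by (intro ennreal_leI mult_left_mono) auto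
  have "rdist A g x y \<le> ennreal (C * dist (?u x) (?u y))"
    by (rule rdist_le_chart_dist[of _ x]) (use p_chart assms d constants in auto)
  then show "rdist A g x y \<le> ennreal (C * t)" using C by (rule order_trans)
  have "rdist A g y x \<le> ennreal (C * dist (?u y) (?u x))"
    by (rule rdist_le_chart_dist[of _ x]) (use p_chart assms d constants in auto)
  then show "rdist A g y x \<le> ennreal (C * t)" using C by (simp add: dist_commute)
qed

lemma rdist_imp_near:
  assumes "x \<in> \<Lambda>" "rdist A g x y \<le> ennreal (\<kappa> * t)" "0 \<le> t" "t < \<rho> / 2"
  shows "near t x y"
proof -
  have "ennreal (\<kappa> * t) < ennreal (\<kappa> * (\<rho> / 2))"
    using assms constants by (intro ennreal_lessI) auto
  then have "rdist A g x y < ennreal (\<kappa> * (\<rho> / 2))" using assms(2) by simp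
  then have "y \<in> fst (p x) \<and> ennreal (\<kappa> * dist (snd (p x) x) (snd (p x) y)) \<le> rdist A g x y"
    by (intro chart_dist_le_rdist[of _ x]) (use p_chart assms constants in auto)
  then have "y \<in> fst (p x)" "ennreal (\<kappa> * dist (snd (p x) x) (snd (p x) y)) \<le> ennreal (\<kappa> * t)"
    using assms(2) by auto
  then show ?thesis using assms constants by (simp add: near_def)
qed

lemma rdist_imp_near_sym:
  assumes "x \<in> \<Lambda>" "z \<in> \<Lambda>" "rdist A g x z \<le> ennreal (\<kappa> * t)" "0 \<le> t" "C * t / \<kappa> < \<rho> / 2"
  shows "near (C * t / \<kappa>) z x"
proof -
  have "t * \<kappa> \<le> t * C" using assms constants by (intro mult_left_mono) auto
  then have "t \<le> C * t / \<kappa>" using constants by (simp add: field_simps)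
  then have "t < \<rho> / 2" using assms by linarith
  then have "near t x z" by (intro rdist_imp_near assms)
  then have "rdist A g z x \<le> ennreal (C * t)"
    using near_imp_rdist(2)[OF assms(1)] \<open>t < \<rho> / 2\<close> constants by simp
  then show ?thesis
    using constants C_pos assms by (intro rdist_imp_near) auto
qed

text \<open>Distances from \<open>x\<close> are transferred from the chart of \<open>x\<close> to that of \<open>z\<close> by means of the
  Riemannian distance, at the cost of the factor \<open>C / \<kappa>\<close>; in the chart of \<open>z\<close> the Euclidean triangle
  inequality applies.\<close>

lemma near_trans:
  assumes "z \<in> \<Lambda>" "x \<in> \<Lambda>" and a: "near a z x" "a \<le> \<rho> / 2" and b: "near b x y" "b \<le> \<rho>" "C * b < \<kappa> * (\<rho> / 2)"
  shows "near (a + C * b / \<kappa>) z y"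
proof -
  let ?u = "snd (p z)"
  have x: "x \<in> fst (p z)" "dist (?u z) (?u x) \<le> a" using a by (auto simp: near_def)
  have rd: "rdist A g x y \<le> ennreal (C * b)" by (rule near_imp_rdist[OF assms(2) b(1,2)])
  also have "\<dots> < ennreal (\<kappa> * (\<rho> / 2))"
    using b(3) constants by (intro ennreal_lessI) auto
  finally have "y \<in> fst (p z) \<and> ennreal (\<kappa> * dist (?u x) (?u y)) \<le> rdist A g x y"
    by (intro chart_dist_le_rdist[of _ z]) (use p_chart assms(1) x a(2) in auto)
  moreover have "0 \<le> b" using b(1) unfolding near_def by (meson order_trans zero_le_dist)
  ultimately have y: "y \<in> fst (p z)" "\<kappa> * dist (?u x) (?u y) \<le> C * b"
    using rd C_pos by (auto dest: order_trans)
  have "dist (?u x) (?u y) \<le> C * b / \<kappa>" using y(2) constants by (simp add: field_simps)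
  then have "dist (?u z) (?u y) \<le> a + C * b / \<kappa>"
    using x(2) dist_triangle[of "?u z" "?u y" "?u x"] by linarith
  then show ?thesis using y by (simp add: near_def)
qed

lemma transition_compact:
  assumes "continuous_on UNIV h" "c \<in> I" "d \<in> I"
  shows "compact (snd c ` (K c \<inter> h -` K d))"
proof -
  have "closed (K d)" using compact_K[OF assms(3)] by (rule compact_imp_closed)
  then have "closed (h -` K d)" using assms(1) by (rule closed_vimage)
  then have "compact (K c \<inter> h -` K d)" using compact_K[OF assms(2)] by (simp add: compact_Int_closed)
  moreover have "c \<in> A" "K c \<inter> h -` K d \<subseteq> fst c" using assms(2) I_sub K_chart by blast+
  ultimately show ?thesis by (intro compact_continuous_image continuous_on_chart)
qed

text \<open>A point \<open>x\<close> of \<open>\<Lambda>\<close> has its coordinates in the compact set belonging to the pair of charts chosen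
  for \<open>x\<close> and \<open>h x\<close>, and there are only finitely many such pairs.\<close>

lemma uniform_over_charts:
  assumes inv: "h ` \<Lambda> \<subseteq> \<Lambda>"
    and R: "\<And>c d. c \<in> I \<Longrightarrow> d \<in> I \<Longrightarrow>
      eventually (\<lambda>r. \<forall>z\<in>snd c ` (K c \<inter> h -` K d). R c d z r) (at_right (0::real))"
  shows "eventually (\<lambda>r. \<forall>x\<in>\<Lambda>. R (p x) (p (h x)) (snd (p x) x) r) (at_right 0)"
proof -
  have "eventually (\<lambda>r. \<forall>c\<in>I. \<forall>d\<in>I. \<forall>z\<in>snd c ` (K c \<inter> h -` K d). R c d z r) (at_right 0)"
    by (intro eventually_ball_finite finite_I ballI R)
  then show ?thesis
  proof eventually_elim
    case (elim r)
    show ?case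
    proof
      fix x assume "x \<in> \<Lambda>"
      moreover have "h x \<in> \<Lambda>" using \<open>x \<in> \<Lambda>\<close> inv by auto
      ultimately show "R (p x) (p (h x)) (snd (p x) x) r"
        using elim p_chart by blast
    qed
  qed
qed

lemma transition_domain:
  assumes "c \<in> I" "d \<in> I"
  shows "snd c ` (K c \<inter> h -` K d) \<subseteq> snd c ` (fst c \<inter> h -` fst d)"
  using K_chart assms by blast

text \<open>The derivatives in charts are continuous on finitely many compact sets.  The bound is
  expressed as \<open>r * N \<le> 1\<close> for small \<open>r\<close> so that it can be made uniform over the charts.\<close>

lemma rop_norm_mderiv_bdd:
  assumes h: "Ck_map A 1 h" and inv: "h ` \<Lambda> \<subseteq> \<Lambda>"
  shows "\<exists>B. \<forall>x\<in>\<Lambda>. rop_norm g x (h x) (mderiv A h x) \<le> B"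
proof -
  let ?F = "\<lambda>c d. snd d \<circ> h \<circ> chart_inv c"
  let ?N = "\<lambda>c d z. \<Sum>b\<in>Basis. norm (frechet_derivative (?F c d) (at z) b)"
  have "eventually (\<lambda>r. \<forall>z\<in>snd c ` (K c \<inter> h -` K d). r * ?N c d z \<le> 1) (at_right (0::real))"
    if cd: "c \<in> I" "d \<in> I" for c d
  proof -
    let ?Q = "snd c ` (K c \<inter> h -` K d)"
    have C1: "C1_on (?F c d) (snd c ` (fst c \<inter> h -` fst d))"
      using Ck_map_C1_on[OF h] cd I_sub by blast
    then have "continuous_on (snd c ` (fst c \<inter> h -` fst d)) (?N c d)"
      by (intro continuous_intros) (auto simp: C1_on_def)
    then have "continuous_on ?Q (?N c d)"
      by (rule continuous_on_subset[OF _ transition_domain[OF cd]])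
    moreover have "compact ?Q" using h cd by (intro transition_compact) (auto simp: Ck_map_def)
    ultimately have "compact (?N c d ` ?Q)" by (rule compact_continuous_image)
    then have "bounded (?N c d ` ?Q)" by (rule compact_imp_bounded)
    then obtain B where B: "0 < B" "\<And>z. z \<in> ?Q \<Longrightarrow> \<bar>?N c d z\<bar> \<le> B"
      unfolding bounded_pos by auto
    have at_B: "\<forall>z\<in>?Q. (1 / B) * ?N c d z \<le> 1" using B by (simp add: field_simps abs_le_iff)
    have mono: "x * ?N c d z \<le> y * ?N c d z" if "x \<le> y" for x y z
      using that by (intro mult_right_mono sum_nonneg) auto
    have "\<forall>z\<in>?Q. x * ?N c d z \<le> 1" if "x \<le> y" "\<forall>z\<in>?Q. y * ?N c d z \<le> 1" for x y
      using that(2) order_trans[OF mono[OF that(1)]] by blast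
    note shrink = this
    show ?thesis
    proof (rule eventually_at_right_0_mono[of "1 / B"])
      show "0 < 1 / B" using B(1) by simp
      show "\<forall>z\<in>?Q. (1 / B) * ?N c d z \<le> 1" by (rule at_B)
      show "\<forall>z\<in>?Q. x * ?N c d z \<le> 1" if "0 < x" "x \<le> y" "\<forall>z\<in>?Q. y * ?N c d z \<le> 1" for x y
        by (rule shrink[OF that(2,3)])
    qed
  qed
  then have "eventually (\<lambda>r. \<forall>x\<in>\<Lambda>. r * ?N (p x) (p (h x)) (snd (p x) x) \<le> 1) (at_right (0::real))"
    by (rule uniform_over_charts[OF inv, where R="\<lambda>c d z r. r * ?N c d z \<le> 1"])
  then have "eventually (\<lambda>r. 0 < r \<and> (\<forall>x\<in>\<Lambda>. r * ?N (p x) (p (h x)) (snd (p x) x) \<le> 1)) (at_right (0::real))"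
    by (intro eventually_conj) (auto simp: eventually_at_right_less)
  then obtain r :: real where r: "0 < r" "\<And>x. x \<in> \<Lambda> \<Longrightarrow> r * ?N (p x) (p (h x)) (snd (p x) x) \<le> 1"
    using eventually_happens'[OF trivial_limit_at_right_real[of 0]] by blast
  have "rop_norm g x (h x) (mderiv A h x) \<le> C / (r * \<kappa>)" if x: "x \<in> \<Lambda>" for x
  proof (rule rop_norm_le)
    fix w
    let ?c = "p x" and ?d = "p (h x)"
    have hx: "h x \<in> \<Lambda>" using inv x by auto
    have lin: "linear (cderiv ?c ?d h x)"
      by (rule linear_cderiv[OF h p_chart(2)[OF x] p_chart(2)[OF hx] p_chart(4)[OF x] p_chart(4)[OF hx]])
    have on: "norm (cderiv ?c ?d h x v) \<le> (1 / r) * norm v" for v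
    proof -
      have "onorm (cderiv ?c ?d h x) \<le> ?N ?c ?d (snd ?c x)"
        using onorm_le_sum_Basis[OF lin] by (simp add: cderiv_def)
      also have "\<dots> \<le> 1 / r" using r(2)[OF x] r(1) by (simp add: field_simps)
      finally have "onorm (cderiv ?c ?d h x) \<le> 1 / r" .
      moreover have "norm (cderiv ?c ?d h x v) \<le> onorm (cderiv ?c ?d h x) * norm v"
        using lin by (intro onorm) (simp add: linear_conv_bounded_linear)
      ultimately show ?thesis by (meson mult_right_mono norm_ge_zero order_trans)
    qed
    have lT: "linear (tangent_of_coord A ?c x)" "inj (tangent_of_coord A ?c x)"
      using linear_tangent inj_tangent p_chart x by auto
    then have "surj (tangent_of_coord A ?c x)" by (rule linear_inj_imp_surj)
    then obtain v where v: "w = tangent_of_coord A ?c x v" by (metis surjD)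
    have "rnorm g (h x) (mderiv A h x w) = rnorm g (h x) (tangent_of_coord A ?d (h x) (cderiv ?c ?d h x v))"
      using fun_cong[OF mderiv_tangent[OF h, of ?c x ?d], of v] p_chart x hx v by simp
    also have "\<dots> \<le> C * norm (cderiv ?c ?d h x v)" using metric_up_at p_chart hx by auto
    also have "\<dots> \<le> C * ((1 / r) * norm v)" using on C_pos by (intro mult_left_mono) auto
    also have "\<dots> \<le> C * ((1 / r) * (rnorm g x w / \<kappa>))"
      using metric_low_at[of ?c x v] p_chart x v constants C_pos r(1)
      by (intro mult_left_mono) (auto simp: field_simps)
    finally show "rnorm g (h x) (mderiv A h x w) \<le> C / (r * \<kappa>) * rnorm g x w"
      by (simp add: field_simps)
  qed
  then show ?thesis by blast
qed

lemma onorm_cderiv_le: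
  assumes h: "Ck_map A 1 h" and x: "x \<in> \<Lambda>" "h x \<in> \<Lambda>" and N: "rop_norm g x (h x) (mderiv A h x) \<le> N"
  shows "onorm (cderiv (p x) (p (h x)) h x) \<le> C / \<kappa> * N"
proof (rule onorm_le)
  fix v
  let ?c = "p x" and ?d = "p (h x)"
  have "\<kappa> * norm (cderiv ?c ?d h x v) \<le> rnorm g (h x) (tangent_of_coord A ?d (h x) (cderiv ?c ?d h x v))"
    using metric_low_at p_chart x by auto
  also have "\<dots> = rnorm g (h x) (mderiv A h x (tangent_of_coord A ?c x v))"
    using fun_cong[OF mderiv_tangent[OF h, of ?c x ?d], of v] p_chart x by simp
  also have "\<dots> \<le> rop_norm g x (h x) (mderiv A h x) * rnorm g x (tangent_of_coord A ?c x v)"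
    by (rule rnorm_le_rop_norm[OF linear_mderiv[OF h]])
  also have "\<dots> \<le> N * (C * norm v)"
    using rop_norm_nonneg[OF linear_mderiv[OF h], of x "h x" x] N metric_up_at p_chart x
    by (intro mult_mono) auto
  finally show "norm (cderiv ?c ?d h x v) \<le> C / \<kappa> * N * norm v"
    using constants by (simp add: field_simps)
qed

text \<open>The factor in front of \<open>N\<close> depends on the charts but not on \<open>h\<close>.  This matters because the lemma is
  applied to all iterates of a map.  The number 2 leaves room for the variation of the derivative
  near \<open>x\<close>.\<close>

lemma Lipschitz_near:
  assumes h: "Ck_map A 1 h" and inv: "h ` \<Lambda> \<subseteq> \<Lambda>" and "0 < N"
    and N: "\<And>x. x \<in> \<Lambda> \<Longrightarrow> rop_norm g x (h x) (mderiv A h x) \<le> N"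
  shows "eventually (\<lambda>r. \<forall>x\<in>\<Lambda>. \<forall>y t. near t x y \<and> t \<le> r \<longrightarrow> near (2 * C / \<kappa> * N * t) (h x) (h y))
    (at_right 0)"
proof -
  let ?F = "\<lambda>c d. snd d \<circ> h \<circ> chart_inv c"
  define e where "e = C / \<kappa> * N"
  have "0 < e" using C_pos constants \<open>0 < N\<close> by (simp add: e_def)
  have "eventually (\<lambda>r. \<forall>x\<in>\<Lambda>. cball (snd (p x) x) r \<subseteq> snd (p x) ` (fst (p x) \<inter> h -` fst (p (h x))) \<and>
      (\<forall>y\<in>cball (snd (p x) x) r. norm (?F (p x) (p (h x)) y - ?F (p x) (p (h x)) (snd (p x) x)) \<le>
        (onorm (frechet_derivative (?F (p x) (p (h x))) (at (snd (p x) x))) + e) * norm (y - snd (p x) x))) (at_right 0)"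
  proof (rule uniform_over_charts[OF inv, where R="\<lambda>c d z r.
        cball z r \<subseteq> snd c ` (fst c \<inter> h -` fst d) \<and> (\<forall>y\<in>cball z r. norm (?F c d y - ?F c d z) \<le>
        (onorm (frechet_derivative (?F c d) (at z)) + e) * norm (y - z))"])
    fix c d assume cd: "c \<in> I" "d \<in> I"
    then have "c \<in> A" "d \<in> A" using I_sub by auto
    then show "eventually (\<lambda>r. \<forall>z\<in>snd c ` (K c \<inter> h -` K d).
        cball z r \<subseteq> snd c ` (fst c \<inter> h -` fst d) \<and> (\<forall>y\<in>cball z r. norm (?F c d y - ?F c d z) \<le>
        (onorm (frechet_derivative (?F c d) (at z)) + e) * norm (y - z))) (at_right 0)"
      using h by (intro C1_on_Lipschitz_uniform Ck_map_C1_on open_rep_domain transition_compact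
          transition_domain cd \<open>0 < e\<close>) (simp_all add: Ck_map_def)
  qed
  then show ?thesis
  proof eventually_elim
    case (elim r)
    show ?case
    proof (intro ballI allI impI)
      fix x y t assume x: "x \<in> \<Lambda>" and "near t x y \<and> t \<le> r"
      then have y: "y \<in> fst (p x)" "dist (snd (p x) x) (snd (p x) y) \<le> t" "t \<le> r"
        by (auto simp: near_def)
      have hx: "h x \<in> \<Lambda>" using x inv by auto
      let ?c = "p x" and ?d = "p (h x)"
      have c: "?c \<in> A" "x \<in> fst ?c" using p_chart x by auto
      have yb: "snd ?c y \<in> cball (snd ?c x) r" using y by simp
      then have "snd ?c y \<in> snd ?c ` (fst ?c \<inter> h -` fst ?d)" using elim x by blast
      then obtain y' where y': "y' \<in> fst ?c" "h y' \<in> fst ?d" "snd ?c y = snd ?c y'" by auto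
      have "y = y'" using chart_inv_chart[OF c(1) y(1)] chart_inv_chart[OF c(1) y'(1)] y'(3) by metis
      then have hy: "h y \<in> fst ?d" using y'(2) by (simp only:)
      have "norm (snd ?d (h y) - snd ?d (h x)) \<le>
          (onorm (cderiv ?c ?d h x) + e) * norm (snd ?c y - snd ?c x)"
        using bspec[OF conjunct2[OF bspec[OF elim x]] yb] chart_inv_chart[OF c] chart_inv_chart[OF c(1) y(1)]
        by (simp add: cderiv_def)
      also have "\<dots> \<le> (e + e) * t"
        using onorm_cderiv_le[OF h x hx N[OF x]] y(2) \<open>0 < e\<close>
        by (intro mult_mono) (auto simp: e_def dist_norm norm_minus_commute)
      also have "\<dots> = 2 * C / \<kappa> * N * t" by (simp add: e_def)
      finally show "near (2 * C / \<kappa> * N * t) (h x) (h y)"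
        using hy by (simp add: near_def dist_norm norm_minus_commute)
    qed
  qed
qed

end


section \<open>Growth of the differentials and Bowen balls\<close>

locale charted_repeller = charted_set A g \<Lambda> I K p \<rho> \<kappa> C
  for A :: "('m::{t2_space,second_countable_topology}, 'n::finite) chart set"
    and g :: "('m, 'n) metric_tensor"
    and \<Lambda> I K p \<rho> \<kappa> C +
  fixes f :: "'m \<Rightarrow> 'm"
  assumes f: "Ck_map A 1 f" and invariant: "f ` \<Lambda> \<subseteq> \<Lambda>" and expanding: "expanding_on A g f \<Lambda>"
    and compact_Lambda: "compact \<Lambda>" and nonempty: "\<Lambda> \<noteq> {}"
begin

lemma funpow_in: "x \<in> \<Lambda> \<Longrightarrow> (f ^^ k) x \<in> \<Lambda>"
  by (induction k) (use invariant in auto)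

lemma funpow_image: "(f ^^ k) ` \<Lambda> \<subseteq> \<Lambda>"
  using funpow_in by blast

lemma f_in: "x \<in> \<Lambda> \<Longrightarrow> f x \<in> \<Lambda>"
  using invariant by blast

lemma fk: "Ck_map A 1 (f ^^ k)"
  by (rule Ck_map_funpow[OF f])

text \<open>Its exponential growth rate is the number \<open>s\<close> of the theorem.\<close>

definition max_stretch :: "nat \<Rightarrow> real" where
  "max_stretch k = (SUP x\<in>\<Lambda>. rop_norm g x ((f ^^ k) x) (mderiv A (f ^^ k) x))"

lemma rop_norm_le_max_stretch:
  "x \<in> \<Lambda> \<Longrightarrow> rop_norm g x ((f ^^ k) x) (mderiv A (f ^^ k) x) \<le> max_stretch k"
proof -
  assume x: "x \<in> \<Lambda>"
  obtain B where "\<And>x. x \<in> \<Lambda> \<Longrightarrow> rop_norm g x ((f ^^ k) x) (mderiv A (f ^^ k) x) \<le> B"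
    using rop_norm_mderiv_bdd[OF fk funpow_image, of k] by blast
  then show ?thesis
    unfolding max_stretch_def by (intro cSUP_upper x bdd_aboveI2[of _ _ B])
qed

lemma max_stretch_lower:
  obtains b \<mu> where "0 < b" "1 < \<mu>" "\<And>k. b * \<mu> ^ k \<le> max_stretch k"
proof -
  obtain b \<mu> where b: "0 < b" "1 < \<mu>"
      "\<And>x v k. x \<in> \<Lambda> \<Longrightarrow> b * \<mu> ^ k * rnorm g x v \<le> rnorm g ((f ^^ k) x) (mderiv A (f ^^ k) x v)"
    using expanding unfolding expanding_on_def by blast
  obtain x where x: "x \<in> \<Lambda>" using nonempty by blast
  have "b * \<mu> ^ k \<le> max_stretch k" for k
    using rop_norm_ge[OF linear_mderiv[OF fk], of "b * \<mu> ^ k" x] b(3)[OF x] rop_norm_le_max_stretch[OF x]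
    by (meson order_trans)
  with b(1,2) show thesis by (rule that)
qed

lemma max_stretch_pos: "0 < max_stretch k"
proof -
  obtain b \<mu> where b: "0 < b" "1 < \<mu>" "\<And>k. b * \<mu> ^ k \<le> max_stretch k" using max_stretch_lower by blast
  then have "0 < b * \<mu> ^ k" by simp
  then show ?thesis using b(3)[of k] by linarith
qed

lemma max_stretch_submult: "max_stretch (j + k) \<le> max_stretch j * max_stretch k"
  unfolding max_stretch_def[of "j + k"]
proof (rule cSUP_least[OF nonempty])
  fix x assume x: "x \<in> \<Lambda>"
  have "mderiv A (f ^^ (j + k)) x = mderiv A (f ^^ j) ((f ^^ k) x) \<circ> mderiv A (f ^^ k) x"
    unfolding funpow_add by (rule mderiv_compose[OF fk fk])
  moreover have "(f ^^ (j + k)) x = (f ^^ j) ((f ^^ k) x)" by (simp add: funpow_add)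
  ultimately have "rop_norm g x ((f ^^ (j + k)) x) (mderiv A (f ^^ (j + k)) x) \<le>
      rop_norm g ((f ^^ k) x) ((f ^^ j) ((f ^^ k) x)) (mderiv A (f ^^ j) ((f ^^ k) x)) *
      rop_norm g x ((f ^^ k) x) (mderiv A (f ^^ k) x)"
    using rop_norm_compose[OF linear_mderiv[OF fk] linear_mderiv[OF fk]] by simp
  also have "\<dots> \<le> max_stretch j * max_stretch k"
    using x funpow_in rop_norm_nonneg[OF linear_mderiv[OF fk]] max_stretch_pos
    by (intro mult_mono rop_norm_le_max_stretch) (auto intro: less_imp_le)
  finally show "rop_norm g x ((f ^^ (j + k)) x) (mderiv A (f ^^ (j + k)) x) \<le> max_stretch j * max_stretch k" .
qed

definition growth_rate :: real where
  "growth_rate = lim (\<lambda>k. 1 / real k * ln (max_stretch k))"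

text \<open>The logarithms are subadditive by the chain rule, and expansion bounds them from below by a
  linear function with positive slope.\<close>

lemma growth_rate:
  "(\<lambda>k. ln (max_stretch k) / real k) \<longlonglongrightarrow> growth_rate" "0 < growth_rate"
proof -
  obtain b \<mu> where b: "0 < b" "1 < \<mu>" "\<And>k. b * \<mu> ^ k \<le> max_stretch k" using max_stretch_lower by blast
  have low: "ln b + real k * ln \<mu> \<le> ln (max_stretch k)" for k
  proof -
    have "ln (b * \<mu> ^ k) \<le> ln (max_stretch k)" using b max_stretch_pos[of k] by (subst ln_le_cancel_iff) auto
    then show ?thesis using b by (simp add: ln_mult ln_realpow)
  qed
  have "convergent (\<lambda>k. ln (max_stretch k) / real k)"
  proof (rule Fekete_limit)
    show "ln (max_stretch (j + k)) \<le> ln (max_stretch j) + ln (max_stretch k)" for j k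
      using max_stretch_submult[of j k] max_stretch_pos
      by (subst ln_mult_pos[symmetric]) (auto intro!: ln_mono mult_pos_pos)
    show "min (ln b) (ln \<mu>) \<le> ln (max_stretch k) / real (Suc k)" for k
    proof -
      have "min (ln b) (ln \<mu>) + real k * min (ln b) (ln \<mu>) \<le> ln b + real k * ln \<mu>"
        by (intro add_mono mult_left_mono) auto
      then have "min (ln b) (ln \<mu>) * real (Suc k) \<le> ln (max_stretch k)"
        using low[of k] by (simp add: algebra_simps)
      then show ?thesis by (simp add: pos_le_divide_eq)
    qed
  qed
  then show lim: "(\<lambda>k. ln (max_stretch k) / real k) \<longlonglongrightarrow> growth_rate"
    unfolding growth_rate_def by (simp add: convergent_LIMSEQ_iff)
  have "(\<lambda>k. ln b / real k + ln \<mu>) \<longlonglongrightarrow> 0 + ln \<mu>"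
    by (intro tendsto_add tendsto_const lim_const_over_n)
  then have "0 + ln \<mu> \<le> growth_rate"
  proof (rule LIMSEQ_le[OF _ lim])
    show "\<exists>N. \<forall>n\<ge>N. ln b / real n + ln \<mu> \<le> ln (max_stretch n) / real n"
    proof (intro exI[of _ 1] allI impI)
      fix n :: nat assume "1 \<le> n"
      then show "ln b / real n + ln \<mu> \<le> ln (max_stretch n) / real n"
        using divide_right_mono[OF low[of n], of "real n"] by (simp add: add_divide_distrib)
    qed
  qed
  then show "0 < growth_rate" using b by (smt (verit) ln_gt_zero)
qed

text \<open>A constant factor does not change the exponential growth rate.\<close>

lemma eventually_max_stretch_less:
  assumes "growth_rate < \<sigma>" "0 < B"
  shows "\<exists>m\<ge>1. B * max_stretch m \<le> exp (real m * \<sigma>)"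
proof -
  have "(\<lambda>k. ln B / real k + ln (max_stretch k) / real k) \<longlonglongrightarrow> 0 + growth_rate"
    by (intro tendsto_add growth_rate lim_const_over_n)
  then have "eventually (\<lambda>k. ln B / real k + ln (max_stretch k) / real k < \<sigma>) sequentially"
    using assms(1) by (auto dest: order_tendstoD)
  then have "eventually (\<lambda>k. 1 \<le> k \<and> ln B / real k + ln (max_stretch k) / real k < \<sigma>) sequentially"
    using eventually_ge_at_top[of 1] by eventually_elim auto
  then obtain m where m: "1 \<le> m" "ln B / real m + ln (max_stretch m) / real m < \<sigma>"
    using eventually_happens'[OF sequentially_bot] by blast
  then have "ln B + ln (max_stretch m) < real m * \<sigma>" by (simp add: field_simps)
  then have "ln (B * max_stretch m) < real m * \<sigma>"
    using assms(2) max_stretch_pos[of m] by (simp add: ln_mult)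
  then have "exp (ln (B * max_stretch m)) \<le> exp (real m * \<sigma>)" by (subst exp_le_cancel_iff) simp
  then show ?thesis using m(1) assms(2) max_stretch_pos[of m] by auto
qed

text \<open>By \<open>eventually_max_stretch_less\<close> there is an \<open>m\<close> such that \<open>f\<^sup>m\<close> stretches small distances in charts by
  at most \<open>exp (m \<sigma>)\<close>, without any further constant, so the estimate can be iterated.  At most
  \<open>m - 1\<close> remaining steps contribute the bounded factor \<open>L\<close>.\<close>

lemma near_iterates:
  assumes \<sigma>: "growth_rate < \<sigma>" and "0 < \<eta>"
  shows "\<exists>D>0. \<forall>k. \<forall>x\<in>\<Lambda>. \<forall>y. near (D * exp (- (real k * \<sigma>))) x y \<longrightarrow>
    (\<forall>i\<le>k. near \<eta> ((f ^^ i) x) ((f ^^ i) y))"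
proof -
  define Lip where "Lip l = 2 * C / \<kappa> * max_stretch l" for l
  have "0 < 2 * C / \<kappa>" using C_pos constants by simp
  then obtain m where m: "1 \<le> m" "Lip m \<le> exp (real m * \<sigma>)"
    using eventually_max_stretch_less[OF \<sigma>, of "2 * C / \<kappa>"] by (auto simp: Lip_def)
  have "eventually (\<lambda>r. \<forall>l\<in>{..m}. \<forall>x\<in>\<Lambda>. \<forall>y t. near t x y \<and> t \<le> r \<longrightarrow>
      near (Lip l * t) ((f ^^ l) x) ((f ^^ l) y)) (at_right 0)"
    unfolding Lip_def
    by (intro eventually_ball_finite ballI Lipschitz_near fk funpow_image max_stretch_pos
        rop_norm_le_max_stretch) auto
  then have "eventually (\<lambda>r. 0 < r \<and> (\<forall>l\<in>{..m}. \<forall>x\<in>\<Lambda>. \<forall>y t. near t x y \<and> t \<le> r \<longrightarrow>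
      near (Lip l * t) ((f ^^ l) x) ((f ^^ l) y))) (at_right 0)"
    by (intro eventually_conj) (auto simp: eventually_at_right_less)
  then obtain r where r: "0 < r" "\<And>l x y t. l \<le> m \<Longrightarrow> x \<in> \<Lambda> \<Longrightarrow> near t x y \<Longrightarrow> t \<le> r \<Longrightarrow>
      near (Lip l * t) ((f ^^ l) x) ((f ^^ l) y)"
    using eventually_happens'[OF trivial_limit_at_right_real[of 0]] by (metis (no_types, lifting) atMost_iff)
  define L where "L = Max (insert 1 (Lip ` {..m}))"
  have L: "1 \<le> L" "\<And>l. l \<le> m \<Longrightarrow> Lip l \<le> L" unfolding L_def by (rule Max_ge; simp)+
  define D where "D = min r \<eta> / L"
  have D: "0 < D" "D \<le> r" "L * D \<le> \<eta>"
  proof -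
    show "0 < D" using r(1) \<open>0 < \<eta>\<close> L(1) by (simp add: D_def)
    have "D * 1 \<le> D * L" using L(1) \<open>0 < D\<close> by (intro mult_left_mono) auto
    also have "D * L = min r \<eta>" using L(1) by (simp add: D_def)
    finally show "D \<le> r" by simp
    show "L * D \<le> \<eta>" using L(1) by (simp add: D_def)
  qed
  have Lip_pos: "0 < Lip l" for l using max_stretch_pos C_pos constants by (simp add: Lip_def)
  have "0 < \<sigma>" using \<sigma> growth_rate(2) by linarith
  have "near \<eta> ((f ^^ i) x) ((f ^^ i) y)"
    if x: "x \<in> \<Lambda>" and xy: "near (D * exp (- (real k * \<sigma>))) x y" and "i \<le> k" for k i x y
  proof -
    \<comment> \<open>the distance allowed at time \<open>q m\<close>: it grows with \<open>q\<close> but stays below \<open>D\<close> until time \<open>k\<close>\<close>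
    define t where "t q = D * exp (real (q * m) * \<sigma> - real k * \<sigma>)" for q
    have tD: "t q \<le> D" if "q * m \<le> k" for q
    proof -
      have "real (q * m) * \<sigma> \<le> real k * \<sigma>" using that \<open>0 < \<sigma>\<close> by (intro mult_right_mono) (simp_all only: of_nat_le_iff less_imp_le)
      then have "exp (real (q * m) * \<sigma> - real k * \<sigma>) \<le> 1" by simp
      then show ?thesis unfolding t_def using D(1) by (intro mult_left_le) auto
    qed
    have t_pos: "0 < t q" for q using D by (simp add: t_def)
    have tSuc: "t (Suc q) = exp (real m * \<sigma>) * t q" for q
      by (simp add: t_def exp_add[symmetric] algebra_simps)
    have step: "near (t q) ((f ^^ (q * m)) x) ((f ^^ (q * m)) y)" if "q * m \<le> k" for q
      using that
    proof (induction q)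
      case 0
      then show ?case using xy by (simp add: t_def)
    next
      case (Suc q)
      then have q: "q * m \<le> k" by simp
      have "near (Lip m * t q) ((f ^^ m) ((f ^^ (q * m)) x)) ((f ^^ m) ((f ^^ (q * m)) y))"
        using tD[OF q] D(2) by (intro r(2) funpow_in x Suc.IH q) auto
      moreover have "Lip m * t q \<le> t (Suc q)"
        unfolding tSuc using m(2) t_pos[of q] by (intro mult_right_mono) auto
      ultimately show ?case by (auto simp: funpow_add intro: near_mono)
    qed
    define q l where "q = i div m" and "l = i mod m"
    have i: "i = l + q * m" "l \<le> m" "q * m \<le> k"
      using m(1) \<open>i \<le> k\<close> by (auto simp: q_def l_def intro: less_imp_le order_trans[OF div_times_less_eq_dividend])
    have "near (Lip l * t q) ((f ^^ l) ((f ^^ (q * m)) x)) ((f ^^ l) ((f ^^ (q * m)) y))"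
      using tD[OF i(3)] D(2) by (intro r(2) funpow_in x step i) auto
    moreover have "Lip l * t q \<le> \<eta>"
    proof -
      have "Lip l * t q \<le> L * D" using L i tD[OF i(3)] t_pos[of q] Lip_pos[of l]
        by (intro mult_mono) auto
      then show ?thesis using D(3) by linarith
    qed
    ultimately show ?thesis unfolding i(1) by (auto simp: funpow_add intro: near_mono)
  qed
  then show ?thesis using D(1) by blast
qed

section \<open>Volume of Bowen balls\<close>

definition local_map :: "'m \<Rightarrow> real^'n \<Rightarrow> real^'n" where
  "local_map x = snd (p (f x)) \<circ> f \<circ> chart_inv (p x)"

definition local_deriv :: "'m \<Rightarrow> real^'n \<Rightarrow> real^'n \<Rightarrow> real^'n" where
  "local_deriv x y = frechet_derivative (local_map x) (at y)"

definition jac :: "'m \<Rightarrow> real" where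
  "jac x = \<bar>det (matrix (cderiv (p x) (p (f x)) f x))\<bar>"

lemma inj_mderiv: 
  assumes "x \<in> \<Lambda>" shows "inj (mderiv A f x)"
proof -
  obtain b \<mu> where b: "0 < b" "1 < (\<mu>::real)"
      "\<And>x v k. x \<in> \<Lambda> \<Longrightarrow> b * \<mu> ^ k * rnorm g x v \<le> rnorm g ((f ^^ k) x) (mderiv A (f ^^ k) x v)"
    using expanding unfolding expanding_on_def by blast
  have f1: "f ^^ 1 = f" by simp
  have "v = 0" if "mderiv A f x v = 0" for v
  proof (rule ccontr)
    assume "v \<noteq> 0"
    then have "0 < b * \<mu> ^ 1 * rnorm g x v" using b rnorm_pos by simp
    moreover have "b * \<mu> ^ 1 * rnorm g x v \<le> rnorm g (f x) (mderiv A f x v)"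
      using b(3)[OF assms, of 1 v] unfolding f1 by simp
    ultimately show False using that by simp
  qed
  then show ?thesis using linear_mderiv[OF f] by (simp add: linear_injective_0)
qed

text \<open>Expansion makes the differential injective, hence also its matrix in charts.\<close>

lemma inj_cderiv:
  assumes "x \<in> \<Lambda>" "c \<in> A" "x \<in> fst c" "d \<in> A" "f x \<in> fst d"
  shows "inj (cderiv c d f x)"
proof -
  have "inj (mderiv A f x \<circ> tangent_of_coord A c x)"
    using inj_mderiv[OF assms(1)] inj_tangent[OF assms(2,3)] by (rule inj_compose)
  then have "inj (tangent_of_coord A d (f x) \<circ> cderiv c d f x)"
    unfolding mderiv_tangent[OF f assms(2-5)] .
  then show ?thesis by (rule inj_on_imageI2)
qed

lemma jac_pos: 
  assumes "x \<in> \<Lambda>" shows "0 < jac x"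
proof -
  have "inj (cderiv (p x) (p (f x)) f x)" "linear (cderiv (p x) (p (f x)) f x)"
    using assms p_chart f_in by (auto intro!: inj_cderiv linear_cderiv f)
  then show ?thesis unfolding jac_def using det_nz_iff_inj by auto
qed

text \<open>The domain of \<open>f\<close> in charts, its injectivity and the variation of its Jacobian are all
  controlled on balls of one radius around all points of \<open>\<Lambda>\<close>.\<close>

lemma distortion:
  assumes "0 < \<delta>"
  shows "eventually (\<lambda>r. \<forall>x\<in>\<Lambda>. cball (snd (p x) x) r \<subseteq> snd (p x) ` (fst (p x) \<inter> f -` fst (p (f x))) \<and>
      inj_on (local_map x) (cball (snd (p x) x) r) \<and>
      (\<forall>y\<in>cball (snd (p x) x) r. (local_map x has_derivative local_deriv x y) (at y) \<and>
         exp (- \<delta>) * jac x \<le> \<bar>det (matrix (local_deriv x y))\<bar>)) (at_right 0)"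
proof -
  let ?F = "\<lambda>c d. snd d \<circ> f \<circ> chart_inv c"
  let ?J = "\<lambda>c d y. \<bar>det (matrix (frechet_derivative (?F c d) (at y)))\<bar>"
  let ?S = "\<lambda>c d. snd c ` (fst c \<inter> f -` fst d)"
  let ?R = "\<lambda>c d z r. cball z r \<subseteq> ?S c d \<and> inj_on (?F c d) (cball z r) \<and>
      (\<forall>y\<in>cball z r. exp (- \<delta>) * ?J c d z \<le> ?J c d y)"
  have "eventually (\<lambda>r. \<forall>x\<in>\<Lambda>. ?R (p x) (p (f x)) (snd (p x) x) r) (at_right 0)"
  proof (rule uniform_over_charts[OF invariant, where R="?R"])
    fix c d assume cd: "c \<in> I" "d \<in> I"
    then have cdA: "c \<in> A" "d \<in> A" using I_sub by auto
    let ?Q = "snd c ` (K c \<inter> f -` K d)"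
    have Q: "compact ?Q" "?Q \<subseteq> ?S c d"
      using f cd by (intro transition_compact transition_domain; simp add: Ck_map_def)+
    have C1: "C1_on (?F c d) (?S c d)" by (rule Ck_map_C1_on[OF f cdA])
    have op: "open (?S c d)" by (rule open_rep_domain[OF f cdA])
    have inj: "inj (frechet_derivative (?F c d) (at z))" if zQ: "z \<in> ?Q" for z
    proof -
      obtain x where x: "x \<in> K c" "f x \<in> K d" "z = snd c x" using zQ by blast
      have "inj (cderiv c d f x)"
        using x cd cdA K_sub K_chart by (intro inj_cderiv) blast+
      then show ?thesis by (simp add: cderiv_def x(3))
    qed
    have pos: "0 < ?J c d z" if "z \<in> ?Q" for z
    proof -
      have "(?F c d has_derivative frechet_derivative (?F c d) (at z)) (at z)"
        by (rule C1_on_has_derivative[OF C1 subsetD[OF Q(2) that]])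
      then have "linear (frechet_derivative (?F c d) (at z))" by (rule has_derivative_linear)
      then show ?thesis using inj[OF that] det_nz_iff_inj by auto
    qed
    have 1: "eventually (\<lambda>r. \<forall>z\<in>?Q. cball z r \<subseteq> ?S c d) (at_right 0)"
      using C1_on_Lipschitz_uniform[OF C1 op Q zero_less_one] by eventually_elim blast
    have 2: "eventually (\<lambda>r. \<forall>z\<in>?Q. inj_on (?F c d) (cball z r)) (at_right 0)"
      by (rule C1_on_inj_uniform[OF C1 op Q inj])
    have 3: "eventually (\<lambda>r. \<forall>z\<in>?Q. \<forall>y\<in>cball z r. exp (- \<delta>) * ?J c d z \<le> ?J c d y) (at_right 0)"
      by (rule positive_distortion_uniform[OF _ op Q \<open>0 < \<delta>\<close> pos])
        (intro continuous_on_rabs C1_on_continuous_det C1)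
    show "eventually (\<lambda>r. \<forall>z\<in>?Q. ?R c d z r) (at_right 0)"
      using 1 2 3 by eventually_elim blast
  qed
  then show ?thesis
  proof eventually_elim
    case (elim r)
    show ?case
    proof (intro ballI conjI)
      fix x assume x: "x \<in> \<Lambda>"
      have xA: "p x \<in> A" "p (f x) \<in> A" using p_chart x f_in by auto
      have R: "?R (p x) (p (f x)) (snd (p x) x) r" using elim x by blast
      then show sub: "cball (snd (p x) x) r \<subseteq> ?S (p x) (p (f x))" by blast
      show "inj_on (local_map x) (cball (snd (p x) x) r)" using R by (simp add: local_map_def)
      fix y assume y: "y \<in> cball (snd (p x) x) r"
      then have "y \<in> ?S (p x) (p (f x))" using sub by blast
      then show "(local_map x has_derivative local_deriv x y) (at y)"
        unfolding local_deriv_def local_map_def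
        by (rule C1_on_has_derivative[OF Ck_map_C1_on[OF f xA]])
      have "exp (- \<delta>) * ?J (p x) (p (f x)) (snd (p x) x) \<le> ?J (p x) (p (f x)) y" using R y by blast
      then show "exp (- \<delta>) * jac x \<le> \<bar>det (matrix (local_deriv x y))\<bar>"
        by (simp add: jac_def cderiv_def local_deriv_def local_map_def)
    qed
  qed
qed

text \<open>The Bowen ball of order \<open>k\<close> around \<open>z\<close>, drawn in the charts along the orbit of \<open>z\<close>: the points that
  stay \<open>\<eta>\<close>-close to this orbit at the times \<open>0, \<dots>, k - 1\<close>.  At time \<open>k\<close> only the radius \<open>R\<close> is prescribed;
  it is chosen so large that this is no further condition, and it gives the recursion a start with
  a finite volume.\<close>

primrec bowen_set :: "real \<Rightarrow> real \<Rightarrow> nat \<Rightarrow> 'm \<Rightarrow> (real^'n) set" where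
  "bowen_set \<eta> R 0 z = cball (snd (p z) z) R"
| "bowen_set \<eta> R (Suc k) z = {y \<in> cball (snd (p z) z) \<eta>. local_map z y \<in> bowen_set \<eta> R k (f z)}"

text \<open>Closeness at the times up to \<open>k\<close> implies the condition at time \<open>k + 1\<close>, by the Lipschitz estimate
  and the choice of \<open>R\<close>.\<close>

lemma bowen_set_I:
  assumes R: "\<And>x y t. x \<in> \<Lambda> \<Longrightarrow> near t x y \<Longrightarrow> t \<le> \<eta> \<Longrightarrow> near (L * t) (f x) (f y)" "L * \<eta> \<le> R"
    and z: "z \<in> \<Lambda>" and nr: "\<And>i. i \<le> k \<Longrightarrow> near \<eta> ((f ^^ i) z) ((f ^^ i) y)"
  shows "snd (p z) y \<in> bowen_set \<eta> R (Suc k) z"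
  using z nr
proof (induction k arbitrary: z y)
  case 0
  then have n0: "near \<eta> z y" by (metis funpow_0 le_refl)
  have "near (L * \<eta>) (f z) (f y)" by (rule R(1)[OF 0(1) n0 order_refl])
  then have "near R (f z) (f y)" using R(2) by (rule near_mono)
  moreover have "local_map z (snd (p z) y) = snd (p (f z)) (f y)"
    using n0 p_chart[OF 0(1)] by (simp add: local_map_def near_def)
  ultimately show ?case using n0 by (simp add: near_def)
next
  case (Suc k)
  have n0: "near \<eta> z y" using Suc.prems(2)[of 0] by simp
  have "near \<eta> ((f ^^ i) (f z)) ((f ^^ i) (f y))" if "i \<le> k" for i
    using Suc.prems(2)[of "Suc i"] that by (simp add: funpow_swap1)
  then have "snd (p (f z)) (f y) \<in> bowen_set \<eta> R (Suc k) (f z)"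
    by (intro Suc.IH f_in Suc.prems(1))
  moreover have "local_map z (snd (p z) y) = snd (p (f z)) (f y)"
    using n0 p_chart[OF Suc.prems(1)] by (simp add: local_map_def near_def)
  ultimately have "local_map z (snd (p z) y) \<in> bowen_set \<eta> R (Suc k) (f z)" by (simp only:)
  then show ?case using n0 by (subst bowen_set.simps(2)) (simp add: near_def del: bowen_set.simps)
qed

lemma compact_bowen_set:
  assumes "\<And>x y. x \<in> \<Lambda> \<Longrightarrow> y \<in> cball (snd (p x) x) \<eta> \<Longrightarrow> (local_map x has_derivative local_deriv x y) (at y)"
    and "z \<in> \<Lambda>"
  shows "compact (bowen_set \<eta> R k z)"
  using assms(2)
proof (induction k arbitrary: z)
  case (Suc k)
  have "continuous_on (cball (snd (p z) z) \<eta>) (local_map z)"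
    using assms(1)[OF Suc.prems] by (meson continuous_at_imp_continuous_on has_derivative_continuous)
  moreover have "closed (bowen_set \<eta> R k (f z))"
    by (intro compact_imp_closed Suc.IH f_in Suc.prems)
  ultimately have "closed (cball (snd (p z) z) \<eta> \<inter> local_map z -` bowen_set \<eta> R k (f z))"
    by (intro continuous_closed_preimage) auto
  moreover have "bowen_set \<eta> R (Suc k) z = cball (snd (p z) z) \<eta> \<inter> (cball (snd (p z) z) \<eta> \<inter> local_map z -` bowen_set \<eta> R k (f z))"
    by auto
  ultimately show ?case by (simp only: compact_Int_closed[OF compact_cball])
qed simp

lemma chart_volume_bound:
  obtains a b where "0 < a" "\<And>x. x \<in> \<Lambda> \<Longrightarrow> a \<le> chart_volume (p x) x \<and> chart_volume (p x) x \<le> b"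
proof -
  have "\<exists>a b. 0 < a \<and> (\<forall>x\<in>K c. a \<le> chart_volume c x \<and> chart_volume c x \<le> b)" if "c \<in> I" for c
    using chart_volume_bounds[of c "K c"] that I_sub compact_K K_chart by blast
  then obtain a b where ab: "\<And>c. c \<in> I \<Longrightarrow> 0 < a c"
      "\<And>c x. c \<in> I \<Longrightarrow> x \<in> K c \<Longrightarrow> a c \<le> chart_volume c x \<and> chart_volume c x \<le> b c"
    by metis
  have "I \<noteq> {}" using nonempty p_chart by blast
  then have "0 < Min (a ` I)" using finite_I ab(1) by (subst Min_gr_iff) auto
  moreover have "Min (a ` I) \<le> chart_volume (p x) x \<and> chart_volume (p x) x \<le> Max (b ` I)" if x: "x \<in> \<Lambda>" for x
  proof -
    have "Min (a ` I) \<le> a (p x)" "b (p x) \<le> Max (b ` I)"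
      using finite_I p_chart[OF x] by auto
    then show ?thesis using ab(2)[OF p_chart(1)[OF x] p_chart(3)[OF x]] by linarith
  qed
  ultimately show thesis by (rule that)
qed

text \<open>The chart representation of \<open>f\<close> maps the Bowen ball of order \<open>k + 1\<close> around \<open>z\<close> injectively into that
  of order \<open>k\<close> around \<open>f z\<close>, and its Jacobian there is at least \<open>exp (- \<delta>)\<close> times the one at \<open>z\<close>.  Weighting
  the measure by the volume density at the centre turns the Jacobian in charts into the Riemannian
  one, \<open>exp (- \<phi> z)\<close>.\<close>

lemma measure_bowen_set_le:
  assumes \<delta>: "\<And>x. x \<in> \<Lambda> \<Longrightarrow> inj_on (local_map x) (cball (snd (p x) x) \<eta>)"
      "\<And>x y. x \<in> \<Lambda> \<Longrightarrow> y \<in> cball (snd (p x) x) \<eta> \<Longrightarrow> (local_map x has_derivative local_deriv x y) (at y)"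
      "\<And>x y. x \<in> \<Lambda> \<Longrightarrow> y \<in> cball (snd (p x) x) \<eta> \<Longrightarrow> exp (- \<delta>) * jac x \<le> \<bar>det (matrix (local_deriv x y))\<bar>"
    and "0 \<le> R"
    and b: "\<And>x. x \<in> \<Lambda> \<Longrightarrow> chart_volume (p x) x \<le> b"
    and \<phi>: "\<And>x. x \<in> \<Lambda> \<Longrightarrow> \<phi> x = - ln (rabs_det g x (f x) (mderiv A f x))"
    and "z \<in> \<Lambda>"
  shows "chart_volume (p z) z * measure lebesgue (bowen_set \<eta> R k z) \<le>
    b * measure lebesgue (cball (0::real^'n) R) * exp (real k * \<delta>) * exp (\<Sum>i<k. \<phi> ((f ^^ i) z))"
  using \<open>z \<in> \<Lambda>\<close>
proof (induction k arbitrary: z)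
  case 0
  have "measure lebesgue (cball (snd (p z) z) R) = measure lebesgue (cball (0::real^'n) R)"
    using \<open>0 \<le> R\<close> by (simp add: content_cball)
  then show ?case using b[OF 0] by (simp add: mult_right_mono)
next
  case (Suc k)
  let ?w = "\<lambda>x. chart_volume (p x) x" and ?m = "measure lebesgue"
  have z: "z \<in> \<Lambda>" "f z \<in> \<Lambda>" using Suc.prems f_in by auto
  have w: "0 < ?w z" "0 < ?w (f z)" using z p_chart by (auto intro: chart_volume_pos)
  let ?d = "rabs_det g z (f z) (mderiv A f z)"
  have d: "?d * ?w z = jac z * ?w (f z)"
    unfolding jac_def by (rule rabs_det_cderiv[OF f]) (use z p_chart in auto)
  have "0 < ?d * ?w z" unfolding d using jac_pos[OF z(1)] w by simp
  then have "0 < ?d" using w by (simp add: zero_less_mult_iff)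
  then have ed: "?d * exp (\<phi> z) = 1" using \<phi>[OF z(1)] by (simp add: exp_minus)
  let ?S = "bowen_set \<eta> R (Suc k) z" and ?S' = "bowen_set \<eta> R k (f z)"
  have cS: "compact ?S" "compact ?S'" using compact_bowen_set[OF \<delta>(2)] z by blast+
  have subS: "?S \<subseteq> cball (snd (p z) z) \<eta>" by auto
  have "exp (- \<delta>) * jac z * ?m ?S \<le> ?m (local_map z ` ?S)"
  proof (rule measure_image_ge[OF cS(1)])
    show "(local_map z has_derivative local_deriv z x) (at x)" if "x \<in> ?S" for x
      using \<delta>(2)[OF z(1)] that by auto
    show "inj_on (local_map z) ?S" by (rule inj_on_subset[OF \<delta>(1)[OF z(1)] subS])
    show "exp (- \<delta>) * jac z \<le> \<bar>det (matrix (local_deriv z x))\<bar>" if "x \<in> ?S" for x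
      using \<delta>(3)[OF z(1)] that by auto
  qed
  also have "\<dots> \<le> ?m ?S'"
  proof (rule measure_mono_fmeasurable)
    show "local_map z ` ?S \<subseteq> ?S'" by auto
    have "continuous_on ?S (local_map z)"
      using \<delta>(2)[OF z(1)] subS by (meson continuous_at_imp_continuous_on has_derivative_continuous subsetD)
    then have "compact (local_map z ` ?S)" using cS(1) by (rule compact_continuous_image)
    then show "local_map z ` ?S \<in> sets lebesgue" by (simp add: fmeasurableD lmeasurable_compact)
    show "?S' \<in> lmeasurable" using cS(2) by (rule lmeasurable_compact)
  qed
  finally have step: "exp (- \<delta>) * jac z * ?m ?S \<le> ?m ?S'" .
  have "?w z * ?m ?S = exp \<delta> * exp (\<phi> z) * ((?d * ?w z) * (exp (- \<delta>) * ?m ?S))"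
    using ed by (simp add: exp_minus field_simps)
  also have "\<dots> = exp \<delta> * exp (\<phi> z) * (?w (f z) * (exp (- \<delta>) * jac z * ?m ?S))"
    unfolding d by (simp add: mult_ac)
  also have "\<dots> \<le> exp \<delta> * exp (\<phi> z) * (?w (f z) * ?m ?S')"
    using step w by (intro mult_left_mono) auto
  also have "\<dots> \<le> exp \<delta> * exp (\<phi> z) * (b * ?m (cball (0::real^'n) R) * exp (real k * \<delta>) * exp (\<Sum>i<k. \<phi> ((f ^^ i) (f z))))"
    by (intro mult_left_mono Suc.IH z) auto
  also have "\<dots> = b * ?m (cball (0::real^'n) R) * (exp \<delta> * exp (real k * \<delta>)) * (exp (\<phi> z) * exp (\<Sum>i<k. \<phi> ((f ^^ i) (f z))))"
    by (simp add: mult_ac)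
  also have "exp \<delta> * exp (real k * \<delta>) = exp (real (Suc k) * \<delta>)"
    by (simp add: exp_add[symmetric] algebra_simps)
  also have "exp (\<phi> z) * exp (\<Sum>i<k. \<phi> ((f ^^ i) (f z))) = exp (\<Sum>i<Suc k. \<phi> ((f ^^ i) z))"
    unfolding sum.lessThan_Suc_shift by (simp add: exp_add[symmetric] funpow_swap1)
  finally show ?case .
qed

end


section \<open>Separated sets and covering numbers\<close>

lemma finite_max_card:
  assumes "P {}" and bound: "\<And>G. P G \<Longrightarrow> finite G \<and> card G \<le> N"
  obtains G where "P G" "finite G" "\<And>H. P H \<Longrightarrow> card H \<le> card G"
proof -
  have "\<exists>G. P G \<and> (\<forall>H. P H \<longrightarrow> card H \<le> card G)"
    by (rule ex_has_greatest_nat[of P "{}" card "Suc N"]) (use assms in \<open>auto simp: less_Suc_eq_le\<close>)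
  then show thesis using that bound by blast
qed

text \<open>The balls of radius \<open>t\<close> around \<open>2 t\<close>-separated points are disjoint, so their volumes add up.\<close>

lemma card_le_of_disjoint_balls:
  fixes a :: "'i \<Rightarrow> real^'n::finite"
  assumes "finite G" "finite J" "0 < t"
    and sep: "\<And>x y. x \<in> G \<Longrightarrow> y \<in> G \<Longrightarrow> x \<noteq> y \<Longrightarrow> 2 * t \<le> dist (a x) (a y)"
    and sub: "\<And>x. x \<in> G \<Longrightarrow> ball (a x) t \<subseteq> (\<Union>z\<in>J. S z)"
    and comp: "\<And>z. z \<in> J \<Longrightarrow> compact (S z)"
  shows "real (card G) * (unit_ball_vol (real CARD('n)) * t ^ CARD('n)) \<le> (\<Sum>z\<in>J. measure lebesgue (S z))"
proof -
  have disj: "ball (a x) t \<inter> ball (a y) t = {}" if "x \<in> G" "y \<in> G" "x \<noteq> y" for x y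
  proof (rule ccontr)
    assume "ball (a x) t \<inter> ball (a y) t \<noteq> {}"
    then obtain w where "dist (a x) w < t" "dist (a y) w < t" by auto
    then have "dist (a x) (a y) < 2 * t" using dist_triangle2[of "a x" "a y" w] by simp
    then show False using sep[OF that] by simp
  qed
  have "real (card G) * (unit_ball_vol (real CARD('n)) * t ^ CARD('n)) = (\<Sum>x\<in>G. measure lebesgue (ball (a x) t))"
    using \<open>0 < t\<close> by (simp add: content_ball)
  also have "\<dots> = measure lebesgue (\<Union>x\<in>G. ball (a x) t)"
    by (rule measure_UNION'[symmetric]) (use assms(1) disj in \<open>auto simp: pairwise_def disjnt_def\<close>)
  also have "\<dots> \<le> measure lebesgue (\<Union>z\<in>J. S z)"
  proof (rule measure_mono_fmeasurable)
    show "(\<Union>x\<in>G. ball (a x) t) \<subseteq> (\<Union>z\<in>J. S z)" using sub by blast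
    show "(\<Union>x\<in>G. ball (a x) t) \<in> sets lebesgue" using assms(1) by (auto intro!: borel_open)
    show "(\<Union>z\<in>J. S z) \<in> lmeasurable" using assms(2) comp by (intro lmeasurable_compact compact_UN) auto
  qed
  also have "\<dots> \<le> (\<Sum>z\<in>J. measure lebesgue (S z))"
    by (rule measure_UNION_le[OF assms(2)]) (use comp in \<open>simp add: fmeasurableD lmeasurable_compact\<close>)
  finally show ?thesis .
qed

context charted_repeller
begin

text \<open>Orbits of length \<open>k\<close> depend continuously on their starting point.\<close>

lemma small_neighbourhood:
  assumes "0 < \<epsilon>" "x \<in> \<Lambda>"
  shows "\<exists>V. open V \<and> x \<in> V \<and> (\<forall>a\<in>V. \<forall>b\<in>V. \<forall>i<k. rdist A g ((f ^^ i) a) ((f ^^ i) b) \<le> ennreal \<epsilon>)"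
proof -
  define t where "t = min \<rho> (\<epsilon> / (2 * C))"
  have t: "0 < t" "t \<le> \<rho>" using constants C_pos assms by (auto simp: t_def)
  have "C * (2 * t) \<le> C * (2 * (\<epsilon> / (2 * C)))"
    using C_pos by (intro mult_left_mono) (auto simp: t_def)
  then have Ct: "C * (2 * t) \<le> \<epsilon>" using C_pos by simp
  let ?x = "\<lambda>i. (f ^^ i) x" and ?c = "\<lambda>i. p ((f ^^ i) x)"
  define U where "U i = fst (?c i) \<inter> snd (?c i) -` ball (snd (?c i) (?x i)) t" for i
  have oU: "open (U i)" for i
  proof -
    have "?c i \<in> A" using p_chart funpow_in assms by blast
    then show ?thesis
      unfolding U_def using continuous_on_open_vimage[OF open_chart_domain, of "?c i" "snd (?c i)"]
        continuous_on_chart[of "?c i"] by (auto simp: Int_commute)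
  qed
  have U: "rdist A g a b \<le> ennreal \<epsilon>" if "a \<in> U i" "b \<in> U i" for a b i
  proof -
    have xi: "?x i \<in> \<Lambda>" using funpow_in assms by blast
    have ab: "a \<in> fst (?c i)" "b \<in> fst (?c i)" "dist (snd (?c i) (?x i)) (snd (?c i) a) < t"
        "dist (snd (?c i) (?x i)) (snd (?c i) b) < t"
      using that by (auto simp: U_def)
    have "rdist A g a b \<le> ennreal (C * dist (snd (?c i) a) (snd (?c i) b))"
      by (rule rdist_le_chart_dist[OF p_chart(1)[OF xi] p_chart(3)[OF xi]]) (use ab t in auto)
    also have "\<dots> \<le> ennreal (C * (2 * t))"
      using ab C_pos dist_triangle3[of "snd (?c i) a" "snd (?c i) b" "snd (?c i) (?x i)"]
      by (intro ennreal_leI mult_left_mono) auto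
    also have "\<dots> \<le> ennreal \<epsilon>" using Ct by (rule ennreal_leI)
    finally show ?thesis .
  qed
  define V where "V = (\<Inter>i\<in>{..<k}. (f ^^ i) -` U i)"
  have "open V" unfolding V_def
    using fk by (intro open_INT ballI open_vimage oU) (auto simp: Ck_map_def)
  moreover have "x \<in> V"
    using t p_chart funpow_in assms by (auto simp: V_def U_def)
  moreover have "\<forall>a\<in>V. \<forall>b\<in>V. \<forall>i<k. rdist A g ((f ^^ i) a) ((f ^^ i) b) \<le> ennreal \<epsilon>"
    using U by (auto simp: V_def)
  ultimately show ?thesis by blast
qed

text \<open>By compactness finitely many sets cover \<open>\<Lambda>\<close> each of which contains at most one point of a
  separated set.  So the sizes of separated sets are bounded, and one of largest size cannot be
  enlarged.  Both orders of the arguments of the distance occur because separation is required for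
  ordered pairs.\<close>

lemma maximal_separated:
  assumes "0 < \<epsilon>"
  obtains E where "finite E" "E \<subseteq> \<Lambda>" "E \<noteq> {}" "separated A g f k \<epsilon> E"
    "\<And>x. x \<in> \<Lambda> \<Longrightarrow> \<exists>z\<in>E. (\<forall>i<k. rdist A g ((f ^^ i) x) ((f ^^ i) z) \<le> ennreal \<epsilon>) \<or>
      (\<forall>i<k. rdist A g ((f ^^ i) z) ((f ^^ i) x) \<le> ennreal \<epsilon>)"
proof -
  have "\<forall>x\<in>\<Lambda>. \<exists>V. open V \<and> x \<in> V \<and>
      (\<forall>a\<in>V. \<forall>b\<in>V. \<forall>i<k. rdist A g ((f ^^ i) a) ((f ^^ i) b) \<le> ennreal \<epsilon>)"
    using small_neighbourhood[OF assms] by simp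
  then obtain V where V: "\<forall>x\<in>\<Lambda>. open (V x) \<and> x \<in> V x \<and>
      (\<forall>a\<in>V x. \<forall>b\<in>V x. \<forall>i<k. rdist A g ((f ^^ i) a) ((f ^^ i) b) \<le> ennreal \<epsilon>)"
    by (rule bchoice[THEN exE])
  obtain Y where Y: "Y \<subseteq> \<Lambda>" "finite Y" "\<Lambda> \<subseteq> (\<Union>x\<in>Y. V x)"
    by (rule compactE_image[OF compact_Lambda, of \<Lambda> V]) (use V in auto)
  let ?P = "\<lambda>E. E \<subseteq> \<Lambda> \<and> separated A g f k \<epsilon> E"
  have bound: "finite E \<and> card E \<le> card Y" if E: "?P E" for E
  proof -
    have "\<forall>x\<in>E. \<exists>y\<in>Y. x \<in> V y" using E Y by blast
    then obtain y where y: "\<And>x. x \<in> E \<Longrightarrow> y x \<in> Y \<and> x \<in> V (y x)" by metis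
    have "inj_on y E"
    proof (rule inj_onI, rule ccontr)
      fix a b assume ab: "a \<in> E" "b \<in> E" "y a = y b" "a \<noteq> b"
      have "\<exists>i<k. rdist A g ((f ^^ i) a) ((f ^^ i) b) > ennreal \<epsilon>"
        using E ab(1,2,4) unfolding separated_def by blast
      then obtain i where i: "i < k" "rdist A g ((f ^^ i) a) ((f ^^ i) b) > ennreal \<epsilon>" by blast
      have "a \<in> V (y a)" "b \<in> V (y a)" "y a \<in> \<Lambda>"
        using y[OF ab(1)] y[OF ab(2)] ab(3) Y(1) by auto
      then have "rdist A g ((f ^^ i) a) ((f ^^ i) b) \<le> ennreal \<epsilon>" using V i(1) by blast
      then show False using i(2) by simp
    qed
    moreover have "y ` E \<subseteq> Y" using y by auto
    ultimately show ?thesis using Y(2) by (meson card_inj_on_le inj_on_finite)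
  qed
  have "?P {}" by (simp add: separated_def)
  then obtain E where E: "?P E" "finite E" "\<And>H. ?P H \<Longrightarrow> card H \<le> card E"
    using finite_max_card[of ?P "card Y"] bound by blast
  have max: "\<exists>z\<in>E. (\<forall>i<k. rdist A g ((f ^^ i) x) ((f ^^ i) z) \<le> ennreal \<epsilon>) \<or>
      (\<forall>i<k. rdist A g ((f ^^ i) z) ((f ^^ i) x) \<le> ennreal \<epsilon>)" if x: "x \<in> \<Lambda>" for x
  proof (rule ccontr)
    assume far: "\<not> ?thesis"
    show False
    proof (cases "x \<in> E")
      case True
      obtain i where "i < k" "\<not> rdist A g ((f ^^ i) x) ((f ^^ i) x) \<le> ennreal \<epsilon>" using far True by blast
      then show False using V x by blast
    next
      case False
      have "separated A g f k \<epsilon> (insert x E)"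
        using E(1) far unfolding separated_def by (auto simp: not_le)
      then have "card (insert x E) \<le> card E" using E(1) x by (intro E(3)) auto
      then show False using False E(2) by simp
    qed
  qed
  moreover have "E \<noteq> {}" using max nonempty by blast
  ultimately show thesis using that E by blast
qed

text \<open>The volume argument.  Every point \<open>x\<close> of \<open>\<Lambda>\<close> lies in the Bowen ball of some \<open>\<zeta> x\<close> in \<open>E\<close>, and the points
  for which \<open>\<zeta> x\<close> uses the chart \<open>j\<close> are treated together, so that all volumes are compared in one
  chart.  In this chart the balls of radius \<open>r / (4 C)\<close> around a maximal separated set of such points
  are contained in slightly larger Bowen balls.\<close>

lemma covering_number_bound:
  assumes \<sigma>: "growth_rate < \<sigma>" and "0 < \<delta>"
    and \<phi>: "\<And>x. x \<in> \<Lambda> \<Longrightarrow> \<phi> x = - ln (rabs_det g x (f x) (mderiv A f x))"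
  obtains \<epsilon> D B where "0 < \<epsilon>" "0 < D" "0 < B"
    "\<And>k r. 1 \<le> k \<Longrightarrow> 0 < r \<Longrightarrow> r \<le> D * exp (- (real k * \<sigma>)) \<Longrightarrow>
      \<exists>E F. E \<subseteq> \<Lambda> \<and> finite E \<and> E \<noteq> {} \<and> separated A g f k \<epsilon> E \<and>
        finite F \<and> \<Lambda> \<subseteq> (\<Union>x\<in>F. {y. rdist A g x y < ennreal r}) \<and>
        real (card F) \<le> B / r ^ CARD('n) * exp (real k * \<delta>) * (\<Sum>z\<in>E. exp (\<Sum>i<k. \<phi> ((f ^^ i) z)))"
proof -
  have "eventually (\<lambda>r. (\<forall>x\<in>\<Lambda>. \<forall>y t. near t x y \<and> t \<le> r \<longrightarrow> near (2 * C / \<kappa> * max_stretch 1 * t) (f x) (f y))) (at_right 0)"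
    using Lipschitz_near[OF fk funpow_image max_stretch_pos rop_norm_le_max_stretch, of 1] by simp
  moreover have "eventually (\<lambda>r. r < \<rho>) (at_right 0)"
    using eventually_at_right_0_iff constants by blast
  moreover have "eventually (\<lambda>r::real. 0 < r) (at_right 0)" by (simp add: eventually_at_right_less)
  ultimately have "eventually (\<lambda>\<eta>. 0 < \<eta> \<and> \<eta> < \<rho> \<and>
      (\<forall>x\<in>\<Lambda>. \<forall>y t. near t x y \<and> t \<le> \<eta> \<longrightarrow> near (2 * C / \<kappa> * max_stretch 1 * t) (f x) (f y)) \<and>
      (\<forall>x\<in>\<Lambda>. inj_on (local_map x) (cball (snd (p x) x) \<eta>) \<and>
      (\<forall>y\<in>cball (snd (p x) x) \<eta>. (local_map x has_derivative local_deriv x y) (at y) \<and>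
         exp (- \<delta>) * jac x \<le> \<bar>det (matrix (local_deriv x y))\<bar>))) (at_right 0)"
    using distortion[OF \<open>0 < \<delta>\<close>] by eventually_elim blast
  then obtain \<eta> where all: "0 < \<eta> \<and> \<eta> < \<rho> \<and>
      (\<forall>x\<in>\<Lambda>. \<forall>y t. near t x y \<and> t \<le> \<eta> \<longrightarrow> near (2 * C / \<kappa> * max_stretch 1 * t) (f x) (f y)) \<and>
      (\<forall>x\<in>\<Lambda>. inj_on (local_map x) (cball (snd (p x) x) \<eta>) \<and>
      (\<forall>y\<in>cball (snd (p x) x) \<eta>. (local_map x has_derivative local_deriv x y) (at y) \<and>
         exp (- \<delta>) * jac x \<le> \<bar>det (matrix (local_deriv x y))\<bar>))"
    by (rule eventually_happens'[OF trivial_limit_at_right_real, THEN exE])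
  have \<eta>: "0 < \<eta>" "\<eta> < \<rho>" using all by blast+
  have Lip: "near (2 * C / \<kappa> * max_stretch 1 * t) (f x) (f y)" if "x \<in> \<Lambda>" "near t x y" "t \<le> \<eta>" for x y t
    using all that by blast
  have inj: "inj_on (local_map x) (cball (snd (p x) x) \<eta>)" if "x \<in> \<Lambda>" for x
    using all that by blast
  have der: "(local_map x has_derivative local_deriv x y) (at y)"
    if "x \<in> \<Lambda>" "y \<in> cball (snd (p x) x) \<eta>" for x y
    using all that by blast
  have jac: "exp (- \<delta>) * jac x \<le> \<bar>det (matrix (local_deriv x y))\<bar>"
    if "x \<in> \<Lambda>" "y \<in> cball (snd (p x) x) \<eta>" for x y
    using all that by blast
  define R where "R = 2 * C / \<kappa> * max_stretch 1 * \<eta>"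
  have "0 \<le> R" using C_pos constants max_stretch_pos[of 1] \<eta> by (simp add: R_def)
  \<comment> \<open>so that \<open>\<eta> / 2 + C * b / \<kappa> = \<eta>\<close>, which is the distance that \<open>near_trans\<close> yields\<close>
  define b where "b = \<kappa> * \<eta> / (2 * C)"
  have b: "0 < b" "b \<le> \<eta> / 2" "C * b / \<kappa> = \<eta> / 2" "C * b < \<kappa> * (\<rho> / 2)"
  proof -
    show "0 < b" using constants C_pos \<eta> by (simp add: b_def)
    have "\<kappa> * \<eta> \<le> C * \<eta>" using constants \<eta> by (intro mult_right_mono) auto
    then show "b \<le> \<eta> / 2" using C_pos by (simp add: b_def field_simps)
    show "C * b / \<kappa> = \<eta> / 2" using constants C_pos by (simp add: b_def)
    have "C * b = \<kappa> * (\<eta> / 2)" using C_pos by (simp add: b_def)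
    then show "C * b < \<kappa> * (\<rho> / 2)" using \<eta> constants by simp
  qed
  define \<epsilon> where "\<epsilon> = \<kappa> * b"
  have "0 < \<epsilon>" using b constants by (simp add: \<epsilon>_def)
  obtain D0 where D0: "0 < D0" "\<And>k x y i. x \<in> \<Lambda> \<Longrightarrow> near (D0 * exp (- (real k * \<sigma>))) x y \<Longrightarrow> i \<le> k \<Longrightarrow>
      near b ((f ^^ i) x) ((f ^^ i) y)"
    using near_iterates[OF \<sigma> b(1)] by blast
  \<comment> \<open>points at distance \<open>r / (4 C)\<close> in one chart have distance at most \<open>r / (4 \<kappa>)\<close> in another one\<close>
  define D where "D = 4 * \<kappa> * min D0 (\<rho> / 4)"
  have "0 < D" using D0 constants by (simp add: D_def)
  have "0 < \<sigma>" using \<sigma> growth_rate(2) by linarith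
  obtain w0 w1 where w: "0 < w0" "\<And>x. x \<in> \<Lambda> \<Longrightarrow> w0 \<le> chart_volume (p x) x"
      "\<And>x. x \<in> \<Lambda> \<Longrightarrow> chart_volume (p x) x \<le> w1"
    using chart_volume_bound by metis
  have "0 < w1" using w nonempty by (metis all_not_in_conv less_le_trans)
  define V where "V = measure lebesgue (cball (0::real^'n) R)"
  have "0 \<le> V" by (simp add: V_def)
  have vol: "measure lebesgue (bowen_set \<eta> R k z) \<le> w1 / w0 * (V + 1) * exp (real k * \<delta>) * exp (\<Sum>i<k. \<phi> ((f ^^ i) z))"
    if z: "z \<in> \<Lambda>" for k z
  proof -
    let ?e = "exp (real k * \<delta>) * exp (\<Sum>i<k. \<phi> ((f ^^ i) z))"
    have "w0 * measure lebesgue (bowen_set \<eta> R k z) \<le> chart_volume (p z) z * measure lebesgue (bowen_set \<eta> R k z)"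
      using w(2)[OF z] by (intro mult_right_mono) auto
    also have "\<dots> \<le> w1 * V * exp (real k * \<delta>) * exp (\<Sum>i<k. \<phi> ((f ^^ i) z))"
      unfolding V_def by (rule measure_bowen_set_le[OF inj der jac \<open>0 \<le> R\<close> w(3) \<phi> z])
    also have "\<dots> \<le> w1 * (V + 1) * exp (real k * \<delta>) * exp (\<Sum>i<k. \<phi> ((f ^^ i) z))"
      using \<open>0 < w1\<close> by (intro mult_right_mono mult_left_mono) auto
    finally show ?thesis using w(1) by (simp add: field_simps)
  qed
  let ?n = "CARD('n)"
  let ?ub = "unit_ball_vol (real ?n)"
  have ub: "0 < ?ub" by (simp add: unit_ball_vol_pos)
  \<comment> \<open>\<open>V + 1\<close> rather than \<open>V\<close>, so that the constant is positive\<close>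
  define B where "B = w1 / w0 * (V + 1) * (4 * C) ^ ?n / ?ub"
  have "0 < B" using \<open>0 < w1\<close> w(1) \<open>0 \<le> V\<close> C_pos ub by (simp add: B_def)
  have main: "\<exists>E F. E \<subseteq> \<Lambda> \<and> finite E \<and> E \<noteq> {} \<and> separated A g f k \<epsilon> E \<and>
        finite F \<and> \<Lambda> \<subseteq> (\<Union>x\<in>F. {y. rdist A g x y < ennreal r}) \<and>
        real (card F) \<le> B / r ^ ?n * exp (real k * \<delta>) * (\<Sum>z\<in>E. exp (\<Sum>i<k. \<phi> ((f ^^ i) z)))"
    if k: "1 \<le> k" and r: "0 < r" "r \<le> D * exp (- (real k * \<sigma>))" for k r
  proof -
    have kr: "r / (4 * \<kappa>) \<le> D0 * exp (- (real k * \<sigma>))" "r / (4 * \<kappa>) \<le> \<rho> / 4" "r / (4 * C) \<le> \<rho> / 4"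
    proof -
      have "r / (4 * \<kappa>) \<le> min D0 (\<rho> / 4) * exp (- (real k * \<sigma>))"
        using r(2) constants by (simp add: D_def field_simps)
      moreover have "exp (- (real k * \<sigma>)) \<le> 1" using \<open>0 < \<sigma>\<close> by simp
      moreover have "min D0 (\<rho> / 4) * exp (- (real k * \<sigma>)) \<le> D0 * exp (- (real k * \<sigma>))"
        by (intro mult_right_mono) auto
      moreover have "min D0 (\<rho> / 4) * exp (- (real k * \<sigma>)) \<le> \<rho> / 4 * 1"
        using constants D0(1) \<open>0 < \<sigma>\<close> by (intro mult_mono) auto
      moreover have "r / (4 * C) \<le> r / (4 * \<kappa>)"
        using constants r(1) by (intro divide_left_mono) auto
      ultimately show "r / (4 * \<kappa>) \<le> D0 * exp (- (real k * \<sigma>))" "r / (4 * \<kappa>) \<le> \<rho> / 4" "r / (4 * C) \<le> \<rho> / 4"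
        by linarith+
    qed
    obtain E where E: "finite E" "E \<subseteq> \<Lambda>" "E \<noteq> {}" "separated A g f k \<epsilon> E"
        "\<And>x. x \<in> \<Lambda> \<Longrightarrow> \<exists>z\<in>E. (\<forall>i<k. rdist A g ((f ^^ i) x) ((f ^^ i) z) \<le> ennreal \<epsilon>) \<or>
          (\<forall>i<k. rdist A g ((f ^^ i) z) ((f ^^ i) x) \<le> ennreal \<epsilon>)"
      using maximal_separated[OF \<open>0 < \<epsilon>\<close>, of k] by blast
    have "\<exists>z\<in>E. \<forall>i<k. near (\<eta> / 2) ((f ^^ i) z) ((f ^^ i) x)" if x: "x \<in> \<Lambda>" for x
    proof -
      obtain z where z: "z \<in> E" "(\<forall>i<k. rdist A g ((f ^^ i) x) ((f ^^ i) z) \<le> ennreal \<epsilon>) \<or>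
          (\<forall>i<k. rdist A g ((f ^^ i) z) ((f ^^ i) x) \<le> ennreal \<epsilon>)"
        using E(5)[OF x] by blast
      have zL: "z \<in> \<Lambda>" using z E by auto
      have "near (\<eta> / 2) ((f ^^ i) z) ((f ^^ i) x)" if "i < k" for i
        using z(2)
      proof
        assume "\<forall>i<k. rdist A g ((f ^^ i) x) ((f ^^ i) z) \<le> ennreal \<epsilon>"
        then have "near (C * b / \<kappa>) ((f ^^ i) z) ((f ^^ i) x)"
          using that b \<eta> by (intro rdist_imp_near_sym funpow_in x zL) (auto simp: \<epsilon>_def)
        then show ?thesis by (simp only: b(3))
      next
        assume "\<forall>i<k. rdist A g ((f ^^ i) z) ((f ^^ i) x) \<le> ennreal \<epsilon>"
        then have "near b ((f ^^ i) z) ((f ^^ i) x)"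
          using that b \<eta> by (intro rdist_imp_near funpow_in zL) (auto simp: \<epsilon>_def)
        then show ?thesis using b(2) by (rule near_mono)
      qed
      then show ?thesis using z(1) by blast
    qed
    then obtain \<zeta> where \<zeta>: "\<And>x. x \<in> \<Lambda> \<Longrightarrow> \<zeta> x \<in> E"
        "\<And>x i. x \<in> \<Lambda> \<Longrightarrow> i < k \<Longrightarrow> near (\<eta> / 2) ((f ^^ i) (\<zeta> x)) ((f ^^ i) x)"
      by metis
    have \<zeta>\<Lambda>: "\<zeta> x \<in> \<Lambda>" if "x \<in> \<Lambda>" for x using \<zeta>(1)[OF that] E by auto
    define \<tau> where "\<tau> = r / (4 * C)"
    have \<tau>: "0 < \<tau>" "\<tau> \<le> \<rho> / 4" "C * \<tau> = r / 4" using r C_pos kr by (auto simp: \<tau>_def)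
    let ?\<Lambda> = "\<lambda>j. {x\<in>\<Lambda>. p (\<zeta> x) = j}" and ?E = "\<lambda>j. {z\<in>E. p z = j}"
    let ?P = "\<lambda>j G. finite G \<and> G \<subseteq> ?\<Lambda> j \<and> (\<forall>x\<in>G. \<forall>y\<in>G. x \<noteq> y \<longrightarrow> 2 * \<tau> \<le> dist (snd j x) (snd j y))"
    let ?M = "\<lambda>j. \<Sum>z\<in>?E j. measure lebesgue (bowen_set \<eta> R k z)"
    have base: "x \<in> fst (p (\<zeta> x))" "dist (snd (p (\<zeta> x)) (\<zeta> x)) (snd (p (\<zeta> x)) x) \<le> \<eta> / 2" if "x \<in> \<Lambda>" for x
      using \<zeta>(2)[OF that, of 0] k by (auto simp: near_def)
    have ball_sub: "ball (snd j x) \<tau> \<subseteq> (\<Union>z\<in>?E j. bowen_set \<eta> R k z)" if j: "x \<in> ?\<Lambda> j" for j x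
    proof
      fix y assume y: "y \<in> ball (snd j x) \<tau>"
      let ?z = "\<zeta> x"
      have x: "x \<in> \<Lambda>" "p ?z = j" using j by auto
      have z: "?z \<in> \<Lambda>" "j \<in> I" "?z \<in> K j" "j \<in> A" using \<zeta>\<Lambda>[OF x(1)] p_chart x(2) by blast+
      have dx: "x \<in> fst j" "dist (snd j ?z) (snd j x) \<le> \<eta> / 2" using base[OF x(1)] x(2) by auto
      have dy: "dist (snd j ?z) y \<le> \<rho>"
        using dx(2) y \<tau>(2) \<eta> dist_triangle[of "snd j ?z" y "snd j x"] by simp
      then have "y \<in> snd j ` fst j" using cball_chart[OF z(2,3)] by auto
      then obtain y' where y': "y' \<in> fst j" "y = snd j y'" by auto
      have "rdist A g x y' \<le> ennreal (C * dist (snd j x) (snd j y'))"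
        by (rule rdist_le_chart_dist[OF z(2,3)]) (use dx dy y' \<eta> in auto)
      also have "\<dots> \<le> ennreal (\<kappa> * (r / (4 * \<kappa>)))"
      proof (rule ennreal_leI)
        have "C * dist (snd j x) (snd j y') \<le> C * \<tau>" using y y' C_pos by (intro mult_left_mono) auto
        then show "C * dist (snd j x) (snd j y') \<le> \<kappa> * (r / (4 * \<kappa>))" using \<tau>(3) constants by simp
      qed
      finally have "near (r / (4 * \<kappa>)) x y'"
        by (rule rdist_imp_near[OF x(1)]) (use r kr constants in auto)
      then have "near (D0 * exp (- (real k * \<sigma>))) x y'" using kr(1) by (rule near_mono)
      then have nb: "near b ((f ^^ i) x) ((f ^^ i) y')" if "i \<le> k" for i
        using that by (rule D0(2)[OF x(1)])
      have "near (\<eta> / 2 + C * b / \<kappa>) ((f ^^ i) ?z) ((f ^^ i) y')" if "i < k" for i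
        by (rule near_trans[OF funpow_in[OF z(1)] funpow_in[OF x(1)] \<zeta>(2)[OF x(1) that] _ nb])
          (use that b \<eta> in auto)
      then have "near \<eta> ((f ^^ i) ?z) ((f ^^ i) y')" if "i \<le> k - 1" for i
        using that k b(3) by (simp add: less_eq_Suc_le)
      then have "snd (p ?z) y' \<in> bowen_set \<eta> R (Suc (k - 1)) ?z"
        by (intro bowen_set_I[OF Lip _ z(1)]) (auto simp: R_def)
      then show "y \<in> (\<Union>z\<in>?E j. bowen_set \<eta> R k z)"
        using k \<zeta>(1)[OF x(1)] x(2) y'(2) by auto
    qed
    have vol_count: "real (card G) * (?ub * \<tau> ^ ?n) \<le> ?M j" if PG: "?P j G" for j G
    proof (rule card_le_of_disjoint_balls[where a="snd j"])
      show "compact (bowen_set \<eta> R k z)" if "z \<in> ?E j" for z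
        by (rule compact_bowen_set[OF der]) (use that E in auto)
      show "finite G" using PG by blast
      show "finite (?E j)" using E(1) by simp
      show "2 * \<tau> \<le> dist (snd j x) (snd j y)" if "x \<in> G" "y \<in> G" "x \<noteq> y" for x y
        using PG that by blast
      show "ball (snd j x) \<tau> \<subseteq> (\<Union>z\<in>?E j. bowen_set \<eta> R k z)" if "x \<in> G" for x
        by (rule ball_sub) (use PG that in blast)
    qed (rule \<tau>(1))
    have "\<exists>G. ?P j G \<and> (\<forall>H. ?P j H \<longrightarrow> card H \<le> card G)" for j
    proof -
      have pos: "0 < ?ub * \<tau> ^ ?n" using ub \<tau> by simp
      have "finite G \<and> card G \<le> nat \<lceil>?M j / (?ub * \<tau> ^ ?n)\<rceil>" if "?P j G" for G
      proof -
        have "real (card G) \<le> ?M j / (?ub * \<tau> ^ ?n)"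
          using vol_count[OF that] pos by (simp add: pos_le_divide_eq)
        then show ?thesis using that by (simp add: le_nat_iff le_ceiling_iff)
      qed
      then show ?thesis by (rule finite_max_card[of "?P j", rotated]) auto
    qed
    then have "\<forall>j. \<exists>G. ?P j G \<and> (\<forall>H. ?P j H \<longrightarrow> card H \<le> card G)" by (rule allI)
    then obtain G where G_all: "\<forall>j. ?P j (G j) \<and> (\<forall>H. ?P j H \<longrightarrow> card H \<le> card (G j))"
      by (rule choice[THEN exE])
    have G: "?P j (G j)" for j by (rule conjunct1[OF spec[OF G_all]])
    have G_max: "card H \<le> card (G j)" if "?P j H" for j H
      by (rule mp[OF spec[OF conjunct2[OF spec[OF G_all]]] that])
    define F where "F = (\<Union>j\<in>I. G j)"
    have finF: "finite F" unfolding F_def using finite_I G by blast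
    have cover: "\<Lambda> \<subseteq> (\<Union>x\<in>F. {y. rdist A g x y < ennreal r})"
    proof
      fix x assume x: "x \<in> \<Lambda>"
      define j where "j = p (\<zeta> x)"
      have jI: "j \<in> I" using p_chart \<zeta>\<Lambda>[OF x] by (simp add: j_def)
      have "\<exists>a\<in>G j. dist (snd j a) (snd j x) < 2 * \<tau>"
      proof (rule ccontr)
        assume far: "\<not> ?thesis"
        have "x \<notin> G j" using far \<tau>(1) by force
        have "?P j (insert x (G j))"
          using far G[of j] x by (auto simp: not_less j_def dist_commute)
        then have "card (insert x (G j)) \<le> card (G j)" by (rule G_max)
        then show False using \<open>x \<notin> G j\<close> G[of j] by simp
      qed
      then obtain a where a: "a \<in> G j" "dist (snd j a) (snd j x) < 2 * \<tau>" by blast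
      have a': "a \<in> \<Lambda>" "p (\<zeta> a) = j" using a(1) G[of j] by auto
      have z: "\<zeta> a \<in> K j" using p_chart(3)[OF \<zeta>\<Lambda>[OF a'(1)]] a'(2) by simp
      have da: "a \<in> fst j" "dist (snd j (\<zeta> a)) (snd j a) \<le> \<eta> / 2" using base[OF a'(1)] a'(2) by auto
      have dx: "dist (snd j (\<zeta> a)) (snd j x) \<le> \<rho>"
        using dist_triangle[of "snd j (\<zeta> a)" "snd j x" "snd j a"] a(2) da(2) \<eta> \<tau>(2) by linarith
      have "rdist A g a x \<le> ennreal (C * dist (snd j a) (snd j x))"
        by (rule rdist_le_chart_dist[OF jI z da(1)]) (use base[OF x] da dx \<eta> in \<open>auto simp: j_def\<close>)
      also have "\<dots> < ennreal r"
      proof (rule ennreal_lessI)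
        have "C * dist (snd j a) (snd j x) \<le> C * (2 * \<tau>)" using a(2) C_pos by (intro mult_left_mono) auto
        also have "\<dots> = r / 2" using \<tau>(3) by simp
        finally show "C * dist (snd j a) (snd j x) < r" using r by simp
      qed (use r in auto)
      finally show "x \<in> (\<Union>x\<in>F. {y. rdist A g x y < ennreal r})"
        using a(1) jI by (auto simp: F_def)
    qed
    have "real (card F) * (?ub * \<tau> ^ ?n) \<le> (\<Sum>j\<in>I. real (card (G j))) * (?ub * \<tau> ^ ?n)"
      unfolding F_def of_nat_sum[symmetric] using ub \<tau>(1)
      by (intro mult_right_mono of_nat_mono card_UN_le finite_I) auto
    also have "\<dots> \<le> (\<Sum>j\<in>I. ?M j)"
      unfolding sum_distrib_right by (intro sum_mono vol_count G)
    also have "\<dots> = (\<Sum>z\<in>E. measure lebesgue (bowen_set \<eta> R k z))"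
      by (rule sum.group[OF E(1) finite_I]) (use E p_chart in auto)
    also have "\<dots> \<le> (\<Sum>z\<in>E. w1 / w0 * (V + 1) * exp (real k * \<delta>) * exp (\<Sum>i<k. \<phi> ((f ^^ i) z)))"
      by (intro sum_mono vol) (use E in auto)
    finally have "real (card F) * (?ub * \<tau> ^ ?n) \<le> w1 / w0 * (V + 1) * exp (real k * \<delta>) * (\<Sum>z\<in>E. exp (\<Sum>i<k. \<phi> ((f ^^ i) z)))"
      by (simp add: sum_distrib_left)
    then have "real (card F) \<le> w1 / w0 * (V + 1) * exp (real k * \<delta>) * (\<Sum>z\<in>E. exp (\<Sum>i<k. \<phi> ((f ^^ i) z))) / (?ub * \<tau> ^ ?n)"
      by (rule pos_le_divide_eq[THEN iffD2, rotated]) (use ub \<tau> in simp)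
    also have "\<dots> = B / r ^ ?n * exp (real k * \<delta>) * (\<Sum>z\<in>E. exp (\<Sum>i<k. \<phi> ((f ^^ i) z)))"
      using C_pos r by (simp add: B_def \<tau>_def power_divide mult_ac)
    finally show ?thesis using E finF cover by blast
  qed
  show thesis by (rule that[OF \<open>0 < \<epsilon>\<close> \<open>0 < D\<close> \<open>0 < B\<close> main])
qed

end


section \<open>Box dimension and pressure\<close>

lemma antimono_tendsto_SUP:
  fixes h :: "real \<Rightarrow> ereal"
  assumes "\<And>x y. 0 < x \<Longrightarrow> x \<le> y \<Longrightarrow> h y \<le> h x"
  shows "(h \<longlongrightarrow> (SUP x\<in>{0<..}. h x)) (at_right 0)"
proof (rule order_tendstoI)
  fix a assume "a < (SUP x\<in>{0<..}. h x)"
  then obtain e where "0 < e" "a < h e" unfolding less_SUP_iff by auto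
  then show "eventually (\<lambda>x. a < h x) (at_right 0)"
    by (intro eventually_at_right_0_mono[of e]) (auto intro: less_le_trans assms)
next
  fix a assume less: "(SUP x\<in>{0<..}. h x) < a"
  have "h x < a" if "0 < x" for x
    by (rule le_less_trans[OF SUP_upper less]) (use that in auto)
  then show "eventually (\<lambda>x. h x < a) (at_right 0)"
    unfolding eventually_at_right_0_iff by (intro exI[of _ 1]) auto
qed

text \<open>A smaller scale admits more separated sets.  So the limit over the scales exists and is the
  supremum over all scales.\<close>

lemma pressure_scale_le:
  assumes "0 < \<epsilon>"
  shows "limsup (\<lambda>k. SUP E\<in>{E. E \<subseteq> X \<and> finite E \<and> E \<noteq> {} \<and> separated A g f k \<epsilon> E}.
      ereal (ln (\<Sum>x\<in>E. exp (\<Sum>i<k. \<phi> ((f ^^ i) x))) / real k)) \<le> pressure A g f X \<phi>"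
proof -
  define h where "h \<epsilon> = limsup (\<lambda>k. SUP E\<in>{E. E \<subseteq> X \<and> finite E \<and> E \<noteq> {} \<and> separated A g f k \<epsilon> E}.
      ereal (ln (\<Sum>x\<in>E. exp (\<Sum>i<k. \<phi> ((f ^^ i) x))) / real k))" for \<epsilon>
  have sep: "separated A g f k x E" if "separated A g f k y E" "x \<le> y" for k x y E
    using that ennreal_leI[OF that(2)] unfolding separated_def by (meson le_less_trans)
  have "h y \<le> h x" if "0 < x" "x \<le> y" for x y
    unfolding h_def
    by (intro Limsup_mono always_eventually allI SUP_subset_mono) (use sep that in auto)
  then have "(h \<longlongrightarrow> (SUP x\<in>{0<..}. h x)) (at_right 0)" by (rule antimono_tendsto_SUP)
  then have "Lim (at_right 0) h = (SUP x\<in>{0<..}. h x)"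
    by (intro tendsto_Lim) simp_all
  then have "pressure A g f X \<phi> = (SUP x\<in>{0<..}. h x)"
    unfolding pressure_def h_def .
  moreover have "h \<epsilon> \<le> (SUP x\<in>{0<..}. h x)" by (rule SUP_upper) (use assms in simp)
  ultimately show ?thesis by (simp add: h_def)
qed

context charted_repeller
begin

text \<open>For small \<open>r\<close> let \<open>k\<close> be the largest integer allowed by \<open>covering_number_bound\<close>.  It differs from
  \<open>ln (1 / r) / \<sigma>\<close> by a bounded amount, whatever the sign of \<open>q + \<delta>\<close>, so that all other terms disappear in
  the limit.\<close>

lemma upper_box_dim_le_perturbed:
  assumes \<sigma>: "growth_rate < \<sigma>" and "0 < \<delta>" and P: "pressure A g f \<Lambda> \<phi> < ereal q"
    and \<phi>: "\<And>x. x \<in> \<Lambda> \<Longrightarrow> \<phi> x = - ln (rabs_det g x (f x) (mderiv A f x))"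
  shows "upper_box_dim A g \<Lambda> \<le> ereal (real CARD('n) + (q + \<delta>) / \<sigma>)"
proof -
  let ?n = "real CARD('n)"
  have "0 < \<sigma>" using \<sigma> growth_rate(2) by linarith
  obtain \<epsilon> D B where c: "0 < \<epsilon>" "0 < D" "0 < B"
    "\<And>k r. 1 \<le> k \<Longrightarrow> 0 < r \<Longrightarrow> r \<le> D * exp (- (real k * \<sigma>)) \<Longrightarrow>
      \<exists>E F. E \<subseteq> \<Lambda> \<and> finite E \<and> E \<noteq> {} \<and> separated A g f k \<epsilon> E \<and>
        finite F \<and> \<Lambda> \<subseteq> (\<Union>x\<in>F. {y. rdist A g x y < ennreal r}) \<and>
        real (card F) \<le> B / r ^ CARD('n) * exp (real k * \<delta>) * (\<Sum>z\<in>E. exp (\<Sum>i<k. \<phi> ((f ^^ i) z)))"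
    by (rule covering_number_bound[OF \<sigma> \<open>0 < \<delta>\<close> \<phi>]) (assumption | rule that)+
  let ?S = "\<lambda>k. SUP E\<in>{E. E \<subseteq> \<Lambda> \<and> finite E \<and> E \<noteq> {} \<and> separated A g f k \<epsilon> E}.
      ereal (ln (\<Sum>x\<in>E. exp (\<Sum>i<k. \<phi> ((f ^^ i) x))) / real k)"
  have "limsup ?S < ereal q" using pressure_scale_le[OF c(1)] P by (rule le_less_trans)
  then have "eventually (\<lambda>k. ?S k < ereal q) sequentially" by (rule Limsup_lessD)
  then obtain k0 where k0: "\<And>k. k \<ge> k0 \<Longrightarrow> ?S k < ereal q"
    unfolding eventually_sequentially by auto
  have sum_le: "(\<Sum>z\<in>E. exp (\<Sum>i<k. \<phi> ((f ^^ i) z))) \<le> exp (real k * q)"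
    if "k \<ge> k0" "1 \<le> k" "E \<subseteq> \<Lambda>" "finite E" "E \<noteq> {}" "separated A g f k \<epsilon> E" for k E
  proof -
    let ?s = "\<Sum>z\<in>E. exp (\<Sum>i<k. \<phi> ((f ^^ i) z))"
    have "0 < ?s" using that by (intro sum_pos) auto
    have "ereal (ln ?s / real k) \<le> ?S k" by (rule SUP_upper) (use that in auto)
    then have "ereal (ln ?s / real k) < ereal q" using k0[OF that(1)] by (rule le_less_trans)
    then have "ln ?s / real k < q" by simp
    then have "ln ?s \<le> real k * q" using that(2) by (simp add: field_simps)
    then have "exp (ln ?s) \<le> exp (real k * q)" by simp
    then show ?thesis using \<open>0 < ?s\<close> by simp
  qed
  define k where "k r = nat \<lfloor>(ln D + ln (1 / r)) / \<sigma>\<rfloor>" for r :: real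
  \<comment> \<open>\<open>m\<close> guarantees \<open>k r \<ge> 1\<close> and \<open>k r \<ge> k0\<close>; \<open>Q\<close> collects the bounded terms\<close>
  define m where "m = max 1 (real k0 + 1)"
  define Q where "Q = \<bar>ln B\<bar> + \<bar>q + \<delta>\<bar> * (\<bar>ln D\<bar> / \<sigma> + 1)"
  let ?d = "?n + (q + \<delta>) / \<sigma>"
  have "filterlim (\<lambda>r. ln (1 / r)) at_top (at_right (0::real))"
  proof -
    have neg: "filterlim (\<lambda>r. - ln r) at_top (at_right (0::real))"
      by (rule filterlim_uminus_at_bot[THEN iffD1, OF ln_at_0])
    have "eventually (\<lambda>r. - ln r = ln (1 / r)) (at_right (0::real))"
      using eventually_at_right_less[of 0] by eventually_elim (simp add: ln_div)
    from filterlim_cong[OF refl refl this] show ?thesis using neg by (rule iffD1)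
  qed
  note lim = this
  have large: "eventually (\<lambda>r. M \<le> ln (1 / r)) (at_right (0::real))" for M
    using lim by (simp add: filterlim_at_top)
  have bound: "eventually (\<lambda>r. (INF F\<in>{F. finite F \<and> \<Lambda> \<subseteq> (\<Union>x\<in>F. {y. rdist A g x y < ennreal r})}.
         ereal (ln (real (card F)) / ln (1 / r))) \<le> ereal (Q / ln (1 / r) + ?d)) (at_right 0)"
    using large[of "m * \<sigma> - ln D"] large[of 1] eventually_at_right_less[of 0]
  proof eventually_elim
    case (elim r)
    let ?l = "ln (1 / r)"
    have r: "0 < r" using elim by simp
    let ?t = "(ln D + ?l) / \<sigma>"
    have "m \<le> ?t" using elim(1) \<open>0 < \<sigma>\<close> by (simp add: field_simps)
    then have "real k0 + 1 \<le> ?t" "1 \<le> ?t" by (auto simp: m_def)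
    have kt: "real (k r) \<le> ?t" "?t \<le> real (k r) + 1"
      using \<open>1 \<le> ?t\<close> unfolding k_def by linarith+
    have k1: "1 \<le> k r" "k0 \<le> k r"
      using \<open>1 \<le> ?t\<close> \<open>real k0 + 1 \<le> ?t\<close> kt unfolding k_def by linarith+
    have "real (k r) * \<sigma> \<le> ln D + ?l" using kt(1) \<open>0 < \<sigma>\<close> by (simp add: field_simps)
    then have "ln r \<le> ln D - real (k r) * \<sigma>" using r by (simp add: ln_div)
    then have "exp (ln r) \<le> exp (ln D + - (real (k r) * \<sigma>))" by simp
    then have "r \<le> D * exp (- (real (k r) * \<sigma>))" using r c(2) by (simp only: exp_add exp_ln)
    then obtain E F where EF: "E \<subseteq> \<Lambda>" "finite E" "E \<noteq> {}" "separated A g f (k r) \<epsilon> E"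
        "finite F" "\<Lambda> \<subseteq> (\<Union>x\<in>F. {y. rdist A g x y < ennreal r})"
        "real (card F) \<le> B / r ^ CARD('n) * exp (real (k r) * \<delta>) * (\<Sum>z\<in>E. exp (\<Sum>i<k r. \<phi> ((f ^^ i) z)))"
      using c(4)[OF k1(1) r] by blast
    have "F \<noteq> {}" using EF(6) nonempty by auto
    then have cF: "0 < card F" using EF(5) by (simp add: card_gt_0_iff)
    note EF(7)
    also have "B / r ^ CARD('n) * exp (real (k r) * \<delta>) * (\<Sum>z\<in>E. exp (\<Sum>i<k r. \<phi> ((f ^^ i) z))) \<le>
        B / r ^ CARD('n) * exp (real (k r) * \<delta>) * exp (real (k r) * q)"
      using sum_le[OF k1(2,1) EF(1-4)] c(3) r by (intro mult_left_mono) auto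
    finally have "ln (real (card F)) \<le> ln (B / r ^ CARD('n) * exp (real (k r) * \<delta>) * exp (real (k r) * q))"
      using cF by (intro ln_mono) auto
    also have "\<dots> = ln B + ?n * ?l + real (k r) * (q + \<delta>)"
      using c(3) r by (simp add: ln_mult ln_div ln_realpow algebra_simps)
    also have "real (k r) * (q + \<delta>) \<le> (q + \<delta>) / \<sigma> * ?l + \<bar>q + \<delta>\<bar> * (\<bar>ln D\<bar> / \<sigma> + 1)"
    proof -
      have "\<bar>real (k r) - ?l / \<sigma>\<bar> \<le> \<bar>ln D\<bar> / \<sigma> + 1"
      proof -
        have "?t = ln D / \<sigma> + ?l / \<sigma>" by (simp add: add_divide_distrib)
        moreover have "ln D / \<sigma> \<le> \<bar>ln D\<bar> / \<sigma>" "- (\<bar>ln D\<bar> / \<sigma>) \<le> ln D / \<sigma>"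
          using \<open>0 < \<sigma>\<close> by (simp_all add: divide_right_mono field_simps)
        ultimately show ?thesis using kt by linarith
      qed
      then have "\<bar>q + \<delta>\<bar> * \<bar>real (k r) - ?l / \<sigma>\<bar> \<le> \<bar>q + \<delta>\<bar> * (\<bar>ln D\<bar> / \<sigma> + 1)"
        by (intro mult_left_mono) auto
      then have "(q + \<delta>) * (real (k r) - ?l / \<sigma>) \<le> \<bar>q + \<delta>\<bar> * (\<bar>ln D\<bar> / \<sigma> + 1)"
        unfolding abs_mult[symmetric] by (rule order_trans[OF abs_ge_self])
      then show ?thesis by (simp add: algebra_simps)
    qed
    finally have "ln (real (card F)) \<le> Q + ?d * ?l"
      unfolding Q_def using abs_ge_self[of "ln B"] by (simp add: algebra_simps)
    then have "ln (real (card F)) / ?l \<le> (Q + ?d * ?l) / ?l"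
      using elim(2) by (intro divide_right_mono) auto
    also have "\<dots> = Q / ?l + ?d" using elim(2) by (simp add: add_divide_distrib)
    finally have "ereal (ln (real (card F)) / ?l) \<le> ereal (Q / ?l + ?d)" by simp
    then show ?case
      by (rule INF_lower2[rotated]) (use EF in simp)
  qed
  have "((\<lambda>r. Q / ln (1 / r) + ?d) \<longlongrightarrow> 0 + ?d) (at_right 0)"
    by (intro tendsto_add tendsto_const real_tendsto_divide_at_top[OF tendsto_const lim])
  then have "((\<lambda>r. ereal (Q / ln (1 / r) + ?d)) \<longlongrightarrow> ereal (0 + ?d)) (at_right 0)"
    by (intro tendsto_ereal)
  then have "Limsup (at_right 0) (\<lambda>r. ereal (Q / ln (1 / r) + ?d)) = ereal (0 + ?d)"
    by (intro lim_imp_Limsup) simp_all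
  then show ?thesis
    unfolding upper_box_dim_def using Limsup_mono[OF bound] by simp
qed

text \<open>Let first \<open>\<delta>\<close> and \<open>\<sigma> = growth_rate + \<delta>\<close>, and then \<open>q\<close>, tend to their limits.  For infinite
  pressure there is either no such \<open>q\<close>, or \<open>q\<close> tends to \<open>- \<infinity>\<close>.\<close>

lemma upper_box_dim_le:
  assumes \<phi>: "\<And>x. x \<in> \<Lambda> \<Longrightarrow> \<phi> x = - ln (rabs_det g x (f x) (mderiv A f x))"
  shows "upper_box_dim A g \<Lambda> \<le> ereal (real CARD('n)) + pressure A g f \<Lambda> \<phi> / ereal growth_rate"
proof -
  let ?n = "real CARD('n)" and ?P = "pressure A g f \<Lambda> \<phi>" and ?s = growth_rate
  have s: "0 < ?s" by (rule growth_rate(2))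
  have fin: "upper_box_dim A g \<Lambda> \<le> ereal (?n + q / ?s)" if q: "?P < ereal q" for q
  proof -
    have "((\<lambda>d. ?n + (q + d) / (?s + d)) \<longlongrightarrow> ?n + (q + 0) / (?s + 0)) (at_right 0)"
      using s by (intro tendsto_intros) auto
    then have "((\<lambda>d. ereal (?n + (q + d) / (?s + d))) \<longlongrightarrow> ereal (?n + q / ?s)) (at_right 0)"
      by (intro tendsto_ereal) simp
    moreover have "eventually (\<lambda>d. upper_box_dim A g \<Lambda> \<le> ereal (?n + (q + d) / (?s + d))) (at_right 0)"
      using eventually_at_right_less[of 0]
      by eventually_elim (rule upper_box_dim_le_perturbed[OF _ _ q \<phi>]; simp)
    ultimately show ?thesis
      by (rule tendsto_lowerbound) simp
  qed
  show ?thesis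
  proof (cases ?P)
    case (real p)
    have "((\<lambda>q. ?n + q / ?s) \<longlongrightarrow> ?n + p / ?s) (at_right p)"
      using s by (intro tendsto_intros) auto
    then have "((\<lambda>q. ereal (?n + q / ?s)) \<longlongrightarrow> ereal (?n + p / ?s)) (at_right p)"
      by (intro tendsto_ereal)
    moreover have "eventually (\<lambda>q. upper_box_dim A g \<Lambda> \<le> ereal (?n + q / ?s)) (at_right p)"
      using eventually_at_right_less[of p] by eventually_elim (rule fin, simp add: real)
    ultimately have "upper_box_dim A g \<Lambda> \<le> ereal (?n + p / ?s)"
      by (rule tendsto_lowerbound) simp
    then show ?thesis using s by (simp add: real)
  next
    case PInf
    then show ?thesis using s by simp
  next
    case MInf
    have "upper_box_dim A g \<Lambda> \<le> ereal b" for b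
    proof -
      have "upper_box_dim A g \<Lambda> \<le> ereal (?n + ((b - ?n) * ?s) / ?s)" by (rule fin) (simp add: MInf)
      then show ?thesis using s by simp
    qed
    then have "upper_box_dim A g \<Lambda> = - \<infinity>" by (rule ereal_bot)
    then show ?thesis by simp
  qed
qed

end

text \<open>Finitely many charts have common constants.\<close>

lemma (in riemannian_manifold) charted_set_exists:
  assumes "compact \<Lambda>"
  obtains I K p \<rho> \<kappa> C where "charted_set A g \<Lambda> I K p \<rho> \<kappa> C"
proof -
  obtain I K where I: "finite I" "I \<subseteq> A" "\<And>c. c \<in> I \<Longrightarrow> compact (K c)"
      "\<And>c. c \<in> I \<Longrightarrow> K c \<subseteq> fst c" "\<Lambda> = (\<Union>c\<in>I. K c)"
    by (rule finite_chart_cover[OF assms]) (assumption | rule that)+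
  let ?ok = "\<lambda>c \<rho> \<kappa> C. \<forall>z\<in>K c. cball (snd c z) \<rho> \<subseteq> snd c ` fst c \<and>
    (\<forall>y\<in>cball (snd c z) \<rho>. \<forall>v.
      \<kappa> * norm v \<le> rnorm g (chart_inv c y) (tangent_of_coord A c (chart_inv c y) v) \<and>
      rnorm g (chart_inv c y) (tangent_of_coord A c (chart_inv c y) v) \<le> C * norm v)"
  have "\<forall>c\<in>I. \<exists>\<rho> \<kappa> C. 0 < \<rho> \<and> 0 < \<kappa> \<and> ?ok c \<rho> \<kappa> C"
  proof
    fix c assume "c \<in> I"
    then have "c \<in> A" "compact (K c)" "K c \<subseteq> fst c" using I by auto
    from chart_constants[OF this] show "\<exists>\<rho> \<kappa> C. 0 < \<rho> \<and> 0 < \<kappa> \<and> ?ok c \<rho> \<kappa> C" by blast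
  qed
  then obtain r where "\<forall>c\<in>I. \<exists>\<kappa> C. 0 < r c \<and> 0 < \<kappa> \<and> ?ok c (r c) \<kappa> C" by (rule bchoice[THEN exE])
  then obtain k where "\<forall>c\<in>I. \<exists>C. 0 < r c \<and> 0 < k c \<and> ?ok c (r c) (k c) C" by (rule bchoice[THEN exE])
  then obtain C where "\<forall>c\<in>I. 0 < r c \<and> 0 < k c \<and> ?ok c (r c) (k c) (C c)" by (rule bchoice[THEN exE])
  then have c: "0 < r c \<and> 0 < k c \<and> ?ok c (r c) (k c) (C c)" if "c \<in> I" for c
    using that by (rule bspec)
  define \<rho> where "\<rho> = Min (insert 1 (r ` I))"
  define \<kappa> where "\<kappa> = Min (insert 1 (k ` I))"
  define C' where "C' = Max (insert 1 (C ` I))"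
  have \<rho>: "0 < \<rho>" "\<And>c. c \<in> I \<Longrightarrow> \<rho> \<le> r c" using I(1) c by (auto simp: \<rho>_def)
  have \<kappa>: "0 < \<kappa>" "\<kappa> \<le> 1" "\<And>c. c \<in> I \<Longrightarrow> \<kappa> \<le> k c" using I(1) c by (auto simp: \<kappa>_def)
  have C': "1 \<le> C'" "\<And>c. c \<in> I \<Longrightarrow> C c \<le> C'" using I(1) by (auto simp: C'_def)
  have "\<forall>x\<in>\<Lambda>. \<exists>c. c \<in> I \<and> x \<in> K c" using I(5) by blast
  then obtain p where p: "\<forall>x\<in>\<Lambda>. p x \<in> I \<and> x \<in> K (p x)" by (rule bchoice[THEN exE])
  have "charted_set A g \<Lambda> I K p \<rho> \<kappa> C'"
  proof unfold_locales
    fix c z assume cz: "c \<in> I" "z \<in> K c"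
    have sub: "cball (snd c z) \<rho> \<subseteq> cball (snd c z) (r c)" using \<rho>(2)[OF cz(1)] by auto
    then show "cball (snd c z) \<rho> \<subseteq> snd c ` fst c" using c[OF cz(1)] cz(2) by blast
    fix y v :: "real^'n" assume "y \<in> cball (snd c z) \<rho>"
    then have y: "y \<in> cball (snd c z) (r c)" using sub by blast
    have "\<kappa> * norm v \<le> k c * norm v" "C c * norm v \<le> C' * norm v"
      using \<kappa>(3)[OF cz(1)] C'(2)[OF cz(1)] by (auto intro: mult_right_mono)
    moreover have "k c * norm v \<le> rnorm g (chart_inv c y) (tangent_of_coord A c (chart_inv c y) v)"
      "rnorm g (chart_inv c y) (tangent_of_coord A c (chart_inv c y) v) \<le> C c * norm v"
      using c[OF cz(1)] cz(2) y by blast+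
    ultimately show "\<kappa> * norm v \<le> rnorm g (chart_inv c y) (tangent_of_coord A c (chart_inv c y) v)"
      "rnorm g (chart_inv c y) (tangent_of_coord A c (chart_inv c y) v) \<le> C' * norm v"
      by linarith+
  qed (use I p \<rho> \<kappa> C' in auto)
  then show thesis by (rule that)
qed

theorem theorem9:
  fixes A :: "('m::{t2_space,second_countable_topology}, 'n::finite) chart set"
    and g :: "('m, 'n) metric_tensor"
    and f :: "'m \<Rightarrow> 'm"
    and \<Lambda> :: "'m set"
    and \<phi> :: "'m \<Rightarrow> real"
    and s :: real
  assumes "smooth_atlas A"
    and "riemannian_metric A g"
    and "Ck_map A 2 f"
    and "repeller A g f \<Lambda>"
    and "topologically_mixing_on f \<Lambda>"
    and "\<And>x. x \<in> \<Lambda> \<Longrightarrow> \<phi> x = - ln (rabs_det g x (f x) (mderiv A f x))"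
    and "s = lim (\<lambda>k. 1 / real k *
               ln (SUP x\<in>\<Lambda>. rop_norm g x ((f ^^ k) x) (mderiv A (f ^^ k) x)))"
  shows "upper_box_dim A g \<Lambda> \<le> ereal (real CARD('n)) + pressure A g f \<Lambda> \<phi> / ereal s"
proof -
  interpret riemannian_manifold A g
    using assms(1,2) by unfold_locales
  have \<Lambda>: "compact \<Lambda>" "\<Lambda> \<noteq> {}" "f ` \<Lambda> = \<Lambda>" "expanding_on A g f \<Lambda>"
    using assms(4) by (auto simp: repeller_def)
  obtain I K p \<rho> \<kappa> C where "charted_set A g \<Lambda> I K p \<rho> \<kappa> C"
    using charted_set_exists[OF \<Lambda>(1)] .
  then interpret charted_set A g \<Lambda> I K p \<rho> \<kappa> C .
  interpret charted_repeller A g \<Lambda> I K p \<rho> \<kappa> C f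
    using Ck_map_2_imp_1[OF assms(3)] \<Lambda> by unfold_locales auto
  have "s = growth_rate"
    unfolding assms(7) growth_rate_def max_stretch_def ..
  then show ?thesis using upper_box_dim_le[OF assms(6)] by simp
qed

end
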